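(* Let $Q$ be a probability distribution on $\mathbb{R}$ with $\int x\,Q(dx)=0$, $\int x^2\,Q(dx)=1/2$ and $\int x^4\,Q(dx)<\infty$, and let $X_N$ be the associated $N\times N$ Hermitian Wigner matrix. Let $\xi\in(-2,2)$ and $\mu,\nu\in\mathbb{R}$. For $\eta\in\mathbb{R}$ put $$D_N(\xi,\eta):=\det\!\left(X_N-\Big(\sqrt{N}\,\xi+\frac{\eta}{\sqrt{N}\,\varrho(\xi)}\Big)I_N\right),\qquad \varrho(\xi):=\frac{1}{2\pi}\sqrt{4-\xi^2}.$$ Then $$\lim_{N\to\infty}\frac{\mathbb{E}\big(D_N(\xi,\mu)\,D_N(\xi,\nu)\big)}{\sqrt{\mathbb{E}\,D_N(\xi,\mu)^2}\,\sqrt{\mathbb{E}\,D_N(\xi,\nu)^2}}=\frac{\sin\pi(\mu-\nu)}{\pi(\mu-\nu)},$$ where $\sin 0/0:=1$.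
   Context: Wigner matrix associated with $Q$: let $(X_{ii}/\sqrt2)_{i\in\mathbb{N}}$, $(X^{\mathrm{Re}}_{ij})_{i<j}$ and $(X^{\mathrm{Im}}_{ij})_{i<j}$ ($i,j\in\mathbb{N}$) be independent families of independent real random variables, all with distribution $Q$, on some probability space $(\Omega,\mathcal{F},\mathbb{P})$ with expectation $\mathbb{E}$. For $i<j$ put $X_{ij}:=X^{\mathrm{Re}}_{ij}+\mathbf{i}X^{\mathrm{Im}}_{ij}$ and $X_{ji}:=X^{\mathrm{Re}}_{ij}-\mathbf{i}X^{\mathrm{Im}}_{ij}$, where $\mathbf{i}$ is the imaginary unit. Then $X_N:=(X_{ij})_{1\le i,j\le N}$. $I_N$ denotes the $N\times N$ identity matrix. *)

theory Defs
  imports "HOL-Probability.Probability" "Jordan_Normal_Form.Determinant"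
begin

text \<open>
  Index type for the real random variables underlying a Hermitian Wigner matrix, so that the
  independence of all three families can be expressed as joint independence of one family.
  Only the real and imaginary parts with \<^term>\<open>i < j\<close> are independent variables.
\<close>

datatype wigner_index = Diag nat | RePart nat nat | ImPart nat nat

definition wigner_indices :: "wigner_index set" where
  "wigner_indices = range Diag \<union> {RePart i j |i j. i < j} \<union> {ImPart i j |i j. i < j}"

text \<open>
  The arguments \<open>Xd i\<close>, \<open>XRe i j\<close>, \<open>XIm i j\<close> are the diagonal entry at \<open>i\<close> and the real and imaginary
  parts of the entry at \<open>(i, j)\<close>. It is the diagonal entry divided by \<^term>\<open>sqrt 2\<close> that has law
  \<open>Q\<close> below, so diagonal entries have twice the variance of \<open>Q\<close>.
\<close>

fun wigner_variable ::
  "(nat \<Rightarrow> 'a \<Rightarrow> real) \<Rightarrow> (nat \<Rightarrow> nat \<Rightarrow> 'a \<Rightarrow> real) \<Rightarrow> (nat \<Rightarrow> nat \<Rightarrow> 'a \<Rightarrow> real)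
    \<Rightarrow> wigner_index \<Rightarrow> 'a \<Rightarrow> real" where
  "wigner_variable Xd XRe XIm (Diag i) = (\<lambda>\<omega>. Xd i \<omega> / sqrt 2)"
| "wigner_variable Xd XRe XIm (RePart i j) = XRe i j"
| "wigner_variable Xd XRe XIm (ImPart i j) = XIm i j"

locale hermitian_wigner = prob_space M
  for M :: "'a measure" and Q :: "real measure"
    and Xd :: "nat \<Rightarrow> 'a \<Rightarrow> real" and XRe XIm :: "nat \<Rightarrow> nat \<Rightarrow> 'a \<Rightarrow> real" +
  assumes indep: "indep_vars (\<lambda>_. borel) (wigner_variable Xd XRe XIm) wigner_indices"
    and identically_distributed:
      "\<And>k. k \<in> wigner_indices \<Longrightarrow> distr M borel (wigner_variable Xd XRe XIm k) = Q"

definition wigner_entry ::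
  "(nat \<Rightarrow> 'a \<Rightarrow> real) \<Rightarrow> (nat \<Rightarrow> nat \<Rightarrow> 'a \<Rightarrow> real) \<Rightarrow> (nat \<Rightarrow> nat \<Rightarrow> 'a \<Rightarrow> real)
    \<Rightarrow> 'a \<Rightarrow> nat \<Rightarrow> nat \<Rightarrow> complex" where
  "wigner_entry Xd XRe XIm \<omega> i j =
    (if i = j then complex_of_real (Xd i \<omega>)
     else if i < j then complex_of_real (XRe i j \<omega>) + \<i> * complex_of_real (XIm i j \<omega>)
     else complex_of_real (XRe j i \<omega>) - \<i> * complex_of_real (XIm j i \<omega>))"

text \<open>Rows and columns are numbered \<open>0, \<dots>, N - 1\<close>.\<close>

definition wigner_matrix ::
  "(nat \<Rightarrow> 'a \<Rightarrow> real) \<Rightarrow> (nat \<Rightarrow> nat \<Rightarrow> 'a \<Rightarrow> real) \<Rightarrow> (nat \<Rightarrow> nat \<Rightarrow> 'a \<Rightarrow> real)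
    \<Rightarrow> nat \<Rightarrow> 'a \<Rightarrow> complex mat" where
  "wigner_matrix Xd XRe XIm N \<omega> = Matrix.mat N N (\<lambda>(i, j). wigner_entry Xd XRe XIm \<omega> i j)"

definition semicircle_density :: "real \<Rightarrow> real" where
  "semicircle_density \<xi> = 1 / (2 * pi) * sqrt (4 - \<xi>\<^sup>2)"

text \<open>
  The determinant of the Hermitian matrix below is real (see \<open>of_real_wigner_det\<close>); taking its
  real part only changes the type.
\<close>

definition wigner_det ::
  "(nat \<Rightarrow> 'a \<Rightarrow> real) \<Rightarrow> (nat \<Rightarrow> nat \<Rightarrow> 'a \<Rightarrow> real) \<Rightarrow> (nat \<Rightarrow> nat \<Rightarrow> 'a \<Rightarrow> real)
    \<Rightarrow> nat \<Rightarrow> real \<Rightarrow> real \<Rightarrow> 'a \<Rightarrow> real" where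
  "wigner_det Xd XRe XIm N \<xi> \<eta> \<omega> =
    Re (Determinant.det (wigner_matrix Xd XRe XIm N \<omega> -
      complex_of_real (sqrt (real N) * \<xi> + \<eta> / (sqrt (real N) * semicircle_density \<xi>)) \<cdot>\<^sub>m 1\<^sub>m N))"

lemma Im_det_hermitian:
  fixes A :: "complex mat"
  assumes A: "A \<in> carrier_mat n n"
    and herm: "\<And>i j. i < n \<Longrightarrow> j < n \<Longrightarrow> A $$ (j, i) = cnj (A $$ (i, j))"
  shows "Im (Determinant.det A) = 0"
proof -
  have hom: "comm_ring_hom cnj"
    by unfold_locales auto
  have "map_mat cnj A = transpose_mat A"
    using A by (intro eq_matI) (auto simp: herm[symmetric])
  then have "Determinant.det (transpose_mat A) = cnj (Determinant.det A)"
    using comm_ring_hom.hom_det[OF hom, of A] by simp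
  then have "cnj (Determinant.det A) = Determinant.det A"
    using Determinant.det_transpose[OF A] by simp
  from arg_cong[OF this, of Im] show ?thesis
    by simp
qed

lemma of_real_wigner_det:
  "complex_of_real (wigner_det Xd XRe XIm N \<xi> \<eta> \<omega>) =
    Determinant.det (wigner_matrix Xd XRe XIm N \<omega> -
      complex_of_real (sqrt (real N) * \<xi> + \<eta> / (sqrt (real N) * semicircle_density \<xi>)) \<cdot>\<^sub>m 1\<^sub>m N)"
    (is "_ = Determinant.det ?A")
proof -
  have "Im (Determinant.det ?A) = 0"
    by (rule Im_det_hermitian[where n = N]) (auto simp: wigner_matrix_def wigner_entry_def)
  then show ?thesis
    unfolding wigner_det_def by (simp add: complex_eq_iff)
qed

end

theory Submission
  imports Defs "Jordan_Normal_Form.Char_Poly" "HOL-Real_Asymp.Real_Asymp"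
begin

text \<open>
  Let \<open>\<chi>\<^sub>n\<close> be the characteristic polynomial of the \<open>n \<times> n\<close> matrix and
  \<open>f\<^sub>n(a, b)\<close> the expectation of \<open>\<chi>\<^sub>n(a) \<chi>\<^sub>n(b)\<close>. Up to a sign that disappears in products, the
  determinants of the theorem are values of \<open>\<chi>\<^sub>N\<close> at points within distance \<open>O(1 / \<surd>N)\<close> of \<open>\<surd>N \<xi>\<close>.

  \<^emph>\<open>Finite size.\<close> Expand the two determinants of size \<open>n + 1\<close> along the last row and column and average
  over that row and column first. The off-diagonal entries have \<open>E X\<^sup>2 = 0\<close> and \<open>E |X|\<^sup>2 = 1\<close>, so a Wick
  formula holds up to the excess \<open>\<kappa> - 2\<close> of \<open>\<kappa> = E |X|\<^sup>4\<close> over its Gaussian value, and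
  \<open>f\<^sub>n\<^sub>+\<^sub>1 = f\<^sub>n + (a - \<partial>\<^sub>a)(b - \<partial>\<^sub>b) f\<^sub>n + (\<partial>\<^sub>b f\<^sub>n - \<partial>\<^sub>a f\<^sub>n) / (a - b) + (\<kappa> - 2) n f\<^sub>n\<^sub>-\<^sub>1\<close>.
  Here \<open>a - \<partial>\<^sub>a\<close> raises the index of the Hermite polynomials \<open>He\<^sub>k\<close>, and the quotient comes from the
  resolvent identity. With the Christoffel-Darboux kernels \<open>K\<^sub>n(a, b) = \<Sum>k\<le>n. He\<^sub>k(a) He\<^sub>k(b) / k!\<close> the
  solution is \<open>f\<^sub>n = n! (\<Sum>j\<le>n/2. \<gamma>\<^sup>j / j! K\<^sub>n\<^sub>-\<^sub>2\<^sub>j)\<close>, where \<open>\<gamma> = (\<kappa> - 2) / 2\<close> (lemmas \<open>pairing_chi_Suc\<close>,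
  \<open>corrected_kernel_recursion\<close> and \<open>pairing_chi\<close>).

  \<^emph>\<open>Large size.\<close> The function \<open>exp (- x\<^sup>2 / 4) He\<^sub>n(x)\<close> satisfies \<open>y'' = - (n + 1/2 - x\<^sup>2 / 4) y\<close>, which
  near \<open>\<surd>N \<xi>\<close> and on the scale \<open>1 / \<surd>N\<close> is a harmonic oscillator up to a vanishing perturbation. The
  Christoffel-Darboux formula presents \<open>K\<^sub>n(a, b)\<close> as a Wronskian between \<open>a\<close> and \<open>b\<close> and \<open>K\<^sub>n(a, a)\<close> as
  the energy at \<open>a\<close>. For a harmonic oscillator that runs through an angle \<open>\<theta>\<close> from \<open>b\<close> to \<open>a\<close>, Wronskian
  over energy is a multiple of \<open>sin \<theta>\<close>, whatever its amplitude and phase are. So the normalized kernel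
  converges to \<open>sin \<theta> / \<theta>\<close> with \<open>\<theta> = \<pi> (\<mu> - \<nu>)\<close>, and no asymptotic formula for Hermite polynomials is
  involved (lemmas \<open>oscillator_limit\<close> and \<open>sine_kernel_limit\<close>).

  The same formulas give \<open>K\<^sub>n\<^sub>-\<^sub>1(a, a) / K\<^sub>n(a, a) \<longlonglongrightarrow> 1\<close>, so that each \<open>K\<^sub>N\<^sub>-\<^sub>2\<^sub>j\<close> has the limit of \<open>K\<^sub>N\<close>.
  The Cauchy-Schwarz inequality dominates the sum over \<open>j\<close>, and by Tannery's theorem the kernel is only
  multiplied by \<open>exp \<gamma>\<close> in the limit. This factor cancels in the quotient.
\<close>

section \<open>Hermite polynomials and Christoffel-Darboux kernels\<close>

fun hermite :: "nat \<Rightarrow> 'a :: comm_ring_1 poly" where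
  "hermite 0 = 1"
| "hermite (Suc 0) = [:0, 1:]"
| "hermite (Suc (Suc n)) = pCons 0 (hermite (Suc n)) - Polynomial.smult (of_nat (Suc n)) (hermite n)"

text \<open>
  Values of Hermite polynomials are written as sequences in the index, because the kernels below pair
  arbitrary sequences: values of the polynomials at a point or values of their derivatives.
\<close>

abbreviation he :: "'a :: comm_ring_1 \<Rightarrow> nat \<Rightarrow> 'a" where
  "he x k \<equiv> poly (hermite k) x"

abbreviation he' :: "'a :: idom \<Rightarrow> nat \<Rightarrow> 'a" where
  "he' x k \<equiv> poly (pderiv (hermite k)) x"

lemma degree_hermite: "degree (hermite n :: 'a :: comm_ring_1 poly) \<le> n"
proof (induction n rule: hermite.induct)
  case (3 n)
  have "degree (pCons 0 (hermite (Suc n)) :: 'a poly) \<le> Suc (Suc n)"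
    using "3.IH"(1) by (intro order.trans[OF degree_pCons_le]) simp
  moreover have "degree (Polynomial.smult (of_nat (Suc n)) (hermite n) :: 'a poly) \<le> Suc (Suc n)"
    using "3.IH"(2) by (intro order.trans[OF degree_smult_le]) simp
  ultimately show ?case by (simp add: degree_diff_le)
qed auto

lemma pderiv_hermite_Suc:
  "pderiv (hermite (Suc n) :: 'a :: idom poly)
    = Polynomial.smult (of_nat (Suc n)) (hermite n)"
proof (induction n rule: less_induct)
  case (less n)
  show ?case
  proof (cases n)
    case 0
    then show ?thesis by (simp add: pderiv_pCons one_pCons)
  next
    case (Suc m)
    have "pderiv (hermite (Suc n) :: 'a poly)
        = hermite n + pCons 0 (pderiv (hermite n)) - Polynomial.smult (of_nat n) (pderiv (hermite m))"
      by (simp add: Suc pderiv_diff pderiv_pCons pderiv_smult)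
    also have "pderiv (hermite n :: 'a poly) = Polynomial.smult (of_nat n) (hermite m)"
      using less.IH[of m] Suc by simp
    also have "hermite n + pCons 0 (Polynomial.smult (of_nat n) (hermite m)) - Polynomial.smult (of_nat n) (pderiv (hermite m :: 'a poly))
        = hermite n + Polynomial.smult (of_nat n) (pCons 0 (hermite m) - pderiv (hermite m))"
      by (simp add: smult_diff_right)
    also have "pCons 0 (hermite m) - pderiv (hermite m :: 'a poly) = hermite n"
    proof (cases m)
      case 0
      then show ?thesis using Suc by simp
    next
      case (Suc l)
      then have "pderiv (hermite m :: 'a poly) = Polynomial.smult (of_nat m) (hermite l)"
        using less.IH[of l] \<open>n = Suc m\<close> by simp
      then show ?thesis using \<open>n = Suc m\<close> Suc by simp
    qed
    finally show ?thesis by (simp add: smult_add_left)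
  qed
qed

lemma he'_Suc: "he' x (Suc n) = of_nat (Suc n) * he x n"
  by (simp add: pderiv_hermite_Suc del: hermite.simps)

lemma hermite_Suc: "hermite (Suc n) = pCons 0 (hermite n) - pderiv (hermite n :: 'a :: idom poly)"
proof (cases n)
  case (Suc m)
  show ?thesis unfolding Suc pderiv_hermite_Suc by simp
qed (simp add: one_pCons)

lemma he_Suc: "he x (Suc n) = x * he x n - he' x n"
  unfolding hermite_Suc by simp

lemma hermite_equation:
  "poly (pderiv (pderiv (hermite n))) x = x * he' x n - of_nat n * he x n"
  for x :: "'a :: idom"
proof -
  have "Polynomial.smult (of_nat (Suc n)) (hermite n) = pderiv (hermite (Suc n) :: 'a poly)"
    by (simp only: pderiv_hermite_Suc)
  also have "\<dots> = pderiv (pCons 0 (hermite n) - pderiv (hermite n))"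
    by (simp only: hermite_Suc)
  also have "\<dots> = hermite n + pCons 0 (pderiv (hermite n)) - pderiv (pderiv (hermite n))"
    by (simp add: pderiv_diff pderiv_pCons)
  finally have "Polynomial.smult (of_nat (Suc n)) (hermite n)
      = hermite n + pCons 0 (pderiv (hermite n)) - pderiv (pderiv (hermite n) :: 'a poly)" .
  from arg_cong[OF this, of "\<lambda>p. poly p x"] show ?thesis
    by (simp add: algebra_simps)
qed

lemma he_of_real: "he (of_real x :: complex) k = of_real (he x k)"
  by (induction k rule: hermite.induct) auto

definition cd_kernel :: "nat \<Rightarrow> (nat \<Rightarrow> 'a :: field_char_0) \<Rightarrow> (nat \<Rightarrow> 'a) \<Rightarrow> 'a" where
  "cd_kernel n f g = (\<Sum>k\<le>n. f k * g k / fact k)"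

lemma cd_kernel_Suc: "cd_kernel (Suc n) f g = cd_kernel n f g + f (Suc n) * g (Suc n) / fact (Suc n)"
  by (simp add: cd_kernel_def)

text \<open>
  The three-term recurrence makes both sides grow by the same amount when \<open>n\<close> increases.
\<close>

lemma christoffel_darboux:
  fixes a b :: "'a :: field_char_0"
  shows "(a - b) * cd_kernel n (he a) (he b) = (he a (Suc n) * he b n - he a n * he b (Suc n)) / fact n"
proof (induction n)
  case 0
  then show ?case by (simp add: cd_kernel_def)
next
  case (Suc n)
  define N :: 'a where "N = of_nat (Suc n)"
  have N: "N \<noteq> 0" by (simp add: N_def del: of_nat_Suc)
  have h: "he x (Suc (Suc n)) = x * he x (Suc n) - N * he x n" for x :: 'a
    by (simp add: N_def)
  have F: "(fact (Suc n) :: 'a) = N * fact n"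
    by (simp add: N_def)
  have "(a - b) * cd_kernel (Suc n) (he a) (he b)
      = (he a (Suc n) * he b n - he a n * he b (Suc n)) / fact n
        + (a - b) * (he a (Suc n) * he b (Suc n) / fact (Suc n))"
    by (simp only: cd_kernel_Suc distrib_left Suc)
  also have "\<dots> = (he a (Suc (Suc n)) * he b (Suc n) - he a (Suc n) * he b (Suc (Suc n))) / fact (Suc n)"
    unfolding h F using N by (simp add: field_simps)
  finally show ?case .
qed

text \<open>
  In each summand the Christoffel-Darboux formula produces neighbouring Hermite polynomials, and
  \<open>He\<^sub>k' = k He\<^sub>k\<^sub>-\<^sub>1\<close> turns them into derivatives. So the difference quotient in the recursion for
  expected products is a sum of kernels.
\<close>

lemma sum_cd_kernel:
  fixes a b :: "'a :: field_char_0"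
  shows "(a - b) * (\<Sum>k<n. cd_kernel k (he a) (he b)) = cd_kernel n (he a) (he' b) - cd_kernel n (he' a) (he b)"
proof (induction n)
  case 0
  then show ?case by (simp add: cd_kernel_def)
next
  case (Suc n)
  have F: "he x n / fact n = he' x (Suc n) / fact (Suc n)" for x :: 'a
    by (simp add: he'_Suc del: hermite.simps of_nat_Suc)
  have "(a - b) * (\<Sum>k<Suc n. cd_kernel k (he a) (he b))
      = cd_kernel n (he a) (he' b) - cd_kernel n (he' a) (he b)
        + (he a (Suc n) * (he b n / fact n) - (he a n / fact n) * he b (Suc n))"
    by (simp add: distrib_left Suc christoffel_darboux diff_divide_distrib del: hermite.simps)
  then show ?case unfolding F cd_kernel_Suc by (simp add: algebra_simps del: hermite.simps)
qed

lemma cd_kernel_raise_sum: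
  fixes a b :: "'a :: field_char_0"
  shows "cd_kernel n (he a) (he b) + (\<Sum>k\<le>n. he a (Suc k) * he b (Suc k) / fact k)
      + (\<Sum>k<n. cd_kernel k (he a) (he b))
    = of_nat (Suc n) * cd_kernel (Suc n) (he a) (he b)"
proof (induction n)
  case 0
  then show ?case by (simp add: cd_kernel_def)
next
  case (Suc n)
  have F: "he a (Suc (Suc n)) * he b (Suc (Suc n)) / fact (Suc n)
      = of_nat (Suc (Suc n)) * (he a (Suc (Suc n)) * he b (Suc (Suc n)) / fact (Suc (Suc n)))"
    by (simp del: hermite.simps of_nat_Suc)
  have "cd_kernel (Suc n) (he a) (he b) + (\<Sum>k\<le>Suc n. he a (Suc k) * he b (Suc k) / fact k)
      + (\<Sum>k<Suc n. cd_kernel k (he a) (he b))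
    = of_nat (Suc n) * cd_kernel (Suc n) (he a) (he b) + cd_kernel (Suc n) (he a) (he b)
      + he a (Suc (Suc n)) * he b (Suc (Suc n)) / fact (Suc n)"
    unfolding Suc.IH[symmetric] by (simp add: cd_kernel_Suc del: hermite.simps of_nat_Suc fact_Suc)
  also have "\<dots> = of_nat (Suc (Suc n)) * cd_kernel (Suc (Suc n)) (he a) (he b)"
    unfolding F cd_kernel_Suc[of "Suc n"] by (simp add: algebra_simps del: hermite.simps fact_Suc)
  finally show ?case .
qed

text \<open>
  The first four terms are \<open>K\<^sub>n + (a - \<partial>\<^sub>a)(b - \<partial>\<^sub>b) K\<^sub>n\<close>, and \<open>a - \<partial>\<^sub>a\<close> raises the index of \<open>He\<^sub>k(a)\<close>. This
  gives the summand with index \<open>k \<le> n\<close> the weight \<open>1 + k\<close>, while the difference quotient contributes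
  \<open>n - k\<close>; the new summand with index \<open>n + 1\<close> gets the same total weight \<open>n + 1\<close> from raising alone.
\<close>

lemma cd_kernel_recursion:
  fixes a b :: "'a :: field_char_0"
  assumes "a \<noteq> b"
  shows "(1 + a * b) * cd_kernel n (he a) (he b) - a * cd_kernel n (he a) (he' b) - b * cd_kernel n (he' a) (he b)
      + cd_kernel n (he' a) (he' b) + (cd_kernel n (he a) (he' b) - cd_kernel n (he' a) (he b)) / (a - b)
    = of_nat (Suc n) * cd_kernel (Suc n) (he a) (he b)"
proof -
  have "(1 + a * b) * cd_kernel n (he a) (he b) - a * cd_kernel n (he a) (he' b) - b * cd_kernel n (he' a) (he b)
      + cd_kernel n (he' a) (he' b)
    = cd_kernel n (he a) (he b) + (\<Sum>k\<le>n. he a (Suc k) * he b (Suc k) / fact k)"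
    unfolding he_Suc cd_kernel_def sum_distrib_left sum.distrib[symmetric] sum_subtractf[symmetric]
    by (intro sum.cong refl) (simp add: field_simps)
  moreover have "(cd_kernel n (he a) (he' b) - cd_kernel n (he' a) (he b)) / (a - b) = (\<Sum>k<n. cd_kernel k (he a) (he b))"
    using assms by (simp add: sum_cd_kernel[symmetric])
  ultimately show ?thesis using cd_kernel_raise_sum[of n a b] by simp
qed

text \<open>
  For \<open>\<gamma> = 0\<close> only \<open>j = 0\<close> contributes and this is the kernel of the Gaussian ensemble. The parameter
  \<open>\<gamma>\<close> measures how far the fourth moment is from the Gaussian one.
\<close>

definition corrected_kernel :: "'a :: field_char_0 \<Rightarrow> nat \<Rightarrow> (nat \<Rightarrow> 'a) \<Rightarrow> (nat \<Rightarrow> 'a) \<Rightarrow> 'a" where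
  "corrected_kernel \<gamma> n f g = (\<Sum>j\<le>n div 2. \<gamma> ^ j / fact j * cd_kernel (n - 2 * j) f g)"

text \<open>
  The operator on the left maps \<open>K\<^sub>n\<^sub>-\<^sub>2\<^sub>j\<close> to \<open>(n + 1 - 2j) K\<^sub>n\<^sub>+\<^sub>1\<^sub>-\<^sub>2\<^sub>j\<close>, and the last term, after a shift of
  \<open>j\<close>, supplies the missing \<open>2j\<close>.
\<close>

lemma corrected_kernel_recursion:
  fixes a b :: "'a :: field_char_0"
  assumes ab: "a \<noteq> b"
  shows "(1 + a * b) * corrected_kernel \<gamma> n (he a) (he b) - a * corrected_kernel \<gamma> n (he a) (he' b)
      - b * corrected_kernel \<gamma> n (he' a) (he b) + corrected_kernel \<gamma> n (he' a) (he' b)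
      + (corrected_kernel \<gamma> n (he a) (he' b) - corrected_kernel \<gamma> n (he' a) (he b)) / (a - b)
      + (if n = 0 then 0 else 2 * \<gamma> * corrected_kernel \<gamma> (n - 1) (he a) (he b))
    = of_nat (Suc n) * corrected_kernel \<gamma> (Suc n) (he a) (he b)"
    (is "?main + ?extra = ?rhs")
proof -
  define t where "t j = \<gamma> ^ j / fact j * cd_kernel (Suc n - 2 * j) (he a) (he b)" for j
  have "?main = (\<Sum>j\<le>n div 2. \<gamma> ^ j / fact j *
      ((1 + a * b) * cd_kernel (n - 2 * j) (he a) (he b) - a * cd_kernel (n - 2 * j) (he a) (he' b)
        - b * cd_kernel (n - 2 * j) (he' a) (he b) + cd_kernel (n - 2 * j) (he' a) (he' b)
        + (cd_kernel (n - 2 * j) (he a) (he' b) - cd_kernel (n - 2 * j) (he' a) (he b)) / (a - b)))"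
    unfolding corrected_kernel_def sum_distrib_left sum_divide_distrib sum.distrib[symmetric] sum_subtractf[symmetric]
    by (intro sum.cong refl) (simp add: algebra_simps add_divide_distrib diff_divide_distrib)
  also have "\<dots> = (\<Sum>j\<le>n div 2. of_nat (Suc n - 2 * j) * t j)"
  proof (intro sum.cong refl)
    fix j assume "j \<in> {..n div 2}"
    then have "Suc (n - 2 * j) = Suc n - 2 * j" by auto
    then show "\<gamma> ^ j / fact j *
      ((1 + a * b) * cd_kernel (n - 2 * j) (he a) (he b) - a * cd_kernel (n - 2 * j) (he a) (he' b)
        - b * cd_kernel (n - 2 * j) (he' a) (he b) + cd_kernel (n - 2 * j) (he' a) (he' b)
        + (cd_kernel (n - 2 * j) (he a) (he' b) - cd_kernel (n - 2 * j) (he' a) (he b)) / (a - b))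
      = of_nat (Suc n - 2 * j) * t j"
      unfolding cd_kernel_recursion[OF ab] t_def by (simp add: mult_ac)
  qed
  also have "\<dots> = (\<Sum>j\<le>Suc n div 2. of_nat (Suc n - 2 * j) * t j)"
    by (intro sum.mono_neutral_left) auto
  finally have main: "?main = (\<Sum>j\<le>Suc n div 2. of_nat (Suc n - 2 * j) * t j)" .
  have "?extra = (\<Sum>j\<le>Suc n div 2. of_nat (2 * j) * t j)"
  proof (cases n)
    case 0
    then show ?thesis by (simp add: t_def)
  next
    case (Suc m)
    have t_Suc: "of_nat (2 * Suc j) * t (Suc j) = 2 * \<gamma> * (\<gamma> ^ j / fact j * cd_kernel (m - 2 * j) (he a) (he b))" for j
    proof -
      have two: "(of_nat (2 * Suc j) :: 'a) = 2 * of_nat (Suc j)"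
        by (simp only: of_nat_mult of_nat_numeral)
      have weight: "(of_nat (2 * Suc j) :: 'a) * (\<gamma> ^ Suc j / fact (Suc j)) = 2 * \<gamma> * (\<gamma> ^ j / fact j)"
        unfolding two fact_Suc by (simp del: of_nat_Suc)
      have level: "Suc n - 2 * Suc j = m - 2 * j"
        using Suc by simp
      show ?thesis
        unfolding t_def level mult.assoc[symmetric] weight[unfolded mult.assoc[symmetric]] ..
    qed
    have "?extra = (\<Sum>j\<le>m div 2. of_nat (2 * Suc j) * t (Suc j))"
      unfolding t_Suc by (simp add: Suc corrected_kernel_def sum_distrib_left)
    also have "\<dots> = (\<Sum>j\<in>{..Suc n div 2}. of_nat (2 * j) * t j)"
    proof -
      have "Suc n div 2 = Suc (m div 2)" using Suc by simp
      then show ?thesis by (simp only: sum.atMost_Suc_shift) simp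
    qed
    finally show ?thesis .
  qed
  with main have "?main + ?extra = (\<Sum>j\<le>Suc n div 2. of_nat (Suc n - 2 * j) * t j + of_nat (2 * j) * t j)"
    by (simp add: sum.distrib)
  also have "\<dots> = (\<Sum>j\<le>Suc n div 2. of_nat (Suc n) * t j)"
  proof (intro sum.cong refl)
    fix j assume "j \<in> {..Suc n div 2}"
    then have "Suc n = (Suc n - 2 * j) + 2 * j" by auto
    then show "of_nat (Suc n - 2 * j) * t j + of_nat (2 * j) * t j = of_nat (Suc n) * t j"
      by (metis distrib_right of_nat_add)
  qed
  also have "\<dots> = ?rhs"
    by (simp only: corrected_kernel_def t_def sum_distrib_left)
  finally show ?thesis .
qed

lemma cd_kernel_commute: "cd_kernel n f g = cd_kernel n g f"
  by (simp add: cd_kernel_def mult.commute)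

lemma corrected_kernel_commute: "corrected_kernel \<gamma> n f g = corrected_kernel \<gamma> n g f"
  by (simp add: corrected_kernel_def cd_kernel_commute)

lemma cd_kernel_sum_left: "cd_kernel n (\<lambda>k. \<Sum>x\<in>A. w x * f x k) g = (\<Sum>x\<in>A. w x * cd_kernel n (f x) g)"
proof -
  have "cd_kernel n (\<lambda>k. \<Sum>x\<in>A. w x * f x k) g = (\<Sum>k\<le>n. \<Sum>x\<in>A. w x * (f x k * g k / fact k))"
    unfolding cd_kernel_def sum_distrib_right sum_divide_distrib by (simp add: mult.assoc)
  also have "\<dots> = (\<Sum>x\<in>A. w x * cd_kernel n (f x) g)"
    unfolding cd_kernel_def sum_distrib_left by (rule sum.swap)
  finally show ?thesis .
qed

lemma corrected_kernel_sum_left: "corrected_kernel \<gamma> n (\<lambda>k. \<Sum>x\<in>A. w x * f x k) g = (\<Sum>x\<in>A. w x * corrected_kernel \<gamma> n (f x) g)"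
proof -
  have "corrected_kernel \<gamma> n (\<lambda>k. \<Sum>x\<in>A. w x * f x k) g
      = (\<Sum>j\<le>n div 2. \<Sum>x\<in>A. w x * (\<gamma> ^ j / fact j * cd_kernel (n - 2 * j) (f x) g))"
    unfolding corrected_kernel_def cd_kernel_sum_left sum_distrib_left by (simp add: mult_ac)
  also have "\<dots> = (\<Sum>x\<in>A. w x * corrected_kernel \<gamma> n (f x) g)"
    unfolding corrected_kernel_def sum_distrib_left by (rule sum.swap)
  finally show ?thesis .
qed

lemma corrected_kernel_cong:
  assumes "\<And>k. k \<le> n \<Longrightarrow> f k = f' k" "\<And>k. k \<le> n \<Longrightarrow> g k = g' k"
  shows "corrected_kernel \<gamma> n f g = corrected_kernel \<gamma> n f' g'"
  unfolding corrected_kernel_def cd_kernel_def by (intro sum.cong refl arg_cong2[where f = times] arg_cong2[where f = divide]) (auto simp: assms)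

lemma corrected_kernel_of_real:
  "corrected_kernel (of_real \<gamma>) n (he (of_real a)) (he (of_real b)) = (of_real (corrected_kernel \<gamma> n (he a) (he b)) :: complex)"
  by (simp add: corrected_kernel_def cd_kernel_def he_of_real)

section \<open>Perturbed harmonic oscillators\<close>

text \<open>
  Variation of constants: \<open>y = \<alpha> cos (\<theta>x) + \<beta> sin (\<theta>x)\<close> and \<open>y' / \<theta> = - \<alpha> sin (\<theta>x) + \<beta> cos (\<theta>x)\<close> define
  amplitudes \<open>\<alpha>\<close> and \<open>\<beta>\<close> that are constant for \<open>\<epsilon> = 0\<close>. Their derivatives are bounded by
  \<open>|\<epsilon> y / \<theta>|\<close>, and Gronwall's argument for the energy \<open>\<rho> = \<alpha>\<^sup>2 + \<beta>\<^sup>2\<close> bounds \<open>y\<close>.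
\<close>

lemma perturbed_oscillator:
  fixes y y' \<epsilon> :: "real \<Rightarrow> real" and \<theta> e :: real
  assumes \<theta>: "\<theta> \<noteq> 0"
    and y: "\<And>x. x \<in> {0..1} \<Longrightarrow> (y has_real_derivative y' x) (at x)"
    and y': "\<And>x. x \<in> {0..1} \<Longrightarrow> (y' has_real_derivative - (\<theta>\<^sup>2 + \<epsilon> x) * y x) (at x)"
    and \<epsilon>: "\<And>x. x \<in> {0..1} \<Longrightarrow> \<bar>\<epsilon> x\<bar> \<le> e"
  defines "\<rho> \<equiv> \<lambda>x. (y x)\<^sup>2 + (y' x / \<theta>)\<^sup>2"
  defines "\<alpha> \<equiv> \<lambda>x. y x * cos (\<theta> * x) - y' x / \<theta> * sin (\<theta> * x)"
  defines "\<beta> \<equiv> \<lambda>x. y x * sin (\<theta> * x) + y' x / \<theta> * cos (\<theta> * x)"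
  shows "\<bar>\<alpha> 1 - \<alpha> 0\<bar> \<le> e / \<bar>\<theta>\<bar> * exp (e / \<bar>\<theta>\<bar>) * sqrt (\<rho> 0)"
    and "\<bar>\<beta> 1 - \<beta> 0\<bar> \<le> e / \<bar>\<theta>\<bar> * exp (e / \<bar>\<theta>\<bar>) * sqrt (\<rho> 0)"
proof -
  define c where "c = e / \<bar>\<theta>\<bar>"
  have e0: "0 \<le> e" using \<epsilon>[of 0] by simp
  have c0: "0 \<le> c" using e0 by (simp add: c_def)
  have \<rho>_nonneg: "0 \<le> \<rho> x" for x by (simp add: \<rho>_def)
  have \<rho>': "(\<rho> has_real_derivative - 2 * \<epsilon> x * y x * y' x / \<theta>\<^sup>2) (at x)" if "x \<in> {0..1}" for x
    unfolding \<rho>_def using \<theta>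
    by (auto intro!: derivative_eq_intros y[OF that] y'[OF that] simp: field_simps power2_eq_square)
  have \<rho>'_le: "- 2 * \<epsilon> x * y x * y' x / \<theta>\<^sup>2 \<le> c * \<rho> x" if "x \<in> {0..1}" for x
  proof -
    have "2 * \<bar>y x * (y' x / \<theta>)\<bar> \<le> \<rho> x"
      unfolding \<rho>_def abs_mult
      using sum_squares_bound[of "\<bar>y x\<bar>" "\<bar>y' x / \<theta>\<bar>"] by (simp only: power2_abs mult.assoc)
    then have "\<bar>\<epsilon> x\<bar> / \<bar>\<theta>\<bar> * (2 * \<bar>y x * (y' x / \<theta>)\<bar>) \<le> e / \<bar>\<theta>\<bar> * \<rho> x"
      using \<epsilon>[OF that] e0 by (intro mult_mono divide_right_mono) auto
    moreover have "- 2 * \<epsilon> x * y x * y' x / \<theta>\<^sup>2 \<le> \<bar>\<epsilon> x\<bar> / \<bar>\<theta>\<bar> * (2 * \<bar>y x * (y' x / \<theta>)\<bar>)"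
    proof -
      have "- 2 * \<epsilon> x * y x * y' x / \<theta>\<^sup>2 \<le> \<bar>- 2 * \<epsilon> x * y x * y' x / \<theta>\<^sup>2\<bar>"
        by (rule abs_ge_self)
      also have "\<dots> = \<bar>\<epsilon> x\<bar> / \<bar>\<theta>\<bar> * (2 * \<bar>y x * (y' x / \<theta>)\<bar>)"
        by (simp add: abs_mult power2_eq_square)
      finally show ?thesis .
    qed
    ultimately show ?thesis by (simp add: c_def)
  qed
  \<comment> \<open>\<open>\<rho>' \<le> c \<rho>\<close> makes \<open>\<rho> x exp (- c x)\<close> decreasing.\<close>
  have gronwall: "\<rho> x \<le> \<rho> 0 * exp c" if x: "x \<in> {0..1}" for x
  proof -
    have "\<rho> x * exp (- c * x) \<le> \<rho> 0 * exp (- c * 0)"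
    proof (rule DERIV_nonpos_imp_nonincreasing[where f = "\<lambda>x. \<rho> x * exp (- c * x)"])
      fix t assume t: "0 \<le> t" "t \<le> x"
      then have t': "t \<in> {0..1}" using x by auto
      have "((\<lambda>x. \<rho> x * exp (- c * x)) has_real_derivative
          (- 2 * \<epsilon> t * y t * y' t / \<theta>\<^sup>2 - c * \<rho> t) * exp (- c * t)) (at t)"
        by (auto intro!: derivative_eq_intros \<rho>'[OF t'] simp: algebra_simps)
      moreover have "(- 2 * \<epsilon> t * y t * y' t / \<theta>\<^sup>2 - c * \<rho> t) * exp (- c * t) \<le> 0"
        using \<rho>'_le[OF t'] by (intro mult_nonpos_nonneg) auto
      ultimately show "\<exists>d. ((\<lambda>x. \<rho> x * exp (- c * x)) has_real_derivative d) (at t) \<and> d \<le> 0"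
        by blast
    qed (use x in auto)
    then have "\<rho> x \<le> \<rho> 0 * exp (c * x)"
      by (simp add: exp_minus field_simps)
    also have "\<dots> \<le> \<rho> 0 * exp c"
      using x c0 \<rho>_nonneg by (intro mult_left_mono) (auto intro: mult_left_le)
    finally show ?thesis .
  qed
  have y_le: "\<bar>\<epsilon> x * y x / \<theta>\<bar> \<le> c * exp c * sqrt (\<rho> 0)" if x: "x \<in> {0..1}" for x
  proof -
    have "\<bar>y x\<bar> = sqrt ((y x)\<^sup>2)" by simp
    also have "\<dots> \<le> sqrt (\<rho> 0 * exp c)"
      using gronwall[OF x] by (intro real_sqrt_le_mono) (simp add: \<rho>_def add_increasing2 order.trans[rotated])
    also have "\<dots> = sqrt (\<rho> 0) * exp (c / 2)"
      by (simp add: real_sqrt_mult exp_half_le2 real_sqrt_unique power2_eq_square exp_add[symmetric])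
    also have "\<dots> \<le> sqrt (\<rho> 0) * exp c"
      using c0 \<rho>_nonneg by (intro mult_left_mono) auto
    finally have "\<bar>\<epsilon> x\<bar> / \<bar>\<theta>\<bar> * \<bar>y x\<bar> \<le> e / \<bar>\<theta>\<bar> * (sqrt (\<rho> 0) * exp c)"
      using \<epsilon>[OF x] e0 by (intro mult_mono divide_right_mono) auto
    then show ?thesis by (simp add: c_def abs_mult mult_ac)
  qed
  have bound: "\<bar>\<epsilon> x * y x / \<theta> * t\<bar> \<le> c * exp c * sqrt (\<rho> 0)" if "x \<in> {0..1}" "\<bar>t\<bar> \<le> 1" for x t
    using mult_mono[OF y_le[OF that(1)] that(2)] c0 \<rho>_nonneg by (simp add: abs_mult)
  have \<alpha>': "(\<alpha> has_real_derivative \<epsilon> x * y x / \<theta> * sin (\<theta> * x)) (at x)" if "x \<in> {0..1}" for x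
    unfolding \<alpha>_def using \<theta>
    by (auto intro!: derivative_eq_intros y[OF that] y'[OF that] simp: field_simps power2_eq_square)
  have \<beta>': "(\<beta> has_real_derivative \<epsilon> x * y x / \<theta> * (- cos (\<theta> * x))) (at x)" if "x \<in> {0..1}" for x
    unfolding \<beta>_def using \<theta>
    by (auto intro!: derivative_eq_intros y[OF that] y'[OF that] simp: field_simps power2_eq_square)
  show "\<bar>\<alpha> 1 - \<alpha> 0\<bar> \<le> e / \<bar>\<theta>\<bar> * exp (e / \<bar>\<theta>\<bar>) * sqrt (\<rho> 0)"
  proof -
    obtain z where "0 < z" "z < 1" "\<alpha> 1 - \<alpha> 0 = (1 - 0) * (\<epsilon> z * y z / \<theta> * sin (\<theta> * z))"
      using MVT2[of 0 1 \<alpha> "\<lambda>x. \<epsilon> x * y x / \<theta> * sin (\<theta> * x)"] \<alpha>' by auto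
    then show ?thesis using bound[of z "sin (\<theta> * z)"] by (simp add: c_def)
  qed
  show "\<bar>\<beta> 1 - \<beta> 0\<bar> \<le> e / \<bar>\<theta>\<bar> * exp (e / \<bar>\<theta>\<bar>) * sqrt (\<rho> 0)"
  proof -
    obtain z where "0 < z" "z < 1" "\<beta> 1 - \<beta> 0 = (1 - 0) * (\<epsilon> z * y z / \<theta> * (- cos (\<theta> * z)))"
      using MVT2[of 0 1 \<beta> "\<lambda>x. \<epsilon> x * y x / \<theta> * (- cos (\<theta> * x))"] \<beta>' by auto
    then show ?thesis using bound[of z "- cos (\<theta> * z)"] by (simp add: c_def)
  qed
qed

text \<open>
  By the previous lemma the amplitudes at 1 and at 0, divided by the root of the energy, differ by a
  null sequence. For constant amplitudes the Wronskian is \<open>- \<theta> sin \<theta> (\<alpha>\<^sup>2 + \<beta>\<^sup>2)\<close>, so the phase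
  \<open>\<alpha> : \<beta>\<close>, which need not converge, drops out.
\<close>

lemma oscillator_limit:
  fixes y y' \<epsilon> :: "nat \<Rightarrow> real \<Rightarrow> real" and e :: "nat \<Rightarrow> real" and \<theta> :: real
  assumes \<theta>: "\<theta> \<noteq> 0"
    and y: "\<And>N x. x \<in> {0..1} \<Longrightarrow> (y N has_real_derivative y' N x) (at x)"
    and y': "\<And>N x. x \<in> {0..1} \<Longrightarrow> (y' N has_real_derivative - (\<theta>\<^sup>2 + \<epsilon> N x) * y N x) (at x)"
    and \<epsilon>: "\<And>N x. x \<in> {0..1} \<Longrightarrow> \<bar>\<epsilon> N x\<bar> \<le> e N"
    and e: "e \<longlonglongrightarrow> 0"
  defines "\<rho> \<equiv> \<lambda>N x. (y N x)\<^sup>2 + (y' N x / \<theta>)\<^sup>2"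
  assumes pos: "\<And>N. 0 < \<rho> N 0"
  shows "(\<lambda>N. (y' N 1 * y N 0 - y N 1 * y' N 0) / \<rho> N 0) \<longlonglongrightarrow> - \<theta> * sin \<theta>"
    and "(\<lambda>N. \<rho> N 1 / \<rho> N 0) \<longlonglongrightarrow> 1"
proof -
  define r where "r N = sqrt (\<rho> N 0)" for N
  have r: "0 < r N" for N using pos by (simp add: r_def)
  have r2: "\<rho> N 0 = r N * r N" for N using pos[of N] by (simp add: r_def)
  define \<alpha> where "\<alpha> N x = y N x * cos (\<theta> * x) - y' N x / \<theta> * sin (\<theta> * x)" for N x
  define \<beta> where "\<beta> N x = y N x * sin (\<theta> * x) + y' N x / \<theta> * cos (\<theta> * x)" for N x
  define a where "a N = (\<alpha> N 1 - \<alpha> N 0) / r N" for N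
  define b where "b N = (\<beta> N 1 - \<beta> N 0) / r N" for N
  define A where "A N = y N 0 / r N" for N
  define B where "B N = y' N 0 / \<theta> / r N" for N
  have unit: "(A N)\<^sup>2 + (B N)\<^sup>2 = 1" for N
  proof -
    have "(A N)\<^sup>2 + (B N)\<^sup>2 = \<rho> N 0 / (r N)\<^sup>2"
      unfolding A_def B_def \<rho>_def power_divide[of _ "r N"] add_divide_distrib ..
    then show ?thesis using r[of N] r2[of N] by (simp add: power2_eq_square)
  qed
  have A1: "\<bar>A N\<bar> \<le> 1" and B1: "\<bar>B N\<bar> \<le> 1" for N
    unfolding abs_square_le_1[symmetric]
    using unit[of N] zero_le_power2[of "A N"] zero_le_power2[of "B N"] by linarith+
  have \<delta>: "(\<lambda>N. e N / \<bar>\<theta>\<bar> * exp (e N / \<bar>\<theta>\<bar>)) \<longlonglongrightarrow> 0"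
  proof -
    have "(\<lambda>N. e N / \<bar>\<theta>\<bar> * exp (e N / \<bar>\<theta>\<bar>)) \<longlonglongrightarrow> 0 / \<bar>\<theta>\<bar> * exp (0 / \<bar>\<theta>\<bar>)"
      using \<theta> by (intro tendsto_intros e) auto
    then show ?thesis by simp
  qed
  have a: "a \<longlonglongrightarrow> 0"
  proof (rule Lim_null_comparison[OF _ \<delta>], intro always_eventually allI)
    fix N show "norm (a N) \<le> e N / \<bar>\<theta>\<bar> * exp (e N / \<bar>\<theta>\<bar>)"
      using perturbed_oscillator(1)[of \<theta> "y N" "y' N" "\<epsilon> N" "e N", OF \<theta> y y' \<epsilon>] r[of N]
      by (simp add: a_def \<alpha>_def r_def \<rho>_def divide_le_eq)
  qed
  have b: "b \<longlonglongrightarrow> 0"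
  proof (rule Lim_null_comparison[OF _ \<delta>], intro always_eventually allI)
    fix N show "norm (b N) \<le> e N / \<bar>\<theta>\<bar> * exp (e N / \<bar>\<theta>\<bar>)"
      using perturbed_oscillator(2)[of \<theta> "y N" "y' N" "\<epsilon> N" "e N", OF \<theta> y y' \<epsilon>] r[of N]
      by (simp add: b_def \<beta>_def r_def \<rho>_def divide_le_eq)
  qed
  have null: "(\<lambda>N. f N * g N) \<longlonglongrightarrow> 0" if "f \<longlonglongrightarrow> 0" "\<And>N. \<bar>g N\<bar> \<le> 1" for f g :: "nat \<Rightarrow> real"
  proof (rule Lim_null_comparison[where g = "\<lambda>N. \<bar>f N\<bar>"])
    show "\<forall>\<^sub>F N in sequentially. norm (f N * g N) \<le> \<bar>f N\<bar>"
      using that(2) by (intro always_eventually allI) (auto simp: abs_mult intro: mult_left_le)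
    show "(\<lambda>N. \<bar>f N\<bar>) \<longlonglongrightarrow> 0" using that(1) by (rule tendsto_rabs_zero)
  qed
  note limits = null[OF a A1] null[OF a B1] null[OF b A1] null[OF b B1]
  have y1: "y N 1 = r N * ((A N + a N) * cos \<theta> + (B N + b N) * sin \<theta>)"
    and y'1: "y' N 1 = \<theta> * r N * ((B N + b N) * cos \<theta> - (A N + a N) * sin \<theta>)" for N
  proof -
    have \<alpha>1: "r N * (A N + a N) = \<alpha> N 1" and \<beta>1: "r N * (B N + b N) = \<beta> N 1"
      using r[of N] by (simp_all add: A_def B_def a_def b_def \<alpha>_def \<beta>_def field_simps)
    have "r N * ((A N + a N) * cos \<theta> + (B N + b N) * sin \<theta>) = \<alpha> N 1 * cos \<theta> + \<beta> N 1 * sin \<theta>"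
      unfolding \<alpha>1[symmetric] \<beta>1[symmetric] by (simp add: algebra_simps)
    also have "\<dots> = y N 1 * ((sin \<theta>)\<^sup>2 + (cos \<theta>)\<^sup>2)"
      by (simp add: \<alpha>_def \<beta>_def algebra_simps power2_eq_square del: sin_cos_squared_add3)
    finally show "y N 1 = r N * ((A N + a N) * cos \<theta> + (B N + b N) * sin \<theta>)"
      by (simp only: sin_cos_squared_add mult_1_right)
    have "\<theta> * r N * ((B N + b N) * cos \<theta> - (A N + a N) * sin \<theta>) = \<theta> * (\<beta> N 1 * cos \<theta> - \<alpha> N 1 * sin \<theta>)"
      unfolding \<alpha>1[symmetric] \<beta>1[symmetric] by (simp add: algebra_simps)
    also have "\<dots> = \<theta> * (y' N 1 / \<theta> * ((sin \<theta>)\<^sup>2 + (cos \<theta>)\<^sup>2))"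
      by (simp add: \<alpha>_def \<beta>_def algebra_simps power2_eq_square del: sin_cos_squared_add3)
    finally show "y' N 1 = \<theta> * r N * ((B N + b N) * cos \<theta> - (A N + a N) * sin \<theta>)"
      unfolding sin_cos_squared_add using \<theta> by simp
  qed
  have y0: "y N 0 = r N * A N" and y'0: "y' N 0 = \<theta> * r N * B N" for N
    using r[of N] \<theta> by (simp_all add: A_def B_def)
  \<comment> \<open>Since \<open>A\<^sup>2 + B\<^sup>2 = 1\<close>, the main term no longer depends on the amplitudes, which need not converge.\<close>
  have wronskian: "(y' N 1 * y N 0 - y N 1 * y' N 0) / \<rho> N 0
      = \<theta> * (- sin \<theta> * (1 + (a N * A N + b N * B N)) + cos \<theta> * (b N * A N - a N * B N))" for N
  proof -
    have "y' N 1 * y N 0 - y N 1 * y' N 0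
        = \<rho> N 0 * (\<theta> * (- sin \<theta> * ((A N)\<^sup>2 + (B N)\<^sup>2 + (a N * A N + b N * B N)) + cos \<theta> * (b N * A N - a N * B N)))"
      unfolding y1 y'1 y0 y'0 r2 by (simp add: algebra_simps power2_eq_square)
    then show ?thesis unfolding unit using pos[of N] by simp
  qed
  have "(\<lambda>N. (y' N 1 * y N 0 - y N 1 * y' N 0) / \<rho> N 0)
      \<longlonglongrightarrow> \<theta> * (- sin \<theta> * (1 + (0 + 0)) + cos \<theta> * (0 - 0))"
    unfolding wronskian by (intro tendsto_intros limits)
  then show "(\<lambda>N. (y' N 1 * y N 0 - y N 1 * y' N 0) / \<rho> N 0) \<longlonglongrightarrow> - \<theta> * sin \<theta>" by simp
  have energy: "\<rho> N 1 / \<rho> N 0 = 1 + 2 * (a N * A N + b N * B N) + a N * a N + b N * b N" for N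
  proof -
    have "\<rho> N 1 = \<rho> N 0 * ((A N + a N)\<^sup>2 + (B N + b N)\<^sup>2) * ((sin \<theta>)\<^sup>2 + (cos \<theta>)\<^sup>2)"
    proof -
      define U where "U = A N + a N"
      define V where "V = B N + b N"
      have "y' N 1 / \<theta> = r N * (V * cos \<theta> - U * sin \<theta>)"
        unfolding y'1 U_def V_def using \<theta> by simp
      then have "\<rho> N 1 = (r N * (U * cos \<theta> + V * sin \<theta>))\<^sup>2 + (r N * (V * cos \<theta> - U * sin \<theta>))\<^sup>2"
        by (simp only: \<rho>_def y1 U_def V_def)
      also have "\<dots> = r N * r N * (U\<^sup>2 + V\<^sup>2) * ((sin \<theta>)\<^sup>2 + (cos \<theta>)\<^sup>2)"
        by (simp add: algebra_simps power2_eq_square del: sin_cos_squared_add3)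
      finally show ?thesis by (simp only: r2 U_def V_def)
    qed
    also have "(A N + a N)\<^sup>2 + (B N + b N)\<^sup>2
        = (A N)\<^sup>2 + (B N)\<^sup>2 + 2 * (a N * A N + b N * B N) + a N * a N + b N * b N"
      by (simp add: algebra_simps power2_eq_square)
    finally show ?thesis unfolding unit using pos[of N] by simp
  qed
  have "(\<lambda>N. \<rho> N 1 / \<rho> N 0) \<longlonglongrightarrow> 1 + 2 * (0 + 0) + 0 * 0 + 0 * 0"
    unfolding energy by (intro tendsto_intros limits a b)
  then show "(\<lambda>N. \<rho> N 1 / \<rho> N 0) \<longlonglongrightarrow> 1" by simp
qed

section \<open>The sine kernel limit of the Christoffel-Darboux kernels\<close>

text \<open>
  The weight is the square root of the Gaussian density. It removes the first-order term from the
  Hermite equation.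
\<close>

definition hermite_fun :: "nat \<Rightarrow> real \<Rightarrow> real" where
  "hermite_fun n x = exp (- (x\<^sup>2 / 4)) * he x n"

definition hermite_fun' :: "nat \<Rightarrow> real \<Rightarrow> real" where
  "hermite_fun' n x = exp (- (x\<^sup>2 / 4)) * (he' x n - x / 2 * he x n)"

lemma DERIV_gauss_half:
  "((\<lambda>x :: real. exp (- (x\<^sup>2 / 4))) has_real_derivative exp (- (x\<^sup>2 / 4)) * (- x / 2)) (at x)"
  by (auto intro!: derivative_eq_intros)

lemma DERIV_hermite_fun:
  "(hermite_fun n has_real_derivative hermite_fun' n x) (at x)"
  unfolding hermite_fun_def hermite_fun'_def
  by (rule DERIV_cong[OF DERIV_mult[OF DERIV_gauss_half poly_DERIV]]) (simp add: algebra_simps)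

lemma DERIV_hermite_fun':
  "(hermite_fun' n has_real_derivative - (real n + 1 / 2 - x\<^sup>2 / 4) * hermite_fun n x) (at x)"
proof -
  have P: "((\<lambda>x. he' x n - x / 2 * he x n) has_real_derivative
      poly (pderiv (pderiv (hermite n))) x - (1 / 2 * he x n + he' x n * (x / 2))) (at x)"
    by (auto intro!: derivative_eq_intros simp: field_simps)
  have deriv: "(hermite_fun' n has_real_derivative
      exp (- (x\<^sup>2 / 4)) * (- x / 2) * (he' x n - x / 2 * he x n)
      + (poly (pderiv (pderiv (hermite n))) x - (1 / 2 * he x n + he' x n * (x / 2))) * exp (- (x\<^sup>2 / 4))) (at x)"
    unfolding hermite_fun'_def by (rule DERIV_mult[OF DERIV_gauss_half P])
  have "E * - z * (q - z * p) + ((2 * z * q - m * p) - (t * p + q * z)) * E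
      = - (m + t - z\<^sup>2) * (E * p)" for E p q z m t :: real
    by (simp add: algebra_simps power2_eq_square)
  from this[of "exp (- (x\<^sup>2 / 4))" "x / 2" "he' x n" "he x n" "real n" "1 / 2"]
  have "exp (- (x\<^sup>2 / 4)) * (- x / 2) * (he' x n - x / 2 * he x n)
      + (x * he' x n - real n * he x n - (1 / 2 * he x n + he' x n * (x / 2))) * exp (- (x\<^sup>2 / 4))
      = - (real n + 1 / 2 - x\<^sup>2 / 4) * (exp (- (x\<^sup>2 / 4)) * he x n)"
    by (simp add: power_divide)
  with deriv show ?thesis
    unfolding hermite_equation hermite_fun_def by (rule DERIV_cong)
qed

text \<open>
  The Christoffel-Darboux formula with \<open>He\<^sub>n\<^sub>+\<^sub>1 = x He\<^sub>n - He\<^sub>n'\<close> inserted, so that only the index \<open>n\<close> occurs.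
\<close>

lemma cd_kernel_wronskian:
  "(a - b) * (fact n * cd_kernel n (he a) (he b) * exp (- (a\<^sup>2 / 4)) * exp (- (b\<^sup>2 / 4)))
    = (a - b) / 2 * hermite_fun n a * hermite_fun n b
      - (hermite_fun' n a * hermite_fun n b - hermite_fun n a * hermite_fun' n b)"
proof -
  have "(a - b) * (fact n * cd_kernel n (he a) (he b) * exp (- (a\<^sup>2 / 4)) * exp (- (b\<^sup>2 / 4)))
      = fact n * ((a - b) * cd_kernel n (he a) (he b)) * exp (- (a\<^sup>2 / 4)) * exp (- (b\<^sup>2 / 4))"
    by (simp only: mult_ac)
  also have "\<dots> = (he a (Suc n) * he b n - he a n * he b (Suc n)) * exp (- (a\<^sup>2 / 4)) * exp (- (b\<^sup>2 / 4))"
    unfolding christoffel_darboux by (simp del: hermite.simps)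
  also have "\<dots> = (a - b) / 2 * hermite_fun n a * hermite_fun n b
      - (hermite_fun' n a * hermite_fun n b - hermite_fun n a * hermite_fun' n b)"
    unfolding he_Suc hermite_fun_def hermite_fun'_def by (simp add: field_simps)
  finally show ?thesis .
qed

lemma cd_kernel_diag:
  "fact n * cd_kernel n (he a) (he a) = (he' a n)\<^sup>2 - a * he' a n * he a n + (real n + 1) * (he a n)\<^sup>2"
proof (induction n)
  case 0
  then show ?case by (simp add: cd_kernel_def)
next
  case (Suc n)
  have "fact (Suc n) * cd_kernel (Suc n) (he a) (he a)
      = (real n + 1) * (fact n * cd_kernel n (he a) (he a)) + (he a (Suc n))\<^sup>2"
    unfolding cd_kernel_Suc by (simp add: distrib_left power2_eq_square del: hermite.simps)
  then show ?case
    unfolding Suc he'_Suc unfolding he_Suc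
    by (simp add: algebra_simps power2_eq_square del: hermite.simps)
qed

text \<open>
  The limit \<open>b \<rightarrow> a\<close> of the Wronskian formula: on the diagonal the kernel is the energy of
  the oscillator.
\<close>

lemma cd_kernel_diag_energy:
  "fact n * cd_kernel n (he a) (he a) * exp (- (a\<^sup>2 / 2))
    = (hermite_fun' n a)\<^sup>2 + (real n + 1 - a\<^sup>2 / 4) * (hermite_fun n a)\<^sup>2"
proof -
  have E: "exp (- (a\<^sup>2 / 2)) = exp (- (a\<^sup>2 / 4)) * exp (- (a\<^sup>2 / 4))"
    by (simp add: exp_add[symmetric])
  show ?thesis
    unfolding cd_kernel_diag hermite_fun_def hermite_fun'_def E
    by (simp add: field_simps power2_eq_square)
qed

lemma cd_kernel_diag_ge_1: "1 \<le> cd_kernel n (he a) (he a)" for a :: real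
proof (induction n)
  case 0
  then show ?case by (simp add: cd_kernel_def)
next
  case (Suc n)
  have "0 \<le> he a (Suc n) * he a (Suc n) / fact (Suc n)"
    by (intro divide_nonneg_nonneg) (auto simp del: hermite.simps)
  with Suc show ?case unfolding cd_kernel_Suc by linarith
qed

lemma cd_kernel_diag_mono: "m \<le> n \<Longrightarrow> cd_kernel m (he a) (he a) \<le> cd_kernel n (he a) (he a)" for a :: real
  unfolding cd_kernel_def by (intro sum_mono2) auto

lemma cd_kernel_cauchy_schwarz:
  fixes a b :: real
  shows "\<bar>cd_kernel n (he a) (he b)\<bar> \<le> sqrt (cd_kernel n (he a) (he a)) * sqrt (cd_kernel n (he b) (he b))"
proof -
  have s: "he x k * he y k / fact k = (he x k / sqrt (fact k)) * (he y k / sqrt (fact k))" for x y :: real and k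
    by simp
  have "\<bar>cd_kernel n (he a) (he b)\<bar> \<le> (\<Sum>k\<le>n. \<bar>he a k / sqrt (fact k)\<bar> * \<bar>he b k / sqrt (fact k)\<bar>)"
    unfolding cd_kernel_def s abs_mult[symmetric] by (rule sum_abs)
  also have "\<dots> \<le> L2_set (\<lambda>k. he a k / sqrt (fact k)) {..n} * L2_set (\<lambda>k. he b k / sqrt (fact k)) {..n}"
    by (rule L2_set_mult_ineq)
  also have "\<dots> = sqrt (cd_kernel n (he a) (he a)) * sqrt (cd_kernel n (he b) (he b))"
    unfolding L2_set_def cd_kernel_def s power2_eq_square ..
  finally show ?thesis .
qed

text \<open>
  The last summand of the kernel is part of the energy, with a coefficient that is large below the edge
  \<open>a\<^sup>2 = 4n\<close> of the spectrum. Hence it is small compared with the whole kernel.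
\<close>

lemma cd_kernel_diag_step:
  assumes n: "0 < n" and pos: "0 < real n + 1 - a\<^sup>2 / 4"
  shows "1 - 1 / (real n + 1 - a\<^sup>2 / 4) \<le> cd_kernel (n - 1) (he a) (he a) / cd_kernel n (he a) (he a)"
proof -
  let ?K = "cd_kernel n (he a) (he a)" and ?c = "real n + 1 - a\<^sup>2 / 4"
  have K: "0 < ?K" using cd_kernel_diag_ge_1[of n a] by linarith
  have E: "exp (- (a\<^sup>2 / 2)) = exp (- (a\<^sup>2 / 4)) * exp (- (a\<^sup>2 / 4))"
    by (simp add: exp_add[symmetric])
  have "?c * (he a n)\<^sup>2 * exp (- (a\<^sup>2 / 2)) \<le> fact n * ?K * exp (- (a\<^sup>2 / 2))"
    unfolding cd_kernel_diag_energy unfolding hermite_fun_def E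
    by (simp add: power2_eq_square mult_ac)
  then have "?c * (he a n)\<^sup>2 \<le> fact n * ?K" by simp
  then have "(he a n * he a n / fact n) / ?K \<le> 1 / ?c"
    using K pos by (simp add: field_simps power2_eq_square)
  moreover have "cd_kernel (n - 1) (he a) (he a) = ?K - he a n * he a n / fact n"
    using cd_kernel_Suc[of "n - 1" "he a" "he a"] n by simp
  then have "cd_kernel (n - 1) (he a) (he a) / ?K = 1 - (he a n * he a n / fact n) / ?K"
    unfolding diff_divide_distrib[symmetric] using K by (simp add: diff_divide_distrib)
  ultimately show ?thesis by linarith
qed

lemma cd_kernel_diag_ratio:
  fixes a :: "nat \<Rightarrow> real"
  assumes a: "filterlim (\<lambda>N. real N - (a N)\<^sup>2 / 4) at_top sequentially"
  shows "(\<lambda>N. cd_kernel (N - m) (he (a N)) (he (a N)) / cd_kernel N (he (a N)) (he (a N))) \<longlonglongrightarrow> 1"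
proof (induction m)
  case 0
  have "cd_kernel N (he (a N)) (he (a N)) \<noteq> 0" for N
    using cd_kernel_diag_ge_1[of N "a N"] by linarith
  then show ?case by simp
next
  case (Suc m)
  let ?K = "\<lambda>n N. cd_kernel n (he (a N)) (he (a N))"
  have K: "0 < ?K n N" for n N using cd_kernel_diag_ge_1[of n "a N"] by linarith
  have a': "filterlim (\<lambda>N. (1 - real m) + (real N - (a N)\<^sup>2 / 4)) at_top sequentially"
    by (rule filterlim_tendsto_add_at_top[OF tendsto_const a])
  have step: "(\<lambda>N. ?K (N - Suc m) N / ?K (N - m) N) \<longlonglongrightarrow> 1"
  proof (rule tendsto_sandwich)
    show "\<forall>\<^sub>F N in sequentially. 1 - 1 / ((1 - real m) + (real N - (a N)\<^sup>2 / 4)) \<le> ?K (N - Suc m) N / ?K (N - m) N"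
      using filterlim_at_top_dense[THEN iffD1, OF a', rule_format, of 0] eventually_gt_at_top[of m]
    proof eventually_elim
      case (elim N)
      then show ?case using cd_kernel_diag_step[of "N - m" "a N"]
        by (simp add: of_nat_diff algebra_simps)
    qed
    show "\<forall>\<^sub>F N in sequentially. ?K (N - Suc m) N / ?K (N - m) N \<le> 1"
      using K cd_kernel_diag_mono by (intro always_eventually allI) (simp add: divide_le_eq)
    have "(\<lambda>N. 1 / ((1 - real m) + (real N - (a N)\<^sup>2 / 4))) \<longlonglongrightarrow> 0"
      by (rule tendsto_divide_0[OF tendsto_const]) (rule filterlim_at_top_imp_at_infinity[OF a'])
    from tendsto_diff[OF tendsto_const[of 1] this]
    show "(\<lambda>N. 1 - 1 / ((1 - real m) + (real N - (a N)\<^sup>2 / 4))) \<longlonglongrightarrow> 1" by simp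
  qed simp
  have split: "?K (N - Suc m) N / ?K N N = (?K (N - Suc m) N / ?K (N - m) N) * (?K (N - m) N / ?K N N)" for N
    using K[of "N - m" N] by simp
  from tendsto_mult[OF step Suc] show ?case
    by (simp only: split[symmetric] mult_1_right)
qed

text \<open>
  The normalized kernel does not see the weights and factorials that turn kernels into Wronskians
  and energies.
\<close>

lemma common_factors_cancel:
  fixes w c p q K A B :: real
  assumes "0 < w" "0 < c" "0 < p" "0 < q"
  shows "w * (c * K * p * q) / (sqrt (w * (c * A * p\<^sup>2)) * sqrt (w * (c * B * q\<^sup>2)))
    = K / (sqrt A * sqrt B)"
proof -
  have "sqrt (w * (c * A * p\<^sup>2)) * sqrt (w * (c * B * q\<^sup>2))
      = (sqrt w * sqrt w) * (sqrt c * sqrt c) * p * q * (sqrt A * sqrt B)"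
  proof -
    have "sqrt (p\<^sup>2) = p" "sqrt (q\<^sup>2) = q" using assms by simp_all
    then show ?thesis unfolding real_sqrt_mult by (simp only: mult_ac)
  qed
  also have "\<dots> = (w * c * p * q) * (sqrt A * sqrt B)"
    using assms by simp
  finally have denom: "sqrt (w * (c * A * p\<^sup>2)) * sqrt (w * (c * B * q\<^sup>2)) = \<dots>" .
  have "w * (c * K * p * q) = (w * c * p * q) * K" by simp
  then show ?thesis
    unfolding denom using assms by simp
qed

text \<open>
  The segment from \<open>b\<close> to \<open>a\<close> is parametrized by \<open>x \<in> [0, 1]\<close>, so that the oscillator has frequency close to
  \<open>\<theta>\<close> by assumption \<open>freq\<close> and all estimates take place on a fixed interval. Assumption \<open>bh\<close> keeps the
  frequency nearly constant along the segment.
\<close>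

lemma sine_kernel_limit:
  fixes a b :: "nat \<Rightarrow> real" and n :: "nat \<Rightarrow> nat" and \<theta> :: real
  assumes \<theta>: "\<theta> \<noteq> 0" and ab: "\<And>N. a N \<noteq> b N"
    and h0: "(\<lambda>N. a N - b N) \<longlonglongrightarrow> 0"
    and bh: "(\<lambda>N. b N * (a N - b N)) \<longlonglongrightarrow> l"
    and freq: "(\<lambda>N. (a N - b N)\<^sup>2 * (real (n N) + 1 / 2 - (b N)\<^sup>2 / 4)) \<longlonglongrightarrow> \<theta>\<^sup>2"
  shows "(\<lambda>N. cd_kernel (n N) (he (a N)) (he (b N))
      / (sqrt (cd_kernel (n N) (he (a N)) (he (a N))) * sqrt (cd_kernel (n N) (he (b N)) (he (b N)))))
    \<longlonglongrightarrow> sin \<theta> / \<theta>"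
proof -
  define h where "h N = a N - b N" for N
  have h: "h N \<noteq> 0" for N using ab[of N] by (simp add: h_def)
  note h0 = h0[folded h_def] and bh = bh[folded h_def] and freq = freq[folded h_def]
  define y where "y N x = hermite_fun (n N) (b N + x * h N)" for N x
  define y' where "y' N x = h N * hermite_fun' (n N) (b N + x * h N)" for N x
  define \<epsilon> where "\<epsilon> N x = (h N)\<^sup>2 * (real (n N) + 1 / 2 - (b N + x * h N)\<^sup>2 / 4) - \<theta>\<^sup>2" for N x
  define e where "e N = \<bar>(h N)\<^sup>2 * (real (n N) + 1 / 2 - (b N)\<^sup>2 / 4) - \<theta>\<^sup>2\<bar>
    + (h N)\<^sup>2 * (\<bar>b N * h N\<bar> / 2 + (h N)\<^sup>2 / 4)" for N
  have shift: "((\<lambda>x. b N + x * h N) has_real_derivative h N) (at x)" for N x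
    by (auto intro!: derivative_eq_intros)
  have y: "(y N has_real_derivative y' N x) (at x)" for N x
    unfolding y_def y'_def using DERIV_chain2[OF DERIV_hermite_fun shift] by (simp add: mult.commute)
  have y': "(y' N has_real_derivative - (\<theta>\<^sup>2 + \<epsilon> N x) * y N x) (at x)" for N x
    unfolding y_def y'_def \<epsilon>_def
    by (rule DERIV_cong[OF DERIV_cmult[OF DERIV_chain2[OF DERIV_hermite_fun' shift]]])
       (simp add: power2_eq_square algebra_simps)
  have \<epsilon>: "\<bar>\<epsilon> N x\<bar> \<le> e N" if x: "x \<in> {0..1}" for N x
  proof -
    have split: "\<epsilon> N x = ((h N)\<^sup>2 * (real (n N) + 1 / 2 - (b N)\<^sup>2 / 4) - \<theta>\<^sup>2)
        - (h N)\<^sup>2 * (x * (b N * h N / 2) + x\<^sup>2 * ((h N)\<^sup>2 / 4))"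
      by (simp add: \<epsilon>_def field_simps power2_eq_square)
    have "\<bar>\<epsilon> N x\<bar> \<le> \<bar>(h N)\<^sup>2 * (real (n N) + 1 / 2 - (b N)\<^sup>2 / 4) - \<theta>\<^sup>2\<bar>
        + (h N)\<^sup>2 * (x * (\<bar>b N * h N\<bar> / 2) + x\<^sup>2 * ((h N)\<^sup>2 / 4))"
    proof -
      have "\<bar>(h N)\<^sup>2 * (x * (b N * h N / 2) + x\<^sup>2 * ((h N)\<^sup>2 / 4))\<bar>
          \<le> (h N)\<^sup>2 * (\<bar>x * (b N * h N / 2)\<bar> + \<bar>x\<^sup>2 * ((h N)\<^sup>2 / 4)\<bar>)"
        unfolding abs_mult[of "(h N)\<^sup>2"] abs_power2 by (intro mult_left_mono abs_triangle_ineq) simp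
      also have "\<dots> = (h N)\<^sup>2 * (x * (\<bar>b N * h N\<bar> / 2) + x\<^sup>2 * ((h N)\<^sup>2 / 4))"
      proof -
        have "\<bar>x * (b N * h N / 2)\<bar> = x * (\<bar>b N * h N\<bar> / 2)"
          using x by (simp add: abs_mult[of x])
        moreover have "\<bar>x\<^sup>2 * ((h N)\<^sup>2 / 4)\<bar> = x\<^sup>2 * ((h N)\<^sup>2 / 4)"
          by (intro abs_of_nonneg) simp
        ultimately show ?thesis by simp
      qed
      finally show ?thesis unfolding split by (rule order.trans[OF abs_triangle_ineq4 add_left_mono])
    qed
    also have "\<dots> \<le> e N"
    proof -
      have "x\<^sup>2 \<le> 1" using x by (simp add: power_le_one)
      then have "x\<^sup>2 * ((h N)\<^sup>2 / 4) \<le> (h N)\<^sup>2 / 4"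
        by (intro mult_left_le_one_le) simp_all
      moreover have "x * (\<bar>b N * h N\<bar> / 2) \<le> \<bar>b N * h N\<bar> / 2"
        using x by (intro mult_left_le_one_le) simp_all
      ultimately have "x * (\<bar>b N * h N\<bar> / 2) + x\<^sup>2 * ((h N)\<^sup>2 / 4) \<le> \<bar>b N * h N\<bar> / 2 + (h N)\<^sup>2 / 4"
        by linarith
      then show ?thesis
        unfolding e_def by (rule add_left_mono[OF mult_left_mono]) simp
    qed
    finally show ?thesis .
  qed
  have h2: "(\<lambda>N. (h N)\<^sup>2) \<longlonglongrightarrow> 0"
    using tendsto_power[OF h0, of 2] by simp
  have e: "e \<longlonglongrightarrow> 0"
  proof -
    have "(\<lambda>N. \<bar>(h N)\<^sup>2 * (real (n N) + 1 / 2 - (b N)\<^sup>2 / 4) - \<theta>\<^sup>2\<bar>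
        + (h N)\<^sup>2 * (\<bar>b N * h N\<bar> / 2 + (h N)\<^sup>2 / 4)) \<longlonglongrightarrow> \<bar>\<theta>\<^sup>2 - \<theta>\<^sup>2\<bar> + 0 * (\<bar>l\<bar> / 2 + 0 / 4)"
      by (intro tendsto_intros freq bh h2) simp_all
    then show ?thesis by (simp add: e_def[abs_def])
  qed
  define \<rho> where "\<rho> N x = (y N x)\<^sup>2 + (y' N x / \<theta>)\<^sup>2" for N x
  define Ea where "Ea N = fact (n N) * cd_kernel (n N) (he (a N)) (he (a N)) * exp (- ((a N)\<^sup>2 / 2))" for N
  define Eb where "Eb N = fact (n N) * cd_kernel (n N) (he (b N)) (he (b N)) * exp (- ((b N)\<^sup>2 / 2))" for N
  define G where "G N = fact (n N) * cd_kernel (n N) (he (a N)) (he (b N)) * exp (- ((a N)\<^sup>2 / 4)) * exp (- ((b N)\<^sup>2 / 4))" for N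
  have Kpos: "0 < cd_kernel k (he x) (he x)" for k and x :: real
    using cd_kernel_diag_ge_1[of k x] by linarith
  have Ea_pos: "0 < Ea N" and Eb_pos: "0 < Eb N" for N
    by (simp_all add: Ea_def Eb_def Kpos)
  have y1: "y N 1 = hermite_fun (n N) (a N)" and y0: "y N 0 = hermite_fun (n N) (b N)"
    and y'1: "y' N 1 = h N * hermite_fun' (n N) (a N)" and y'0: "y' N 0 = h N * hermite_fun' (n N) (b N)" for N
    by (simp_all add: y_def y'_def h_def)
  define pa where "pa N = (h N)\<^sup>2 * (real (n N) + 1 - (a N)\<^sup>2 / 4)" for N
  define pb where "pb N = (h N)\<^sup>2 * (real (n N) + 1 - (b N)\<^sup>2 / 4)" for N
  have Ea: "(h N)\<^sup>2 * Ea N = \<theta>\<^sup>2 * \<rho> N 1 + (pa N - \<theta>\<^sup>2) * (y N 1)\<^sup>2"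
    and Eb: "(h N)\<^sup>2 * Eb N = \<theta>\<^sup>2 * \<rho> N 0 + (pb N - \<theta>\<^sup>2) * (y N 0)\<^sup>2" for N
    unfolding Ea_def Eb_def cd_kernel_diag_energy \<rho>_def y1 y0 y'1 y'0 pa_def pb_def using \<theta>
    by (simp_all add: field_simps power2_eq_square)
  \<comment> \<open>The kernel is at least 1 on the diagonal, so the energy cannot vanish.\<close>
  have \<rho>_pos: "0 < \<rho> N 0" for N
  proof (rule ccontr)
    assume "\<not> 0 < \<rho> N 0"
    then have "\<rho> N 0 = 0" "(y N 0)\<^sup>2 = 0"
      unfolding \<rho>_def by (simp_all add: not_less sum_power2_le_zero_iff)
    then have "(h N)\<^sup>2 * Eb N = 0" unfolding Eb by simp
    then show False using h[of N] Eb_pos[of N] by simp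
  qed
  note osc = oscillator_limit[of \<theta> y y' \<epsilon> e, OF \<theta> y y' \<epsilon> e \<rho>_pos[unfolded \<rho>_def], folded \<rho>_def]
  have pb: "pb \<longlonglongrightarrow> \<theta>\<^sup>2"
  proof -
    have "(\<lambda>N. (h N)\<^sup>2 * (real (n N) + 1 / 2 - (b N)\<^sup>2 / 4) + (h N)\<^sup>2 / 2) \<longlonglongrightarrow> \<theta>\<^sup>2 + 0 / 2"
      by (intro tendsto_intros freq h2) simp
    then show ?thesis by (simp add: pb_def[abs_def] algebra_simps)
  qed
  have pa: "pa \<longlonglongrightarrow> \<theta>\<^sup>2"
  proof -
    have eq: "pa N = pb N - (h N)\<^sup>2 * (b N * h N / 2 + (h N)\<^sup>2 / 4)" for N
      unfolding pa_def pb_def by (simp add: h_def field_simps power2_eq_square)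
    have "(\<lambda>N. pb N - (h N)\<^sup>2 * (b N * h N / 2 + (h N)\<^sup>2 / 4)) \<longlonglongrightarrow> \<theta>\<^sup>2 - 0 * (l / 2 + 0 / 4)"
      by (intro tendsto_intros pb h2 bh) simp_all
    then show ?thesis unfolding eq[symmetric] by simp
  qed
  have \<rho>1: "(y N x)\<^sup>2 \<le> \<rho> N x" for N x by (simp add: \<rho>_def)
  have Ea_lim: "(\<lambda>N. (h N)\<^sup>2 * Ea N / (\<theta>\<^sup>2 * \<rho> N 0)) \<longlonglongrightarrow> 1"
  proof -
    have "(\<lambda>N. (pa N - \<theta>\<^sup>2) * ((y N 1)\<^sup>2 / \<rho> N 0)) \<longlonglongrightarrow> 0"
    proof (rule Lim_null_comparison[where g = "\<lambda>N. \<bar>pa N - \<theta>\<^sup>2\<bar> * (\<rho> N 1 / \<rho> N 0)"])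
      show "\<forall>\<^sub>F N in sequentially. norm ((pa N - \<theta>\<^sup>2) * ((y N 1)\<^sup>2 / \<rho> N 0)) \<le> \<bar>pa N - \<theta>\<^sup>2\<bar> * (\<rho> N 1 / \<rho> N 0)"
      proof (intro always_eventually allI)
        fix N
        have "\<bar>(y N 1)\<^sup>2 / \<rho> N 0\<bar> \<le> \<rho> N 1 / \<rho> N 0"
          using \<rho>1[of N 1] \<rho>_pos[of N] by (simp add: divide_right_mono)
        then show "norm ((pa N - \<theta>\<^sup>2) * ((y N 1)\<^sup>2 / \<rho> N 0)) \<le> \<bar>pa N - \<theta>\<^sup>2\<bar> * (\<rho> N 1 / \<rho> N 0)"
          unfolding real_norm_def abs_mult[of "pa N - \<theta>\<^sup>2"] by (intro mult_left_mono) auto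
      qed
      have "(\<lambda>N. \<bar>pa N - \<theta>\<^sup>2\<bar> * (\<rho> N 1 / \<rho> N 0)) \<longlonglongrightarrow> \<bar>\<theta>\<^sup>2 - \<theta>\<^sup>2\<bar> * 1"
        by (intro tendsto_intros pa osc(2))
      then show "(\<lambda>N. \<bar>pa N - \<theta>\<^sup>2\<bar> * (\<rho> N 1 / \<rho> N 0)) \<longlonglongrightarrow> 0" by simp
    qed
    then have "(\<lambda>N. \<rho> N 1 / \<rho> N 0 + (pa N - \<theta>\<^sup>2) * ((y N 1)\<^sup>2 / \<rho> N 0) / \<theta>\<^sup>2) \<longlonglongrightarrow> 1 + 0 / \<theta>\<^sup>2"
      using \<theta> by (intro tendsto_intros osc(2)) auto
    moreover have "(h N)\<^sup>2 * Ea N / (\<theta>\<^sup>2 * \<rho> N 0)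
        = \<rho> N 1 / \<rho> N 0 + (pa N - \<theta>\<^sup>2) * ((y N 1)\<^sup>2 / \<rho> N 0) / \<theta>\<^sup>2" for N
      unfolding Ea using \<theta> \<rho>_pos[of N] by (simp add: add_divide_distrib)
    ultimately show ?thesis by simp
  qed
  have Eb_lim: "(\<lambda>N. (h N)\<^sup>2 * Eb N / (\<theta>\<^sup>2 * \<rho> N 0)) \<longlonglongrightarrow> 1"
  proof -
    have "(\<lambda>N. (pb N - \<theta>\<^sup>2) * ((y N 0)\<^sup>2 / \<rho> N 0)) \<longlonglongrightarrow> 0"
    proof (rule Lim_null_comparison[where g = "\<lambda>N. \<bar>pb N - \<theta>\<^sup>2\<bar>"])
      show "\<forall>\<^sub>F N in sequentially. norm ((pb N - \<theta>\<^sup>2) * ((y N 0)\<^sup>2 / \<rho> N 0)) \<le> \<bar>pb N - \<theta>\<^sup>2\<bar>"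
      proof (intro always_eventually allI)
        fix N
        have "\<bar>(y N 0)\<^sup>2 / \<rho> N 0\<bar> \<le> 1"
          using \<rho>1[of N 0] \<rho>_pos[of N] by simp
        then show "norm ((pb N - \<theta>\<^sup>2) * ((y N 0)\<^sup>2 / \<rho> N 0)) \<le> \<bar>pb N - \<theta>\<^sup>2\<bar>"
          unfolding real_norm_def abs_mult[of "pb N - \<theta>\<^sup>2"] by (intro mult_left_le) auto
      qed
      have "(\<lambda>N. \<bar>pb N - \<theta>\<^sup>2\<bar>) \<longlonglongrightarrow> \<bar>\<theta>\<^sup>2 - \<theta>\<^sup>2\<bar>"
        by (intro tendsto_intros pb)
      then show "(\<lambda>N. \<bar>pb N - \<theta>\<^sup>2\<bar>) \<longlonglongrightarrow> 0" by simp
    qed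
    then have "(\<lambda>N. 1 + (pb N - \<theta>\<^sup>2) * ((y N 0)\<^sup>2 / \<rho> N 0) / \<theta>\<^sup>2) \<longlonglongrightarrow> 1 + 0 / \<theta>\<^sup>2"
      using \<theta> by (intro tendsto_intros) auto
    moreover have "(h N)\<^sup>2 * Eb N / (\<theta>\<^sup>2 * \<rho> N 0)
        = 1 + (pb N - \<theta>\<^sup>2) * ((y N 0)\<^sup>2 / \<rho> N 0) / \<theta>\<^sup>2" for N
      unfolding Eb using \<theta> \<rho>_pos[of N] by (simp add: add_divide_distrib)
    ultimately show ?thesis by simp
  qed
  have G_lim: "(\<lambda>N. (h N)\<^sup>2 * G N / (\<theta>\<^sup>2 * \<rho> N 0)) \<longlonglongrightarrow> sin \<theta> / \<theta>"
  proof -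
    have G: "(h N)\<^sup>2 * G N = (h N)\<^sup>2 / 2 * (y N 1 * y N 0) - (y' N 1 * y N 0 - y N 1 * y' N 0)" for N
    proof -
      have "(h N)\<^sup>2 * G N = h N * (h N * G N)" by (simp add: power2_eq_square)
      also have "h N * G N = h N / 2 * hermite_fun (n N) (a N) * hermite_fun (n N) (b N)
          - (hermite_fun' (n N) (a N) * hermite_fun (n N) (b N) - hermite_fun (n N) (a N) * hermite_fun' (n N) (b N))"
        unfolding h_def G_def by (rule cd_kernel_wronskian)
      finally show ?thesis
        unfolding y1 y0 y'1 y'0 by (simp add: algebra_simps power2_eq_square)
    qed
    have "(\<lambda>N. (h N)\<^sup>2 / 2 * (y N 1 * y N 0 / \<rho> N 0)) \<longlonglongrightarrow> 0"
    proof (rule Lim_null_comparison[where g = "\<lambda>N. (h N)\<^sup>2 / 2 * (\<rho> N 1 / \<rho> N 0 + 1)"])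
      have yy: "\<bar>y N 1 * y N 0\<bar> \<le> \<rho> N 1 + \<rho> N 0" for N
      proof -
        have "2 * (\<bar>y N 1\<bar> * \<bar>y N 0\<bar>) \<le> (y N 1)\<^sup>2 + (y N 0)\<^sup>2"
          using sum_squares_bound[of "\<bar>y N 1\<bar>" "\<bar>y N 0\<bar>"] by (simp only: power2_abs mult.assoc)
        moreover have "0 \<le> \<bar>y N 1\<bar> * \<bar>y N 0\<bar>" by simp
        ultimately show ?thesis
          unfolding abs_mult using \<rho>1[of N 1] \<rho>1[of N 0] by linarith
      qed
      show "\<forall>\<^sub>F N in sequentially. norm ((h N)\<^sup>2 / 2 * (y N 1 * y N 0 / \<rho> N 0)) \<le> (h N)\<^sup>2 / 2 * (\<rho> N 1 / \<rho> N 0 + 1)"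
      proof (intro always_eventually allI)
        fix N
        have "\<bar>y N 1 * y N 0 / \<rho> N 0\<bar> = \<bar>y N 1 * y N 0\<bar> / \<rho> N 0"
          using \<rho>_pos[of N] by (simp only: abs_divide abs_of_pos)
        also have "\<dots> \<le> (\<rho> N 1 + \<rho> N 0) / \<rho> N 0"
          using yy[of N] \<rho>_pos[of N] by (intro divide_right_mono) auto
        also have "\<dots> = \<rho> N 1 / \<rho> N 0 + 1"
          using \<rho>_pos[of N] by (simp add: add_divide_distrib)
        finally have "\<bar>(h N)\<^sup>2 / 2\<bar> * \<bar>y N 1 * y N 0 / \<rho> N 0\<bar> \<le> \<bar>(h N)\<^sup>2 / 2\<bar> * (\<rho> N 1 / \<rho> N 0 + 1)"
          by (intro mult_left_mono) auto
        then show "norm ((h N)\<^sup>2 / 2 * (y N 1 * y N 0 / \<rho> N 0)) \<le> (h N)\<^sup>2 / 2 * (\<rho> N 1 / \<rho> N 0 + 1)"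
          unfolding real_norm_def abs_mult[of "(h N)\<^sup>2 / 2"] by simp
      qed
      have "(\<lambda>N. (h N)\<^sup>2 / 2 * (\<rho> N 1 / \<rho> N 0 + 1)) \<longlonglongrightarrow> 0 / 2 * (1 + 1)"
        by (intro tendsto_intros h2 osc(2)) simp
      then show "(\<lambda>N. (h N)\<^sup>2 / 2 * (\<rho> N 1 / \<rho> N 0 + 1)) \<longlonglongrightarrow> 0" by simp
    qed
    then have "(\<lambda>N. ((h N)\<^sup>2 / 2 * (y N 1 * y N 0 / \<rho> N 0) - (y' N 1 * y N 0 - y N 1 * y' N 0) / \<rho> N 0) / \<theta>\<^sup>2)
        \<longlonglongrightarrow> (0 - (- \<theta> * sin \<theta>)) / \<theta>\<^sup>2"
      using \<theta> by (intro tendsto_intros osc(1)) auto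
    moreover have "((h N)\<^sup>2 / 2 * (y N 1 * y N 0 / \<rho> N 0) - (y' N 1 * y N 0 - y N 1 * y' N 0) / \<rho> N 0) / \<theta>\<^sup>2
        = (h N)\<^sup>2 * G N / (\<theta>\<^sup>2 * \<rho> N 0)" for N
    proof -
      have alg: "(u * (v / r) - z / r) / t = (u * v - z) / (t * r)" if "r \<noteq> 0" "t \<noteq> 0" for u v r z t :: real
        using that by (simp add: field_simps)
      then show ?thesis unfolding G by (intro alg) (use \<theta> \<rho>_pos[of N] in simp_all)
    qed
    moreover have "(0 - (- \<theta> * sin \<theta>)) / \<theta>\<^sup>2 = sin \<theta> / \<theta>"
      using \<theta> by (simp add: power2_eq_square)
    ultimately show ?thesis by (simp only:)
  qed
  have "(\<lambda>N. ((h N)\<^sup>2 * G N / (\<theta>\<^sup>2 * \<rho> N 0))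
      / (sqrt ((h N)\<^sup>2 * Ea N / (\<theta>\<^sup>2 * \<rho> N 0)) * sqrt ((h N)\<^sup>2 * Eb N / (\<theta>\<^sup>2 * \<rho> N 0))))
    \<longlonglongrightarrow> (sin \<theta> / \<theta>) / (sqrt 1 * sqrt 1)"
    by (intro tendsto_intros G_lim Ea_lim Eb_lim) simp
  moreover have "((h N)\<^sup>2 * G N / (\<theta>\<^sup>2 * \<rho> N 0))
      / (sqrt ((h N)\<^sup>2 * Ea N / (\<theta>\<^sup>2 * \<rho> N 0)) * sqrt ((h N)\<^sup>2 * Eb N / (\<theta>\<^sup>2 * \<rho> N 0)))
    = cd_kernel (n N) (he (a N)) (he (b N))
      / (sqrt (cd_kernel (n N) (he (a N)) (he (a N))) * sqrt (cd_kernel (n N) (he (b N)) (he (b N))))" for N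
  proof -
    define w where "w = (h N)\<^sup>2 / (\<theta>\<^sup>2 * \<rho> N 0)"
    have w: "0 < w" using h[of N] \<theta> \<rho>_pos[of N] by (simp add: w_def)
    have half: "exp (- (x\<^sup>2 / 2)) = (exp (- (x\<^sup>2 / 4)))\<^sup>2" for x :: real
      by (simp add: power2_eq_square exp_add[symmetric])
    have scale: "(h N)\<^sup>2 * v / (\<theta>\<^sup>2 * \<rho> N 0) = w * v" for v
      by (simp add: w_def)
    show ?thesis
      unfolding scale unfolding G_def Ea_def Eb_def half
      by (rule common_factors_cancel) (use w in simp_all)
  qed
  ultimately show ?thesis by simp
qed

text \<open>
  The point at which the determinants are evaluated; near it neighbouring eigenvalues have mean
  distance \<open>1 / (\<surd>N \<rho>(\<xi>))\<close>.
\<close>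

definition spectral_point :: "real \<Rightarrow> real \<Rightarrow> nat \<Rightarrow> real" where
  "spectral_point \<xi> \<eta> N = sqrt (real N) * \<xi> + \<eta> / (sqrt (real N) * semicircle_density \<xi>)"

lemma semicircle_density_pos: "- 2 < \<xi> \<Longrightarrow> \<xi> < 2 \<Longrightarrow> 0 < semicircle_density \<xi>"
  and semicircle_density_sq: "- 2 < \<xi> \<Longrightarrow> \<xi> < 2 \<Longrightarrow> (pi * semicircle_density \<xi>)\<^sup>2 = 1 - \<xi>\<^sup>2 / 4"
proof -
  assume "- 2 < \<xi>" "\<xi> < 2"
  then have pos: "0 < 4 - \<xi>\<^sup>2"
    using abs_square_less_1[of "\<xi> / 2"] by (simp add: power_divide abs_less_iff)
  then show "0 < semicircle_density \<xi>" by (simp add: semicircle_density_def)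
  show "(pi * semicircle_density \<xi>)\<^sup>2 = 1 - \<xi>\<^sup>2 / 4"
    using pos by (simp add: semicircle_density_def power_mult_distrib power_divide field_simps)
qed

lemma spectral_point_sq:
  assumes "0 < N"
  shows "(spectral_point \<xi> \<eta> N)\<^sup>2 = real N * \<xi>\<^sup>2 + 2 * \<xi> * (\<eta> / semicircle_density \<xi>) + (\<eta> / semicircle_density \<xi>)\<^sup>2 / real N"
proof -
  define w where "w = \<eta> / semicircle_density \<xi>"
  define r where "r = sqrt (real N)"
  have r: "0 < r" "real N = r * r" using assms by (simp_all add: r_def)
  have level: "spectral_point \<xi> \<eta> N = r * \<xi> + w / r"
    by (simp add: spectral_point_def w_def r_def)
  show ?thesis
    unfolding level w_def[symmetric] r(2) using r(1) by (simp add: field_simps power2_eq_square)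
qed

lemma spectral_point_subcritical:
  assumes \<xi>: "- 2 < \<xi>" "\<xi> < 2"
  shows "filterlim (\<lambda>N. real N - (spectral_point \<xi> \<eta> N)\<^sup>2 / 4) at_top sequentially"
proof -
  define w where "w = \<eta> / semicircle_density \<xi>"
  define c where "c = 1 - \<xi>\<^sup>2 / 4"
  have c: "0 < c"
    using semicircle_density_pos[OF \<xi>] unfolding c_def semicircle_density_sq[OF \<xi>, symmetric] by simp
  have "filterlim (\<lambda>N. real N * c - \<xi> * w / 2 - w\<^sup>2 / 4 / real N) at_top sequentially"
    using c by real_asymp
  moreover have "\<forall>\<^sub>F N in sequentially. real N * c - \<xi> * w / 2 - w\<^sup>2 / 4 / real N
      = real N - (spectral_point \<xi> \<eta> N)\<^sup>2 / 4"
    using eventually_gt_at_top[of 0]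
    by eventually_elim (simp add: spectral_point_sq c_def w_def algebra_simps add_divide_distrib)
  ultimately show ?thesis by (simp cong: filterlim_cong)
qed

text \<open>
  A fixed shift \<open>m\<close> of the index changes neither the limiting frequency nor, by \<open>cd_kernel_diag_ratio\<close>,
  the normalization.
\<close>

lemma cd_kernel_spectral_limit:
  assumes \<xi>: "- 2 < \<xi>" "\<xi> < 2"
  shows "(\<lambda>N. cd_kernel (N - m) (he (spectral_point \<xi> \<mu> N)) (he (spectral_point \<xi> \<nu> N))
      / (sqrt (cd_kernel N (he (spectral_point \<xi> \<mu> N)) (he (spectral_point \<xi> \<mu> N)))
        * sqrt (cd_kernel N (he (spectral_point \<xi> \<nu> N)) (he (spectral_point \<xi> \<nu> N)))))
    \<longlonglongrightarrow> sinc (pi * (\<mu> - \<nu>))"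
proof -
  define K where "K n \<eta> \<zeta> N = cd_kernel n (he (spectral_point \<xi> \<eta> N)) (he (spectral_point \<xi> \<zeta> N))" for n \<eta> \<zeta> N
  have Kpos: "0 < K n \<eta> \<eta> N" for n \<eta> N
    unfolding K_def using cd_kernel_diag_ge_1[of n "spectral_point \<xi> \<eta> N"] by linarith
  have lower: "(\<lambda>N. K (N - m) \<eta> \<eta> N / K N \<eta> \<eta> N) \<longlonglongrightarrow> 1" for \<eta>
    unfolding K_def by (intro cd_kernel_diag_ratio spectral_point_subcritical \<xi>)
  have sine: "(\<lambda>N. K (N - m) \<mu> \<nu> N / (sqrt (K (N - m) \<mu> \<mu> N) * sqrt (K (N - m) \<nu> \<nu> N)))
      \<longlonglongrightarrow> sinc (pi * (\<mu> - \<nu>))"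
  proof (cases "\<mu> = \<nu>")
    case True
    have "K n \<nu> \<nu> N / (sqrt (K n \<nu> \<nu> N) * sqrt (K n \<nu> \<nu> N)) = 1" for n N
      using Kpos[of n \<nu> N] by simp
    then show ?thesis using True by simp
  next
    case False
    define \<theta> where "\<theta> = pi * (\<mu> - \<nu>)"
    define s where "s = semicircle_density \<xi>"
    have s: "0 < s" and s2: "(pi * s)\<^sup>2 = 1 - \<xi>\<^sup>2 / 4"
      using semicircle_density_pos[OF \<xi>] semicircle_density_sq[OF \<xi>] by (simp_all add: s_def)
    define \<delta> where "\<delta> = (\<mu> - \<nu>) / s"
    have \<theta>: "\<theta> \<noteq> 0" using False by (simp add: \<theta>_def)
    have \<delta>: "\<delta> \<noteq> 0" using False s by (simp add: \<delta>_def)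
    have \<delta>\<theta>: "\<delta>\<^sup>2 * (1 - \<xi>\<^sup>2 / 4) = \<theta>\<^sup>2"
      unfolding s2[symmetric] \<delta>_def \<theta>_def using s by (simp add: power_divide power_mult_distrib)
    define a where "a N = spectral_point \<xi> \<mu> N" for N
    define b where "b N = spectral_point \<xi> \<nu> N" for N
    have h: "a N - b N = \<delta> / sqrt (real N)" for N
      by (simp add: a_def b_def spectral_point_def \<delta>_def s_def diff_divide_distrib mult.commute)
    have h0: "(\<lambda>N. a N - b N) \<longlonglongrightarrow> 0"
      unfolding h by real_asymp
    have bh: "(\<lambda>N. b N * (a N - b N)) \<longlonglongrightarrow> \<xi> * \<delta>"
    proof -
      have "(\<lambda>N. \<xi> * \<delta> + \<nu> / s * \<delta> / real N) \<longlonglongrightarrow> \<xi> * \<delta>" by real_asymp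
      moreover have "\<forall>\<^sub>F N in sequentially. \<xi> * \<delta> + \<nu> / s * \<delta> / real N = b N * (a N - b N)"
        using eventually_gt_at_top[of 0]
      proof eventually_elim
        case (elim N)
        define r where "r = sqrt (real N)"
        have r: "0 < r" "real N = r * r" using elim by (simp_all add: r_def)
        have "b N = r * \<xi> + \<nu> / (r * s)" "a N - b N = \<delta> / r"
          unfolding h by (simp_all add: b_def spectral_point_def s_def r_def)
        then have "b N * (a N - b N) = (r * \<xi> + \<nu> / (r * s)) * (\<delta> / r)" by (simp only:)
        then show ?case unfolding r(2)
          using r(1) s by (simp add: field_simps)
      qed
      ultimately show ?thesis by (rule Lim_transform_eventually)
    qed
    have freq: "(\<lambda>N. (a N - b N)\<^sup>2 * (real (N - m) + 1 / 2 - (b N)\<^sup>2 / 4)) \<longlonglongrightarrow> \<theta>\<^sup>2"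
    proof -
      define w where "w = \<nu> / s"
      have "(\<lambda>N. \<delta>\<^sup>2 * ((1 - \<xi>\<^sup>2 / 4) + (1 / 2 - real m - \<xi> * w / 2) / real N - w\<^sup>2 / 4 / (real N)\<^sup>2))
          \<longlonglongrightarrow> \<delta>\<^sup>2 * (1 - \<xi>\<^sup>2 / 4)" by real_asymp
      moreover have "\<forall>\<^sub>F N in sequentially.
          \<delta>\<^sup>2 * ((1 - \<xi>\<^sup>2 / 4) + (1 / 2 - real m - \<xi> * w / 2) / real N - w\<^sup>2 / 4 / (real N)\<^sup>2)
          = (a N - b N)\<^sup>2 * (real (N - m) + 1 / 2 - (b N)\<^sup>2 / 4)"
        using eventually_gt_at_top[of m]
      proof eventually_elim
        case (elim N)
        then have N: "0 < N" "0 < real N" by auto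
        have gap: "(a N - b N)\<^sup>2 = \<delta>\<^sup>2 / real N"
          unfolding h using N by (simp add: power_divide)
        have centre: "(b N)\<^sup>2 = real N * \<xi>\<^sup>2 + 2 * \<xi> * w + w\<^sup>2 / real N"
          using spectral_point_sq[OF N(1), of \<xi> \<nu>] by (simp add: b_def w_def s_def)
        have index: "real (N - m) = real N - real m"
          using elim by simp
        show ?case
          unfolding gap centre index using N(2) by (simp add: field_simps power2_eq_square)
      qed
      ultimately show ?thesis unfolding \<delta>\<theta> by (rule Lim_transform_eventually)
    qed
    \<comment> \<open>For \<open>N = 0\<close> the two points coincide because of division by zero, so the sequence starts at 1.\<close>
    have "(\<lambda>N. cd_kernel (Suc N - m) (he (a (Suc N))) (he (b (Suc N)))
        / (sqrt (cd_kernel (Suc N - m) (he (a (Suc N))) (he (a (Suc N))))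
          * sqrt (cd_kernel (Suc N - m) (he (b (Suc N))) (he (b (Suc N))))))
      \<longlonglongrightarrow> sin \<theta> / \<theta>"
    proof (rule sine_kernel_limit[OF \<theta>])
      show "a (Suc N) \<noteq> b (Suc N)" for N
      proof -
        have "a (Suc N) - b (Suc N) \<noteq> 0" unfolding h using \<delta> by simp
        then show ?thesis by simp
      qed
      show "(\<lambda>N. a (Suc N) - b (Suc N)) \<longlonglongrightarrow> 0" by (rule LIMSEQ_Suc[OF h0])
      show "(\<lambda>N. b (Suc N) * (a (Suc N) - b (Suc N))) \<longlonglongrightarrow> \<xi> * \<delta>" by (rule LIMSEQ_Suc[OF bh])
      show "(\<lambda>N. (a (Suc N) - b (Suc N))\<^sup>2 * (real (Suc N - m) + 1 / 2 - (b (Suc N))\<^sup>2 / 4)) \<longlonglongrightarrow> \<theta>\<^sup>2"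
        by (rule LIMSEQ_Suc[OF freq])
    qed
    then have "(\<lambda>N. cd_kernel (N - m) (he (a N)) (he (b N))
        / (sqrt (cd_kernel (N - m) (he (a N)) (he (a N))) * sqrt (cd_kernel (N - m) (he (b N)) (he (b N)))))
      \<longlonglongrightarrow> sin \<theta> / \<theta>"
      by (rule LIMSEQ_imp_Suc)
    then show ?thesis using \<theta> by (simp add: K_def a_def b_def \<theta>_def)
  qed
  have "K (N - m) \<mu> \<nu> N / (sqrt (K N \<mu> \<mu> N) * sqrt (K N \<nu> \<nu> N))
    = K (N - m) \<mu> \<nu> N / (sqrt (K (N - m) \<mu> \<mu> N) * sqrt (K (N - m) \<nu> \<nu> N))
      * (sqrt (K (N - m) \<mu> \<mu> N / K N \<mu> \<mu> N) * sqrt (K (N - m) \<nu> \<nu> N / K N \<nu> \<nu> N))" for N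
    using Kpos[of "N - m" \<mu> N] Kpos[of "N - m" \<nu> N] by (simp add: real_sqrt_divide)
  moreover have "(\<lambda>N. K (N - m) \<mu> \<nu> N / (sqrt (K (N - m) \<mu> \<mu> N) * sqrt (K (N - m) \<nu> \<nu> N))
      * (sqrt (K (N - m) \<mu> \<mu> N / K N \<mu> \<mu> N) * sqrt (K (N - m) \<nu> \<nu> N / K N \<nu> \<nu> N)))
    \<longlonglongrightarrow> sinc (pi * (\<mu> - \<nu>)) * (sqrt 1 * sqrt 1)"
    by (intro tendsto_mult sine tendsto_real_sqrt lower)
  ultimately show ?thesis by (simp add: K_def)
qed

text \<open>
  Tannery's theorem for the sum over \<open>j\<close>. The Cauchy-Schwarz inequality and monotonicity of the
  diagonal kernels bound every normalized kernel by 1, so the exponential series is a dominating series.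
\<close>

lemma corrected_kernel_spectral_limit:
  assumes \<xi>: "- 2 < \<xi>" "\<xi> < 2"
  shows "(\<lambda>N. corrected_kernel \<gamma> N (he (spectral_point \<xi> \<mu> N)) (he (spectral_point \<xi> \<nu> N))
      / (sqrt (cd_kernel N (he (spectral_point \<xi> \<mu> N)) (he (spectral_point \<xi> \<mu> N)))
        * sqrt (cd_kernel N (he (spectral_point \<xi> \<nu> N)) (he (spectral_point \<xi> \<nu> N)))))
    \<longlonglongrightarrow> exp \<gamma> * sinc (pi * (\<mu> - \<nu>))"
proof -
  define d where "d N = sqrt (cd_kernel N (he (spectral_point \<xi> \<mu> N)) (he (spectral_point \<xi> \<mu> N)))
    * sqrt (cd_kernel N (he (spectral_point \<xi> \<nu> N)) (he (spectral_point \<xi> \<nu> N)))" for N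
  have d: "0 < d N" for N
    unfolding d_def using cd_kernel_diag_ge_1[of N "spectral_point \<xi> \<mu> N"] cd_kernel_diag_ge_1[of N "spectral_point \<xi> \<nu> N"] by simp
  define T where "T j N = (if j \<le> N div 2
    then \<gamma> ^ j / fact j * (cd_kernel (N - 2 * j) (he (spectral_point \<xi> \<mu> N)) (he (spectral_point \<xi> \<nu> N)) / d N) else 0)" for j N
  have lim: "(\<lambda>N. T j N) \<longlonglongrightarrow> \<gamma> ^ j / fact j * sinc (pi * (\<mu> - \<nu>))" for j
  proof -
    have "(\<lambda>N. \<gamma> ^ j / fact j * (cd_kernel (N - 2 * j) (he (spectral_point \<xi> \<mu> N)) (he (spectral_point \<xi> \<nu> N)) / d N))
        \<longlonglongrightarrow> \<gamma> ^ j / fact j * sinc (pi * (\<mu> - \<nu>))"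
      unfolding d_def by (intro tendsto_mult tendsto_const cd_kernel_spectral_limit \<xi>)
    moreover have "\<forall>\<^sub>F N in sequentially.
        \<gamma> ^ j / fact j * (cd_kernel (N - 2 * j) (he (spectral_point \<xi> \<mu> N)) (he (spectral_point \<xi> \<nu> N)) / d N) = T j N"
      using eventually_ge_at_top[of "2 * j"] by eventually_elim (auto simp: T_def)
    ultimately show ?thesis by (rule Lim_transform_eventually)
  qed
  have bound: "norm (T j N) \<le> \<bar>\<gamma>\<bar> ^ j / fact j" for j N
  proof -
    have "\<bar>cd_kernel (N - 2 * j) (he (spectral_point \<xi> \<mu> N)) (he (spectral_point \<xi> \<nu> N))\<bar> \<le> d N"
      unfolding d_def
      by (rule order.trans[OF cd_kernel_cauchy_schwarz])
         (intro mult_mono real_sqrt_le_mono cd_kernel_diag_mono; simp add: order.trans[OF zero_le_one cd_kernel_diag_ge_1])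
    then have "\<bar>cd_kernel (N - 2 * j) (he (spectral_point \<xi> \<mu> N)) (he (spectral_point \<xi> \<nu> N)) / d N\<bar> \<le> 1"
      using d[of N] by (simp add: divide_le_eq)
    then have "\<bar>\<gamma> ^ j / fact j\<bar> * \<bar>cd_kernel (N - 2 * j) (he (spectral_point \<xi> \<mu> N)) (he (spectral_point \<xi> \<nu> N)) / d N\<bar>
        \<le> \<bar>\<gamma> ^ j / fact j\<bar>"
      by (intro mult_left_le) auto
    then show ?thesis by (auto simp: T_def abs_mult power_abs)
  qed
  have summable: "summable (\<lambda>j. \<bar>\<gamma>\<bar> ^ j / fact j)"
    using summable_exp_generic[of "\<bar>\<gamma>\<bar>"] by (simp add: divide_inverse mult.commute)
  have "(\<lambda>N. suminf (\<lambda>j. T j N)) \<longlonglongrightarrow> suminf (\<lambda>j. \<gamma> ^ j / fact j * sinc (pi * (\<mu> - \<nu>)))"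
  proof -
    have "\<forall>\<^sub>F (j, N) in at_top \<times>\<^sub>F sequentially. norm (T j N) \<le> \<bar>\<gamma>\<bar> ^ j / fact j"
      using bound by (intro always_eventually) (simp only: case_prod_beta, blast)
    from tannerys_theorem[where a = T, OF lim this summable] show ?thesis by simp
  qed
  moreover have "suminf (\<lambda>j. \<gamma> ^ j / fact j * sinc (pi * (\<mu> - \<nu>))) = exp \<gamma> * sinc (pi * (\<mu> - \<nu>))"
  proof -
    have "(\<lambda>j. \<gamma> ^ j / fact j) sums exp \<gamma>"
      using exp_converges[of \<gamma>] by (simp add: divide_inverse mult.commute)
    from sums_mult2[OF this] show ?thesis by (rule sums_unique[symmetric])
  qed
  moreover have "suminf (\<lambda>j. T j N) = corrected_kernel \<gamma> N (he (spectral_point \<xi> \<mu> N)) (he (spectral_point \<xi> \<nu> N)) / d N" for N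
  proof -
    have "suminf (\<lambda>j. T j N) = (\<Sum>j\<le>N div 2. T j N)"
      by (rule suminf_finite) (auto simp: T_def)
    also have "\<dots> = corrected_kernel \<gamma> N (he (spectral_point \<xi> \<mu> N)) (he (spectral_point \<xi> \<nu> N)) / d N"
      unfolding corrected_kernel_def sum_divide_distrib by (intro sum.cong refl) (simp add: T_def)
    finally show ?thesis .
  qed
  ultimately show ?thesis by (simp add: d_def)
qed

theorem corrected_kernel_sinc:
  assumes \<xi>: "- 2 < \<xi>" "\<xi> < 2"
  shows "(\<lambda>N. corrected_kernel \<gamma> N (he (spectral_point \<xi> \<mu> N)) (he (spectral_point \<xi> \<nu> N))
      / (sqrt (corrected_kernel \<gamma> N (he (spectral_point \<xi> \<mu> N)) (he (spectral_point \<xi> \<mu> N)))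
        * sqrt (corrected_kernel \<gamma> N (he (spectral_point \<xi> \<nu> N)) (he (spectral_point \<xi> \<nu> N)))))
    \<longlonglongrightarrow> sinc (pi * (\<mu> - \<nu>))"
proof -
  define K where "K \<eta> N = sqrt (cd_kernel N (he (spectral_point \<xi> \<eta> N)) (he (spectral_point \<xi> \<eta> N)))" for \<eta> N
  define C where "C \<eta> \<zeta> N = corrected_kernel \<gamma> N (he (spectral_point \<xi> \<eta> N)) (he (spectral_point \<xi> \<zeta> N))" for \<eta> \<zeta> N
  have K: "0 < K \<eta> N" for \<eta> N
    unfolding K_def using cd_kernel_diag_ge_1[of N "spectral_point \<xi> \<eta> N"] by simp
  note lim = corrected_kernel_spectral_limit[OF \<xi>, of \<gamma>, folded C_def K_def]
  have diag: "(\<lambda>N. C \<eta> \<eta> N / (K \<eta> N * K \<eta> N)) \<longlonglongrightarrow> exp \<gamma>" for \<eta>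
    using lim[of \<eta> \<eta>] by simp
  have "(\<lambda>N. (C \<mu> \<nu> N / (K \<mu> N * K \<nu> N))
      / (sqrt (C \<mu> \<mu> N / (K \<mu> N * K \<mu> N)) * sqrt (C \<nu> \<nu> N / (K \<nu> N * K \<nu> N))))
    \<longlonglongrightarrow> (exp \<gamma> * sinc (pi * (\<mu> - \<nu>))) / (sqrt (exp \<gamma>) * sqrt (exp \<gamma>))"
    by (intro tendsto_divide tendsto_mult tendsto_real_sqrt lim diag) simp
  moreover have "(C \<mu> \<nu> N / (K \<mu> N * K \<nu> N))
      / (sqrt (C \<mu> \<mu> N / (K \<mu> N * K \<mu> N)) * sqrt (C \<nu> \<nu> N / (K \<nu> N * K \<nu> N)))
    = C \<mu> \<nu> N / (sqrt (C \<mu> \<mu> N) * sqrt (C \<nu> \<nu> N))" for N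
    using K[of \<mu> N] K[of \<nu> N] by (simp add: real_sqrt_divide real_sqrt_mult)
  moreover have "(exp \<gamma> * t) / (sqrt (exp \<gamma>) * sqrt (exp \<gamma>)) = t" for t :: real
    by simp
  ultimately have "(\<lambda>N. C \<mu> \<nu> N / (sqrt (C \<mu> \<mu> N) * sqrt (C \<nu> \<nu> N))) \<longlonglongrightarrow> sinc (pi * (\<mu> - \<nu>))"
    by (simp only:)
  then show ?thesis by (simp only: C_def)
qed

section \<open>Interpolation, adjugates and bounds for determinants\<close>

text \<open>
  Lagrange interpolation. Applied to derivatives it replaces differentiation under the expectation by a
  finite linear combination, and applied to evaluations it extends identities from distinct to
  coinciding arguments.
\<close>

lemma linear_functional_from_values:
  fixes S :: "'a :: field set" and \<Lambda> :: "'a poly \<Rightarrow> 'a"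
  assumes S: "finite S"
    and add: "\<And>p q. \<Lambda> (p + q) = \<Lambda> p + \<Lambda> q"
    and smult: "\<And>c p. \<Lambda> (Polynomial.smult c p) = c * \<Lambda> p"
  obtains w where "\<And>p. degree p < card S \<Longrightarrow> \<Lambda> p = (\<Sum>x\<in>S. w x * poly p x)"
proof -
  define l where "l x = Polynomial.smult (inverse (\<Prod>z\<in>S - {x}. x - z)) (\<Prod>z\<in>S - {x}. [:- z, 1:])" for x
  have l: "poly (l x) z = (if z = x then 1 else 0)" if "x \<in> S" "z \<in> S" for x z
  proof -
    have "(\<Prod>y\<in>S - {x}. x - y) \<noteq> 0" using S by (auto simp: prod_zero_iff)
    then show ?thesis using that S by (auto simp: l_def poly_prod prod_zero_iff)
  qed
  have deg_l: "degree (l x) < card S" if "x \<in> S" for x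
  proof -
    have "degree (l x) \<le> degree (\<Prod>z\<in>S - {x}. [:- z, 1:])"
      unfolding l_def by (rule degree_smult_le)
    also have "\<dots> \<le> (\<Sum>z\<in>S - {x}. degree [:- z, 1:])"
      using S by (intro degree_prod_sum_le[unfolded o_def]) auto
    also have "\<dots> = card S - 1" using S that by simp
    also have "\<dots> < card S"
    proof -
      have "0 < card S" using S that by (auto simp: card_gt_0_iff)
      then show ?thesis by simp
    qed
    finally show ?thesis .
  qed
  have zero: "\<Lambda> 0 = 0" using smult[of 0 0] by simp
  have \<Lambda>_sum: "\<Lambda> (\<Sum>x\<in>T. f x) = (\<Sum>x\<in>T. \<Lambda> (f x))" if "finite T" for f and T :: "'a set"
    using that by induction (simp_all add: zero add)
  have "\<Lambda> p = (\<Sum>x\<in>S. \<Lambda> (l x) * poly p x)" if p: "degree p < card S" for p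
  proof -
    have "p = (\<Sum>x\<in>S. Polynomial.smult (poly p x) (l x))"
    proof (rule poly_eqI_degree[of S])
      fix z assume "z \<in> S"
      then show "poly p z = poly (\<Sum>x\<in>S. Polynomial.smult (poly p x) (l x)) z"
        using S by (simp add: poly_sum l if_distrib cong: if_cong)
    next
      have "degree (\<Sum>x\<in>S. Polynomial.smult (poly p x) (l x)) \<le> card S - 1"
      proof (rule degree_sum_le[OF S])
        fix x assume "x \<in> S"
        have "degree (Polynomial.smult (poly p x) (l x)) \<le> degree (l x)" by (rule degree_smult_le)
        also have "\<dots> \<le> card S - 1" using deg_l[OF \<open>x \<in> S\<close>] by simp
        finally show "degree (Polynomial.smult (poly p x) (l x)) \<le> card S - 1" .
      qed
      then show "degree (\<Sum>x\<in>S. Polynomial.smult (poly p x) (l x)) < card S" using p by linarith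
    qed (rule p)
    from arg_cong[OF this, of \<Lambda>] show ?thesis
      using S by (simp add: \<Lambda>_sum smult mult.commute)
  qed
  then show ?thesis by (rule that)
qed

text \<open>
  Laplace expansion along the last column and then, in each minor, along the last row. What remains
  of the matrix are minors of \<open>A\<close>.
\<close>

lemma det_bordered:
  fixes M :: "'a :: comm_ring_1 mat"
  assumes M: "M \<in> carrier_mat (Suc n) (Suc n)"
  defines "A \<equiv> Matrix.mat n n (\<lambda>(i, j). M $$ (i, j))"
  shows "Determinant.det M = M $$ (n, n) * Determinant.det A
    - (\<Sum>i<n. \<Sum>j<n. M $$ (n, i) * M $$ (j, n) * adj_mat A $$ (i, j))"
proof -
  have corner: "cofactor M n n = Determinant.det A"
  proof -
    have "mat_delete M n n = A"
      using M unfolding A_def by (intro eq_matI) (auto simp: mat_delete_def)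
    moreover have "(- 1 :: 'a) ^ (n + n) = 1"
      by (simp add: mult_2[symmetric] del: mult_2)
    ultimately show ?thesis by (simp add: cofactor_def)
  qed
  have col: "cofactor M j n = - (\<Sum>i<n. M $$ (n, i) * adj_mat A $$ (i, j))" if j: "j < n" for j
  proof -
    define B where "B = mat_delete M j n"
    have B: "B \<in> carrier_mat n n"
      using M by (auto simp: B_def mat_delete_def)
    have n: "n = Suc (n - 1)" using j by simp
    have "Determinant.det B = (\<Sum>i<n. B $$ (n - 1, i) * cofactor B (n - 1) i)"
      using B j by (intro laplace_expansion_row) auto
    also have "\<dots> = (\<Sum>i<n. M $$ (n, i) * ((- 1) ^ (n - 1 + i) * Determinant.det (mat_delete A j i)))"
    proof (intro sum.cong refl)
      fix i assume "i \<in> {..<n}"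
      then have i: "i < n" by simp
      have "mat_delete B (n - 1) i = mat_delete A j i"
        using M i j unfolding A_def B_def by (intro eq_matI) (auto simp: mat_delete_def)
      moreover have "B $$ (n - 1, i) = M $$ (n, i)"
        using M i j unfolding B_def by (auto simp: mat_delete_def)
      ultimately show "B $$ (n - 1, i) * cofactor B (n - 1) i
          = M $$ (n, i) * ((- 1) ^ (n - 1 + i) * Determinant.det (mat_delete A j i))"
        by (simp add: cofactor_def)
    qed
    finally have "cofactor M j n
        = (\<Sum>i<n. (- 1) ^ (j + n) * (M $$ (n, i) * ((- 1) ^ (n - 1 + i) * Determinant.det (mat_delete A j i))))"
      unfolding cofactor_def B_def[symmetric] by (simp add: sum_distrib_left)
    also have "\<dots> = (\<Sum>i<n. - (M $$ (n, i) * adj_mat A $$ (i, j)))"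
    proof (intro sum.cong refl)
      fix i assume "i \<in> {..<n}"
      then have "adj_mat A $$ (i, j) = (- 1) ^ (j + i) * Determinant.det (mat_delete A j i)"
        using j by (simp add: adj_mat_def A_def cofactor_def)
      moreover have "(- 1 :: 'a) ^ (j + n) * (- 1) ^ (n - 1 + i) = - ((- 1) ^ (j + i))"
      proof -
        have "(- 1 :: 'a) ^ (j + n) * (- 1) ^ (n - 1 + i) = (- 1) ^ (2 * (n - 1) + 1 + (j + i))"
          unfolding power_add[symmetric] using j by (intro arg_cong[where f = "power _"]) auto
        then show ?thesis by (simp add: power_add)
      qed
      ultimately show "(- 1) ^ (j + n) * (M $$ (n, i) * ((- 1) ^ (n - 1 + i) * Determinant.det (mat_delete A j i)))
          = - (M $$ (n, i) * adj_mat A $$ (i, j))"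
        by (metis (no_types, lifting) ab_semigroup_mult_class.mult_ac(1) mult.left_commute mult_minus_left mult_minus_right)
    qed
    finally show ?thesis by (simp add: sum_negf)
  qed
  have "Determinant.det M = (\<Sum>j<Suc n. M $$ (j, n) * cofactor M j n)"
    using M by (intro laplace_expansion_column) auto
  also have "\<dots> = M $$ (n, n) * Determinant.det A
      - (\<Sum>j<n. \<Sum>i<n. M $$ (n, i) * M $$ (j, n) * adj_mat A $$ (i, j))"
    by (simp add: corner col sum_distrib_left sum_negf mult_ac)
  also have "(\<Sum>j<n. \<Sum>i<n. M $$ (n, i) * M $$ (j, n) * adj_mat A $$ (i, j))
      = (\<Sum>i<n. \<Sum>j<n. M $$ (n, i) * M $$ (j, n) * adj_mat A $$ (i, j))"
    by (rule sum.swap)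
  finally show ?thesis .
qed

definition shifted :: "'a :: comm_ring_1 \<Rightarrow> 'a mat \<Rightarrow> 'a mat" where
  "shifted z A = z \<cdot>\<^sub>m 1\<^sub>m (dim_row A) - A"

lemma shifted_carrier [simp]: "A \<in> carrier_mat n n \<Longrightarrow> shifted z A \<in> carrier_mat n n"
  by (simp add: shifted_def minus_carrier_mat)

lemma shifted_dim [simp]:
  "dim_row (shifted z A) = dim_row A" "dim_col (shifted z A) = dim_col A"
  by (simp_all add: shifted_def)

lemma shifted_index:
  "A \<in> carrier_mat n n \<Longrightarrow> i < n \<Longrightarrow> j < n
    \<Longrightarrow> shifted z A $$ (i, j) = (if i = j then z else 0) - A $$ (i, j)"
  by (auto simp: shifted_def)

lemma det_shifted:
  fixes A :: "'a :: field mat"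
  assumes "A \<in> carrier_mat n n"
  shows "Determinant.det (shifted z A) = poly (char_poly A) z"
proof -
  have "- char_matrix A z = shifted z A"
    using assms by (intro eq_matI) (auto simp: char_matrix_def shifted_def)
  then show ?thesis using char_poly_matrix[OF assms, of z] by simp
qed

text \<open>
  Diagonal entries of the adjugate are characteristic polynomials of principal submatrices; this is how
  matrices of size \<open>n - 1\<close> enter the recursion.
\<close>

lemma adj_shifted_diag:
  fixes A :: "'a :: field mat"
  assumes A: "A \<in> carrier_mat n n" and i: "i < n"
  shows "adj_mat (shifted z A) $$ (i, i) = poly (char_poly (mat_delete A i i)) z"
proof -
  have D: "mat_delete A i i \<in> carrier_mat (n - 1) (n - 1)"
    using A by (rule mat_delete_carrier)
  have "mat_delete (shifted z A) i i = shifted z (mat_delete A i i)"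
    using A i by (intro eq_matI) (auto simp: mat_delete_def shifted_def)
  moreover have "(- 1 :: 'a) ^ (i + i) = 1"
    by (simp add: mult_2[symmetric] del: mult_2)
  ultimately show ?thesis
    using A i by (simp add: adj_mat_def cofactor_def det_shifted[OF D])
qed

lemma trace_adj_shifted:
  fixes A :: "'a :: field mat"
  assumes A: "A \<in> carrier_mat n n"
  shows "(\<Sum>i<n. adj_mat (shifted z A) $$ (i, i)) = poly (pderiv (char_poly A)) z"
  using A by (simp add: pderiv_char_poly poly_sum adj_shifted_diag)

text \<open>
  The trace of the resolvent identity \<open>(a - b) (a - A)\<^sup>-\<^sup>1 (b - A)\<^sup>-\<^sup>1 = (b - A)\<^sup>-\<^sup>1 - (a - A)\<^sup>-\<^sup>1\<close>,
  multiplied by both determinants so that it also holds at eigenvalues.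
\<close>

lemma resolvent_identity_adj:
  fixes A :: "'a :: field mat"
  assumes A: "A \<in> carrier_mat n n"
  shows "(a - b) * (\<Sum>i<n. \<Sum>j<n. adj_mat (shifted a A) $$ (i, j) * adj_mat (shifted b A) $$ (j, i))
    = poly (char_poly A) a * poly (pderiv (char_poly A)) b
      - poly (pderiv (char_poly A)) a * poly (char_poly A) b"
proof -
  let ?P = "adj_mat (shifted a A)" and ?Q = "adj_mat (shifted b A)"
  have P: "?P \<in> carrier_mat n n" and Q: "?Q \<in> carrier_mat n n"
    using A by (auto intro: adj_mat)
  have left: "(\<Sum>k<n. ?P $$ (i, k) * shifted a A $$ (k, j)) = (if i = j then Determinant.det (shifted a A) else 0)"
    if "i < n" "j < n" for i j
    using adj_mat(3)[of "shifted a A" n, THEN arg_cong, of "\<lambda>M. M $$ (i, j)"] A P that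
    by (simp add: scalar_prod_def atLeast0LessThan)
  have right: "(\<Sum>k<n. shifted b A $$ (i, k) * ?Q $$ (k, j)) = (if i = j then Determinant.det (shifted b A) else 0)"
    if "i < n" "j < n" for i j
    using adj_mat(2)[of "shifted b A" n, THEN arg_cong, of "\<lambda>M. M $$ (i, j)"] A Q that
    by (simp add: scalar_prod_def atLeast0LessThan)
  have diff: "(a - b) * ?Q $$ (j, i)
      = (\<Sum>k<n. shifted a A $$ (j, k) * ?Q $$ (k, i)) - (\<Sum>k<n. shifted b A $$ (j, k) * ?Q $$ (k, i))"
    if "i < n" "j < n" for i j
  proof -
    have "(\<Sum>k<n. shifted a A $$ (j, k) * ?Q $$ (k, i)) - (\<Sum>k<n. shifted b A $$ (j, k) * ?Q $$ (k, i))
      = (\<Sum>k<n. if k = j then (a - b) * ?Q $$ (j, i) else 0)"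
      unfolding sum_subtractf[symmetric]
      using that A by (intro sum.cong) (auto simp: shifted_index algebra_simps)
    then show ?thesis using that by simp
  qed
  have "(a - b) * (\<Sum>i<n. \<Sum>j<n. ?P $$ (i, j) * ?Q $$ (j, i))
      = (\<Sum>i<n. \<Sum>j<n. ?P $$ (i, j) * ((a - b) * ?Q $$ (j, i)))"
    by (simp add: sum_distrib_left mult_ac)
  also have "\<dots> = (\<Sum>i<n. \<Sum>j<n. ?P $$ (i, j) * (\<Sum>k<n. shifted a A $$ (j, k) * ?Q $$ (k, i)))
      - (\<Sum>i<n. \<Sum>j<n. ?P $$ (i, j) * (\<Sum>k<n. shifted b A $$ (j, k) * ?Q $$ (k, i)))"
    unfolding sum_subtractf[symmetric] by (intro sum.cong refl) (simp add: diff right_diff_distrib)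
  also have "(\<Sum>i<n. \<Sum>j<n. ?P $$ (i, j) * (\<Sum>k<n. shifted a A $$ (j, k) * ?Q $$ (k, i)))
      = (\<Sum>i<n. \<Sum>k<n. (\<Sum>j<n. ?P $$ (i, j) * shifted a A $$ (j, k)) * ?Q $$ (k, i))"
    unfolding sum_distrib_left sum_distrib_right
    by (subst sum.swap) (simp add: mult_ac)
  also have "\<dots> = Determinant.det (shifted a A) * (\<Sum>i<n. ?Q $$ (i, i))"
    unfolding sum_distrib_left by (intro sum.cong refl) (simp add: left if_distrib if_distribR cong: if_cong)
  also have "(\<Sum>i<n. \<Sum>j<n. ?P $$ (i, j) * (\<Sum>k<n. shifted b A $$ (j, k) * ?Q $$ (k, i)))
      = (\<Sum>i<n. ?P $$ (i, i)) * Determinant.det (shifted b A)"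
    unfolding sum_distrib_right by (intro sum.cong refl) (simp add: right if_distrib if_distribR cong: if_cong)
  finally show ?thesis
    using A by (simp add: det_shifted trace_adj_shifted)
qed

lemma borel_measurable_det:
  fixes B :: "'b \<Rightarrow> complex mat"
  assumes B: "\<And>y. B y \<in> carrier_mat m m"
    and meas: "\<And>i j. i < m \<Longrightarrow> j < m \<Longrightarrow> (\<lambda>y. B y $$ (i, j)) \<in> borel_measurable P"
  shows "(\<lambda>y. Determinant.det (B y)) \<in> borel_measurable P"
proof -
  have "(\<lambda>y. Determinant.det (B y)) = (\<lambda>y. \<Sum>p\<in>{p. p permutes {0..<m}}. signof p * (\<Prod>i = 0..<m. B y $$ (i, p i)))"
    by (intro ext det_def' B)
  moreover have "(\<lambda>y. \<Sum>p\<in>{p. p permutes {0..<m}}. signof p * (\<Prod>i = 0..<m. B y $$ (i, p i))) \<in> borel_measurable P"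
    by (intro borel_measurable_sum borel_measurable_times borel_measurable_const borel_measurable_prod meas)
       (auto simp: permutes_in_image)
  ultimately show ?thesis by simp
qed

text \<open>
  A permutation meets every position at most once, so each term of the Leibniz formula is a product over
  a subset of the positions, and further factors that are at least 1 do no harm. The maps \<open>r\<close> and \<open>c\<close>
  place \<open>B\<close> as a submatrix, so that minors obey the bound of the whole matrix.
\<close>

lemma norm_det_le:
  fixes B :: "complex mat" and r c :: "nat \<Rightarrow> nat"
  assumes B: "B \<in> carrier_mat m m"
    and inj: "inj_on r {..<m}" and into: "\<And>i. i < m \<Longrightarrow> r i < n" "\<And>j. j < m \<Longrightarrow> c j < n"
    and bound: "\<And>i j. i < m \<Longrightarrow> j < m \<Longrightarrow> cmod (B $$ (i, j)) \<le> g (r i) (c j)"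
    and g: "\<And>i j. i < n \<Longrightarrow> j < n \<Longrightarrow> 1 \<le> g i j"
  shows "cmod (Determinant.det B) \<le> fact m * (\<Prod>i<n. \<Prod>j<n. g i j)"
proof -
  have term_le: "cmod (signof p * (\<Prod>i = 0..<m. B $$ (i, p i))) \<le> (\<Prod>i<n. \<Prod>j<n. g i j)"
    if p: "p permutes {0..<m}" for p
  proof -
    have p_less: "p i < m" if "i < m" for i using permutes_in_image[OF p, of i] that by simp
    have "cmod (signof p * (\<Prod>i = 0..<m. B $$ (i, p i))) = (\<Prod>i<m. cmod (B $$ (i, p i)))"
      by (cases p rule: sign_cases) (simp_all add: norm_mult prod_norm atLeast0LessThan)
    also have "\<dots> \<le> (\<Prod>i<m. g (r i) (c (p i)))"
      by (intro prod_mono) (auto simp: bound p_less)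
    also have "\<dots> = (\<Prod>i\<in>{..<m}. case_prod g (r i, c (p i)))" by simp
    also have "\<dots> = prod (case_prod g) ((\<lambda>i. (r i, c (p i))) ` {..<m})"
    proof (rule prod.reindex_cong[symmetric])
      show "inj_on (\<lambda>i. (r i, c (p i))) {..<m}" using inj by (auto simp: inj_on_def)
    qed auto
    also have "\<dots> \<le> prod (case_prod g) ({..<n} \<times> {..<n})"
    proof (rule prod_mono2)
      show "(\<lambda>i. (r i, c (p i))) ` {..<m} \<subseteq> {..<n} \<times> {..<n}"
        using into p_less by auto
      show "1 \<le> case_prod g b" if "b \<in> {..<n} \<times> {..<n} - (\<lambda>i. (r i, c (p i))) ` {..<m}" for b
        using that g by auto
      show "0 \<le> case_prod g b" if "b \<in> (\<lambda>i. (r i, c (p i))) ` {..<m}" for b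
        using that g into p_less by (auto intro!: order.trans[OF zero_le_one])
    qed simp
    also have "\<dots> = (\<Prod>i<n. \<Prod>j<n. g i j)" by (simp add: prod.cartesian_product)
    finally show ?thesis .
  qed
  have "cmod (Determinant.det B) \<le> (\<Sum>p\<in>{p. p permutes {0..<m}}. cmod (signof p * (\<Prod>i = 0..<m. B $$ (i, p i))))"
    unfolding det_def'[OF B] by (rule norm_sum)
  also have "\<dots> \<le> (\<Sum>p\<in>{p. p permutes {0..<m}}. (\<Prod>i<n. \<Prod>j<n. g i j))"
    by (intro sum_mono) (simp add: term_le)
  also have "\<dots> = fact m * (\<Prod>i<n. \<Prod>j<n. g i j)"
    by (simp add: card_permutations)
  finally show ?thesis .
qed

section \<open>Hermitian matrices as functions of independent coordinates\<close>

text \<open>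
  The matrix entries as functions of a point of the product space of all independent real coordinates.
  The coordinate of a diagonal entry is the entry divided by \<open>\<surd>2\<close>.
\<close>

definition sample_entry :: "(wigner_index \<Rightarrow> real) \<Rightarrow> nat \<Rightarrow> nat \<Rightarrow> complex" where
  "sample_entry y = wigner_entry (\<lambda>k y. sqrt 2 * y (Diag k))
    (\<lambda>k l y. y (RePart k l)) (\<lambda>k l y. y (ImPart k l)) y"

lemma sample_entry_simps:
  "sample_entry y i i = of_real (sqrt 2 * y (Diag i))"
  "i < j \<Longrightarrow> sample_entry y i j = Complex (y (RePart i j)) (y (ImPart i j))"
  "i < j \<Longrightarrow> sample_entry y j i = cnj (sample_entry y i j)"
  by (auto simp: sample_entry_def wigner_entry_def Complex_eq)

text \<open>
  The submatrix with rows and columns \<open>s 0, \<dots>, s (n - 1)\<close>. Deleting a row and the same column only changes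
  \<open>s\<close>, so that statements about all strictly increasing \<open>s\<close> are closed under taking principal minors.
\<close>

definition sample_matrix :: "(nat \<Rightarrow> nat) \<Rightarrow> nat \<Rightarrow> (wigner_index \<Rightarrow> real) \<Rightarrow> complex mat" where
  "sample_matrix s n y = Matrix.mat n n (\<lambda>(i, j). sample_entry y (s i) (s j))"

lemma sample_matrix_carrier [simp]: "sample_matrix s n y \<in> carrier_mat n n"
  and sample_matrix_dim [simp]: "dim_row (sample_matrix s n y) = n" "dim_col (sample_matrix s n y) = n"
  by (simp_all add: sample_matrix_def)

text \<open>
  The coordinates on which the entries of the matrix of size \<open>n\<close> depend.
\<close>

definition block :: "(nat \<Rightarrow> nat) \<Rightarrow> nat \<Rightarrow> wigner_index set" where
  "block s n = {Diag (s i) |i. i < n} \<union> {RePart (s i) (s j) |i j. i < j \<and> j < n}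
    \<union> {ImPart (s i) (s j) |i j. i < j \<and> j < n}"

lemma sample_entry_restrict:
  assumes s: "strict_mono s" and ij: "i < n" "j < n"
  shows "sample_entry (restrict y (block s n)) (s i) (s j) = sample_entry y (s i) (s j)"
proof -
  have less: "sample_entry (restrict y (block s n)) (s i) (s j) = sample_entry y (s i) (s j)"
    if "i < j" "j < n" for i j
  proof -
    have "s i < s j" using s that by (simp add: strict_mono_less)
    moreover have "RePart (s i) (s j) \<in> block s n" "ImPart (s i) (s j) \<in> block s n"
      using that by (auto simp: block_def)
    ultimately show ?thesis by (simp add: sample_entry_simps)
  qed
  consider "i < j" | "i = j" | "j < i" by linarith
  then show ?thesis
  proof cases
    case 2
    moreover have "Diag (s j) \<in> block s n" using ij by (auto simp: block_def)
    ultimately show ?thesis by (simp add: sample_entry_simps)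
  next
    case 3
    then have "s j < s i" using s by (simp add: strict_mono_less)
    then show ?thesis using less[OF 3 ij(1)] by (simp add: sample_entry_simps)
  qed (use less ij in auto)
qed

lemma sample_matrix_restrict:
  "strict_mono s \<Longrightarrow> sample_matrix s n (restrict y (block s n)) = sample_matrix s n y"
  unfolding sample_matrix_def by (intro eq_matI) (auto simp: sample_entry_restrict)

lemma measurable_sample_entry:
  assumes s: "strict_mono s" and ij: "i < n" "j < n"
  shows "(\<lambda>y. sample_entry y (s i) (s j)) \<in> borel_measurable (PiM (block s n) (\<lambda>_. borel))"
proof -
  have comp: "(\<lambda>y. y k) \<in> borel_measurable (PiM (block s n) (\<lambda>_. borel))" if "k \<in> block s n" for k
    using that by (rule measurable_component_singleton)
  have less: "(\<lambda>y. sample_entry y (s i) (s j)) \<in> borel_measurable (PiM (block s n) (\<lambda>_. borel))"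
    if "i < j" "j < n" for i j
  proof -
    have "s i < s j" using s that by (simp add: strict_mono_less)
    moreover have "RePart (s i) (s j) \<in> block s n" "ImPart (s i) (s j) \<in> block s n"
      using that by (auto simp: block_def)
    ultimately show ?thesis by (auto simp: sample_entry_simps Complex_eq intro!: comp borel_measurable_add borel_measurable_times borel_measurable_of_real)
  qed
  consider "i < j" | "i = j" | "j < i" by linarith
  then show ?thesis
  proof cases
    case 2
    moreover have "Diag (s j) \<in> block s n" using ij by (auto simp: block_def)
    ultimately show ?thesis by (auto simp: sample_entry_simps intro!: comp borel_measurable_of_real borel_measurable_times)
  next
    case 3
    then have "s j < s i" using s by (simp add: strict_mono_less)
    then show ?thesis
      using borel_measurable_continuous_on[OF continuous_on_cnj[OF continuous_on_id] less[OF 3 ij(1)]]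
      by (simp add: sample_entry_simps)
  qed (use less ij in auto)
qed

lemma sample_matrix_index:
  "i < n \<Longrightarrow> j < n \<Longrightarrow> sample_matrix s n y $$ (i, j) = sample_entry y (s i) (s j)"
  by (simp add: sample_matrix_def)

lemma det_shifted_sample_Suc:
  assumes s: "strict_mono s"
  shows "Determinant.det (shifted z (sample_matrix s (Suc n) y))
    = (z - sample_entry y (s n) (s n)) * Determinant.det (shifted z (sample_matrix s n y))
      - (\<Sum>i<n. \<Sum>j<n. cnj (sample_entry y (s i) (s n)) * sample_entry y (s j) (s n)
          * adj_mat (shifted z (sample_matrix s n y)) $$ (i, j))"
proof -
  let ?M = "shifted z (sample_matrix s (Suc n) y)"
  have M: "?M \<in> carrier_mat (Suc n) (Suc n)" by simp
  have entry: "?M $$ (i, j) = (if i = j then z else 0) - sample_entry y (s i) (s j)" if "i < Suc n" "j < Suc n" for i j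
    using that by (simp add: shifted_index[OF sample_matrix_carrier] sample_matrix_index)
  have minor: "Matrix.mat n n (\<lambda>(i, j). ?M $$ (i, j)) = shifted z (sample_matrix s n y)"
  proof (rule eq_matI)
    fix i j assume "i < dim_row (shifted z (sample_matrix s n y))" "j < dim_col (shifted z (sample_matrix s n y))"
    then have ij: "i < n" "j < n" by simp_all
    then show "Matrix.mat n n (\<lambda>(i, j). ?M $$ (i, j)) $$ (i, j) = shifted z (sample_matrix s n y) $$ (i, j)"
      using entry[of i j] by (simp add: shifted_index[OF sample_matrix_carrier ij] sample_matrix_index)
  qed simp_all
  have border: "?M $$ (n, i) * ?M $$ (j, n) = cnj (sample_entry y (s i) (s n)) * sample_entry y (s j) (s n)"
    if "i < n" "j < n" for i j
  proof -
    have "sample_entry y (s n) (s i) = cnj (sample_entry y (s i) (s n))"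
      using s that by (intro sample_entry_simps(3)) (simp add: strict_mono_less)
    then show ?thesis using that by (simp add: entry)
  qed
  have "(\<Sum>i<n. \<Sum>j<n. ?M $$ (n, i) * ?M $$ (j, n) * adj_mat (shifted z (sample_matrix s n y)) $$ (i, j))
      = (\<Sum>i<n. \<Sum>j<n. cnj (sample_entry y (s i) (s n)) * sample_entry y (s j) (s n)
          * adj_mat (shifted z (sample_matrix s n y)) $$ (i, j))"
    by (intro sum.cong refl) (simp add: border)
  moreover have "?M $$ (n, n) = z - sample_entry y (s n) (s n)"
    using entry[of n n] by simp
  ultimately show ?thesis
    unfolding det_bordered[OF M] minor by (simp only:)
qed

lemma mat_delete_sample_matrix:
  assumes "i < n"
  shows "mat_delete (sample_matrix s n y) i i = sample_matrix (s \<circ> insert_index i) (n - 1) y"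
proof (rule eq_matI)
  fix k l assume "k < dim_row (sample_matrix (s \<circ> insert_index i) (n - 1) y)"
    "l < dim_col (sample_matrix (s \<circ> insert_index i) (n - 1) y)"
  then have kl: "k < n - 1" "l < n - 1" by simp_all
  then have less: "insert_index i k < n" "insert_index i l < n" by (auto simp: insert_index_def)
  have "mat_delete (sample_matrix s n y) i i $$ (k, l) = sample_matrix s n y $$ (insert_index i k, insert_index i l)"
    using kl by (simp add: mat_delete_def insert_index_def)
  then show "mat_delete (sample_matrix s n y) i i $$ (k, l) = sample_matrix (s \<circ> insert_index i) (n - 1) y $$ (k, l)"
    using kl less by (simp add: sample_matrix_index)
qed (auto simp: mat_delete_def)

lemma strict_mono_insert_index: "strict_mono (insert_index i)"
  by (auto simp: strict_mono_def insert_index_def)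

text \<open>
  A common bound, up to constants, for all minors. Its square contains every off-diagonal modulus to the
  fourth power and is a product of independent factors, so it is integrable precisely because of the
  fourth moment.
\<close>

definition dominator :: "(nat \<Rightarrow> nat) \<Rightarrow> nat \<Rightarrow> (wigner_index \<Rightarrow> real) \<Rightarrow> real" where
  "dominator s n y = (\<Prod>i<n. \<Prod>j<n. 1 + cmod (sample_entry y (s i) (s j)))"

lemma shifted_entry_le:
  assumes "i < n" "j < n"
  shows "cmod (shifted z (sample_matrix s n y) $$ (i, j))
    \<le> (1 + cmod z) * (1 + cmod (sample_entry y (s i) (s j)))"
proof -
  let ?e = "cmod (sample_entry y (s i) (s j))"
  have "cmod (shifted z (sample_matrix s n y) $$ (i, j)) \<le> cmod z + ?e"
    unfolding shifted_index[OF sample_matrix_carrier assms]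
    by (rule order.trans[OF norm_triangle_ineq4]) (use assms in \<open>auto simp: sample_matrix_def\<close>)
  also have "\<dots> \<le> (1 + cmod z) * (1 + ?e)"
    by (simp add: algebra_simps)
  finally show ?thesis .
qed

lemma dominator_scale:
  "(\<Prod>i<n. \<Prod>j<n. (1 + cmod z) * (1 + cmod (sample_entry y (s i) (s j))))
    = ((1 + cmod z) ^ n) ^ n * dominator s n y"
  by (simp add: prod.distrib dominator_def)

lemma det_shifted_le:
  "cmod (Determinant.det (shifted z (sample_matrix s n y))) \<le> fact n * (((1 + cmod z) ^ n) ^ n * dominator s n y)"
  unfolding dominator_scale[symmetric]
  by (rule norm_det_le[where r = "\<lambda>i. i" and c = "\<lambda>i. i"])
     (auto simp: shifted_entry_le intro!: mult_ge1_I)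

lemma adj_shifted_le:
  assumes "i < n" "j < n"
  shows "cmod (adj_mat (shifted z (sample_matrix s n y)) $$ (i, j))
    \<le> fact (n - 1) * (((1 + cmod z) ^ n) ^ n * dominator s n y)"
proof -
  let ?A = "shifted z (sample_matrix s n y)"
  have A: "?A \<in> carrier_mat n n" by simp
  then have D: "mat_delete ?A j i \<in> carrier_mat (n - 1) (n - 1)" by (rule mat_delete_carrier)
  have "cmod (adj_mat ?A $$ (i, j)) = cmod (Determinant.det (mat_delete ?A j i))"
    using assms A by (simp add: adj_mat_def cofactor_def norm_mult norm_power)
  also have "\<dots> \<le> fact (n - 1) * (\<Prod>i<n. \<Prod>j<n. (1 + cmod z) * (1 + cmod (sample_entry y (s i) (s j))))"
    by (rule norm_det_le[OF D, where r = "insert_index j" and c = "insert_index i"])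
       (use assms A in \<open>auto simp: mat_delete_def insert_index_def inj_on_def
          intro!: shifted_entry_le mult_ge1_I split: if_splits\<close>)
  finally show ?thesis unfolding dominator_scale .
qed

lemma dominator_Suc:
  assumes s: "strict_mono s"
  shows "dominator s (Suc n) y = (\<Prod>m<n. (1 + cmod (sample_entry y (s m) (s n)))\<^sup>2)
    * (1 + cmod (sample_entry y (s n) (s n))) * dominator s n y"
proof -
  have "cmod (sample_entry y (s n) (s m)) = cmod (sample_entry y (s m) (s n))" if "m < n" for m
    using s that by (simp add: sample_entry_simps(3) strict_mono_less)
  then have "(\<Prod>j<n. 1 + cmod (sample_entry y (s n) (s j))) = (\<Prod>m<n. 1 + cmod (sample_entry y (s m) (s n)))"
    by (intro prod.cong) auto
  then show ?thesis
    by (simp add: dominator_def prod.distrib power2_eq_square mult_ac)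
qed

lemma measurable_dominator:
  assumes s: "strict_mono s"
  shows "dominator s n \<in> borel_measurable (PiM (block s n) (\<lambda>_. borel))"
proof -
  have "(\<lambda>y. 1 + cmod (sample_entry y (s i) (s j))) \<in> borel_measurable (PiM (block s n) (\<lambda>_. borel))"
    if "i < n" "j < n" for i j
    using measurable_sample_entry[OF s that] by simp
  then show ?thesis
    unfolding dominator_def by (intro borel_measurable_prod) auto
qed

lemma dominator_restrict:
  "strict_mono s \<Longrightarrow> dominator s n (restrict y (block s n)) = dominator s n y"
  unfolding dominator_def by (intro prod.cong refl) (auto simp: sample_entry_restrict)

lemma measurable_shifted_entry:
  assumes s: "strict_mono s" and "i < n" "j < n"
  shows "(\<lambda>y. shifted z (sample_matrix s n y) $$ (i, j)) \<in> borel_measurable (PiM (block s n) (\<lambda>_. borel))"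
proof -
  have "(\<lambda>y. shifted z (sample_matrix s n y) $$ (i, j))
      = (\<lambda>y. (if i = j then z else 0) - sample_entry y (s i) (s j))"
    using assms by (intro ext) (simp add: shifted_index[OF sample_matrix_carrier] sample_matrix_index)
  then show ?thesis
    using measurable_sample_entry[OF assms] by (simp add: borel_measurable_diff)
qed

lemma measurable_det_shifted:
  assumes s: "strict_mono s"
  shows "(\<lambda>y. Determinant.det (shifted z (sample_matrix s n y))) \<in> borel_measurable (PiM (block s n) (\<lambda>_. borel))"
  by (rule borel_measurable_det[where m = n]) (auto intro: measurable_shifted_entry s)

lemma measurable_adj_shifted:
  assumes s: "strict_mono s" and ij: "i < n" "j < n"
  shows "(\<lambda>y. adj_mat (shifted z (sample_matrix s n y)) $$ (i, j)) \<in> borel_measurable (PiM (block s n) (\<lambda>_. borel))"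
proof -
  have "(\<lambda>y. Determinant.det (mat_delete (shifted z (sample_matrix s n y)) j i)) \<in> borel_measurable (PiM (block s n) (\<lambda>_. borel))"
  proof (rule borel_measurable_det[where m = "n - 1"])
    show "mat_delete (shifted z (sample_matrix s n y)) j i \<in> carrier_mat (n - 1) (n - 1)" for y
      by (rule mat_delete_carrier) simp
    fix k l assume kl: "k < n - 1" "l < n - 1"
    then show "(\<lambda>y. mat_delete (shifted z (sample_matrix s n y)) j i $$ (k, l)) \<in> borel_measurable (PiM (block s n) (\<lambda>_. borel))"
      using ij by (auto simp: mat_delete_def intro!: measurable_shifted_entry s)
  qed
  then show ?thesis
    using ij by (simp add: adj_mat_def cofactor_def borel_measurable_times)
qed

text \<open>
  Functions of the matrix of size \<open>n\<close> whose products in pairs are integrable. They are independent of the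
  next row and column.
\<close>

definition block_fun :: "(nat \<Rightarrow> nat) \<Rightarrow> nat \<Rightarrow> ((wigner_index \<Rightarrow> real) \<Rightarrow> complex) \<Rightarrow> bool" where
  "block_fun s n u \<longleftrightarrow> u \<in> borel_measurable (PiM (block s n) (\<lambda>_. borel))
    \<and> (\<forall>y. u (restrict y (block s n)) = u y) \<and> (\<exists>C. \<forall>y. cmod (u y) \<le> C * dominator s n y)"

lemma block_fun_det:
  assumes s: "strict_mono s"
  shows "block_fun s n (\<lambda>y. Determinant.det (shifted z (sample_matrix s n y)))"
  unfolding block_fun_def
proof (intro conjI allI exI)
  show "cmod (Determinant.det (shifted z (sample_matrix s n y))) \<le> (fact n * ((1 + cmod z) ^ n) ^ n) * dominator s n y" for y
    using det_shifted_le[of z s n y] by (simp add: mult.assoc)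
qed (simp_all add: measurable_det_shifted s sample_matrix_restrict)

lemma block_fun_adj:
  assumes s: "strict_mono s" and ij: "i < n" "j < n"
  shows "block_fun s n (\<lambda>y. adj_mat (shifted z (sample_matrix s n y)) $$ (i, j))"
  unfolding block_fun_def
proof (intro conjI allI exI)
  show "cmod (adj_mat (shifted z (sample_matrix s n y)) $$ (i, j))
      \<le> (fact (n - 1) * ((1 + cmod z) ^ n) ^ n) * dominator s n y" for y
    using adj_shifted_le[OF ij, of z s y] by (simp add: mult.assoc)
qed (simp_all add: measurable_adj_shifted s ij sample_matrix_restrict)

section \<open>Moments and independence of the matrix entries\<close>

lemma prod_power_of_bool:
  fixes x :: "nat \<Rightarrow> 'a :: comm_semiring_1"
  assumes "k < n"
  shows "(\<Prod>m<n. x m ^ of_bool (m = k)) = x k"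
proof -
  have "(\<Prod>m<n. x m ^ of_bool (m = k)) = (\<Prod>m<n. if m = k then x m else 1)"
    by (intro prod.cong) auto
  then show ?thesis using assms by simp
qed

lemma moment_tensor_2:
  fixes mom :: "nat \<Rightarrow> nat \<Rightarrow> nat \<Rightarrow> complex" and n :: nat
  assumes mom: "\<And>m. m < n \<Longrightarrow> mom m 0 0 = 1" "\<And>m. m < n \<Longrightarrow> mom m 1 1 = 1"
      "\<And>m. m < n \<Longrightarrow> mom m 1 0 = 0" "\<And>m. m < n \<Longrightarrow> mom m 0 1 = 0"
    and kl: "k < n" "l < n"
  shows "(\<Prod>m<n. mom m (of_bool (m = k)) (of_bool (m = l))) = of_bool (k = l)"
proof (cases "k = l")
  case True
  have "(\<Prod>m<n. mom m (of_bool (m = k)) (of_bool (m = l))) = (\<Prod>m<n. 1)"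
    using True mom by (intro prod.cong) auto
  then show ?thesis using True by simp
next
  case False
  have "(\<Prod>m<n. mom m (of_bool (m = k)) (of_bool (m = l))) = 0"
  proof -
    have "\<exists>m\<in>{..<n}. mom m (of_bool (m = k)) (of_bool (m = l)) = 0"
      by (rule bexI[of _ k]) (use False mom[of k] kl in simp_all)
    then show ?thesis by (simp only: prod_zero_iff finite_lessThan)
  qed
  then show ?thesis using False by simp
qed

text \<open>
  Wick's formula with a correction for the fourth moment. The mixed third moments \<open>mom m 2 1\<close> and
  \<open>mom m 1 2\<close> are arbitrary: four factors that contain an index three times contain another index exactly
  once, and that index makes the product vanish.
\<close>

lemma moment_tensor_4:
  fixes mom :: "nat \<Rightarrow> nat \<Rightarrow> nat \<Rightarrow> complex" and n :: nat
  assumes mom: "\<And>m. m < n \<Longrightarrow> mom m 0 0 = 1" "\<And>m. m < n \<Longrightarrow> mom m 1 1 = 1" "\<And>m. m < n \<Longrightarrow> mom m 2 2 = c"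
      "\<And>m. m < n \<Longrightarrow> mom m 1 0 = 0" "\<And>m. m < n \<Longrightarrow> mom m 0 1 = 0"
      "\<And>m. m < n \<Longrightarrow> mom m 2 0 = 0" "\<And>m. m < n \<Longrightarrow> mom m 0 2 = 0"
    and ijkl: "i < n" "j < n" "k < n" "l < n"
  shows "(\<Prod>m<n. mom m (of_bool (m = i) + of_bool (m = k)) (of_bool (m = j) + of_bool (m = l)))
    = of_bool (i = j \<and> k = l) + of_bool (i = l \<and> k = j) + (c - 2) * of_bool (i = j \<and> k = j \<and> l = j)"
    (is "?P = ?T")
proof -
  let ?f = "\<lambda>m. mom m (of_bool (m = i) + of_bool (m = k)) (of_bool (m = j) + of_bool (m = l))"
  have zero: "?P = 0" if "m < n" "?f m = 0" for m
  proof -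
    have "\<exists>a\<in>{..<n}. ?f a = 0" by (rule bexI[of _ m]) (use that in simp_all)
    then show ?thesis by (simp only: prod_zero_iff finite_lessThan)
  qed
  show ?thesis
  proof (cases "i = k")
    case ik: True
    show ?thesis
    proof (cases "j = i \<and> l = i")
      case True
      have "?P = (\<Prod>m<n. if m = i then c else 1)"
        using True ik mom by (intro prod.cong) (auto simp: numeral_2_eq_2)
      then show ?thesis using True ik ijkl by simp
    next
      case False
      consider "j \<noteq> i" | "l \<noteq> i" "j = i" using False by auto
      then have "?P = 0"
      proof cases
        case 1
        show ?thesis
          by (rule zero[OF ijkl(2)]) (use 1 ik mom[OF ijkl(2)] in \<open>cases "j = l"; simp add: numeral_2_eq_2\<close>)
      next
        case 2
        show ?thesis
          by (rule zero[OF ijkl(4)]) (use 2 ik mom[OF ijkl(4)] in simp)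
      qed
      moreover have "?T = 0" using False ik by auto
      ultimately show ?thesis by (simp only:)
    qed
  next
    case ik: False
    have "(i = j \<and> k = l) \<or> (i = l \<and> k = j) \<or> (i \<noteq> j \<and> i \<noteq> l) \<or> (k \<noteq> j \<and> k \<noteq> l)"
      using ik by metis
    then show ?thesis
    proof (elim disjE conjE)
      assume eq: "i = j" "k = l"
      have "?P = (\<Prod>m<n. 1)" using eq ik mom by (intro prod.cong) auto
      moreover have "?T = 1" using eq ik by auto
      ultimately show ?thesis by (simp only: prod.neutral_const)
    next
      assume eq: "i = l" "k = j"
      have "?P = (\<Prod>m<n. 1)" using eq ik mom by (intro prod.cong) auto
      moreover have "?T = 1" using eq ik by auto
      ultimately show ?thesis by (simp only: prod.neutral_const)
    next
      assume ne: "i \<noteq> j" "i \<noteq> l"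
      have "?P = 0" by (rule zero[OF ijkl(1)]) (use ne ik mom[OF ijkl(1)] in simp)
      moreover have "?T = 0" using ne by simp
      ultimately show ?thesis by (simp only:)
    next
      assume ne: "k \<noteq> j" "k \<noteq> l"
      have "?P = 0" by (rule zero[OF ijkl(3)]) (use ne ik mom[OF ijkl(3)] in simp)
      moreover have "?T = 0" using ne by auto
      ultimately show ?thesis by (simp only:)
    qed
  qed
qed

lemma tensor_sum:
  fixes X :: "nat \<Rightarrow> nat \<Rightarrow> nat \<Rightarrow> nat \<Rightarrow> complex"
  shows "(\<Sum>i<n. \<Sum>j<n. \<Sum>k<n. \<Sum>l<n.
      (of_bool (i = j \<and> k = l) + of_bool (i = l \<and> k = j) + (c - 2) * of_bool (i = j \<and> k = j \<and> l = j)) * X i j k l)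
    = (\<Sum>i<n. \<Sum>k<n. X i i k k) + (\<Sum>i<n. \<Sum>j<n. X i j j i) + (c - 2) * (\<Sum>i<n. X i i i i)"
proof -
  have row: "(\<Sum>j<n. \<Sum>k<n. \<Sum>l<n.
      (of_bool (i = j \<and> k = l) + of_bool (i = l \<and> k = j) + (c - 2) * of_bool (i = j \<and> k = j \<and> l = j)) * X i j k l)
    = (\<Sum>k<n. X i i k k) + (\<Sum>j<n. X i j j i) + (c - 2) * X i i i i" if i: "i < n" for i
  proof -
    have 1: "(\<Sum>k<n. \<Sum>l<n. of_bool (i = j \<and> k = l) * X i j k l) = (if j = i then \<Sum>k<n. X i i k k else 0)" for j
    proof (cases "j = i")
      case True
      have "(\<Sum>l<n. of_bool (i = j \<and> k = l) * X i j k l) = X i i k k" if "k < n" for k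
      proof -
        have "(\<Sum>l<n. of_bool (i = j \<and> k = l) * X i j k l) = (\<Sum>l<n. if l = k then X i i k k else 0)"
          using True by (intro sum.cong) auto
        then show ?thesis using that by simp
      qed
      then show ?thesis using True by simp
    qed simp
    have 2: "(\<Sum>k<n. \<Sum>l<n. of_bool (i = l \<and> k = j) * X i j k l) = X i j j i" if "j < n" for j
    proof -
      have "(\<Sum>l<n. of_bool (i = l \<and> k = j) * X i j k l) = (\<Sum>l<n. if l = i then if k = j then X i j j i else 0 else 0)" for k
        by (intro sum.cong) auto
      then show ?thesis using i that by simp
    qed
    have 3: "(\<Sum>k<n. \<Sum>l<n. (c - 2) * of_bool (i = j \<and> k = j \<and> l = j) * X i j k l)
        = (if j = i then (c - 2) * X i i i i else 0)" for j
    proof (cases "j = i")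
      case True
      have "(\<Sum>l<n. (c - 2) * of_bool (i = j \<and> k = j \<and> l = j) * X i j k l)
          = (\<Sum>l<n. if l = i then if k = i then (c - 2) * X i i i i else 0 else 0)" for k
        using True by (intro sum.cong) auto
      then show ?thesis using True i by simp
    qed simp
    have mid: "(\<Sum>j<n. \<Sum>k<n. \<Sum>l<n. of_bool (i = l \<and> k = j) * X i j k l) = (\<Sum>j<n. X i j j i)"
      by (intro sum.cong refl) (simp only: lessThan_iff 2)
    show ?thesis
      unfolding distrib_right sum.distrib 1 3 mid using i by simp
  qed
  have "(\<Sum>i<n. \<Sum>j<n. \<Sum>k<n. \<Sum>l<n.
      (of_bool (i = j \<and> k = l) + of_bool (i = l \<and> k = j) + (c - 2) * of_bool (i = j \<and> k = j \<and> l = j)) * X i j k l)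
    = (\<Sum>i<n. (\<Sum>k<n. X i i k k) + (\<Sum>j<n. X i j j i) + (c - 2) * X i i i i)"
    by (intro sum.cong refl) (simp only: lessThan_iff row)
  then show ?thesis
    by (simp only: sum.distrib sum_distrib_left)
qed

locale wigner_moments = hermitian_wigner M Q Xd XRe XIm
  for M :: "'a measure" and Q :: "real measure"
    and Xd :: "nat \<Rightarrow> 'a \<Rightarrow> real" and XRe XIm :: "nat \<Rightarrow> nat \<Rightarrow> 'a \<Rightarrow> real" +
  assumes moment_4: "integrable Q (\<lambda>x. x ^ 4)"
    and mean: "(\<integral>x. x \<partial>Q) = 0"
    and variance_half: "(\<integral>x. x\<^sup>2 \<partial>Q) = 1 / 2"
begin

definition sample :: "'a \<Rightarrow> wigner_index \<Rightarrow> real" where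
  "sample \<omega> k = wigner_variable Xd XRe XIm k \<omega>"

lemma wigner_entry_sample: "wigner_entry Xd XRe XIm \<omega> i j = sample_entry (sample \<omega>) i j"
  by (simp add: sample_entry_def wigner_entry_def sample_def)

lemma measurable_sample: "k \<in> wigner_indices \<Longrightarrow> (\<lambda>\<omega>. sample \<omega> k) \<in> borel_measurable M"
  using indep unfolding indep_vars_def sample_def by auto

lemma integral_sample:
  fixes f :: "real \<Rightarrow> real"
  assumes "k \<in> wigner_indices" "f \<in> borel_measurable borel"
  shows "(\<integral>\<omega>. f (sample \<omega> k) \<partial>M) = (\<integral>x. f x \<partial>Q)"
    and "integrable M (\<lambda>\<omega>. f (sample \<omega> k)) \<longleftrightarrow> integrable Q f"
proof -
  have Q: "distr M borel (\<lambda>\<omega>. sample \<omega> k) = Q"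
    using identically_distributed[OF assms(1)] by (simp add: sample_def)
  show "(\<integral>\<omega>. f (sample \<omega> k) \<partial>M) = (\<integral>x. f x \<partial>Q)"
    unfolding Q[symmetric] by (rule integral_distr[symmetric]) (use assms measurable_sample in auto)
  show "integrable M (\<lambda>\<omega>. f (sample \<omega> k)) \<longleftrightarrow> integrable Q f"
    unfolding Q[symmetric] by (rule integrable_distr_eq[symmetric]) (use assms measurable_sample in auto)
qed

lemma integrable_sample_power:
  assumes k: "k \<in> wigner_indices" and "p \<le> 4"
  shows "integrable M (\<lambda>\<omega>. sample \<omega> k ^ p)"
proof (rule Bochner_Integration.integrable_bound)
  show "integrable M (\<lambda>\<omega>. 1 + sample \<omega> k ^ 4)"
    using integral_sample(2)[OF k, of "\<lambda>x. x ^ 4"] moment_4 by simp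
  show "(\<lambda>\<omega>. sample \<omega> k ^ p) \<in> borel_measurable M"
    using measurable_sample[OF k] by simp
  have "\<bar>x ^ p\<bar> \<le> 1 + x ^ 4" for x :: real
  proof (cases "\<bar>x\<bar> \<le> 1")
    case True
    then have "\<bar>x\<bar> ^ p \<le> 1" by (simp add: power_le_one)
    then show ?thesis by (simp add: power_abs add_increasing2)
  next
    case False
    then have "\<bar>x\<bar> ^ p \<le> \<bar>x\<bar> ^ 4" using assms(2) by (intro power_increasing) auto
    then show ?thesis by (simp add: power_abs)
  qed
  then show "AE \<omega> in M. norm (sample \<omega> k ^ p) \<le> norm (1 + sample \<omega> k ^ 4)"
    by (intro AE_I2) (simp add: order.trans[OF _ abs_ge_self])
qed

lemma expectation_sample:
  assumes k: "k \<in> wigner_indices"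
  shows "(\<integral>\<omega>. sample \<omega> k \<partial>M) = 0" "(\<integral>\<omega>. (sample \<omega> k)\<^sup>2 \<partial>M) = 1 / 2"
    "(\<integral>\<omega>. sample \<omega> k ^ 4 \<partial>M) = (\<integral>x. x ^ 4 \<partial>Q)"
  using integral_sample(1)[OF k, of "\<lambda>x. x"] integral_sample(1)[OF k, of "\<lambda>x. x\<^sup>2"]
    integral_sample(1)[OF k, of "\<lambda>x. x ^ 4"] mean variance_half by simp_all

lemma expectation_sample_prod:
  fixes f g :: "real \<Rightarrow> real"
  assumes kl: "k \<in> wigner_indices" "l \<in> wigner_indices" "k \<noteq> l"
    and f: "f \<in> borel_measurable borel" "integrable M (\<lambda>\<omega>. f (sample \<omega> k))"
    and g: "g \<in> borel_measurable borel" "integrable M (\<lambda>\<omega>. g (sample \<omega> l))"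
  shows "integrable M (\<lambda>\<omega>. f (sample \<omega> k) * g (sample \<omega> l))"
    and "(\<integral>\<omega>. f (sample \<omega> k) * g (sample \<omega> l) \<partial>M)
      = (\<integral>\<omega>. f (sample \<omega> k) \<partial>M) * (\<integral>\<omega>. g (sample \<omega> l) \<partial>M)"
proof -
  define F where "F i = (if i = k then f else g)" for i
  have "indep_vars (\<lambda>_. borel) (\<lambda>i \<omega>. sample \<omega> i) {k, l}"
    using indep_vars_subset[OF indep, of "{k, l}"] kl by (simp add: sample_def)
  then have ind: "indep_vars (\<lambda>_. borel) (\<lambda>i \<omega>. F i (sample \<omega> i)) {k, l}"
    by (rule indep_vars_compose2) (auto simp: F_def f g)
  have int: "integrable M (\<lambda>\<omega>. F i (sample \<omega> i))" if "i \<in> {k, l}" for i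
    using that f g kl by (auto simp: F_def)
  show "integrable M (\<lambda>\<omega>. f (sample \<omega> k) * g (sample \<omega> l))"
    using indep_vars_integrable[OF _ ind int] kl by (simp add: F_def)
  show "(\<integral>\<omega>. f (sample \<omega> k) * g (sample \<omega> l) \<partial>M)
      = (\<integral>\<omega>. f (sample \<omega> k) \<partial>M) * (\<integral>\<omega>. g (sample \<omega> l) \<partial>M)"
    using indep_vars_lebesgue_integral[OF _ ind int] kl by (simp add: F_def)
qed

definition entry_moment :: "nat \<Rightarrow> nat \<Rightarrow> nat \<Rightarrow> nat \<Rightarrow> complex" where
  "entry_moment i j p q = (\<integral>\<omega>. cnj (sample_entry (sample \<omega>) i j) ^ p * sample_entry (sample \<omega>) i j ^ q \<partial>M)"

definition fourth_moment :: real where "fourth_moment = (\<integral>x. x ^ 4 \<partial>Q)"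

context
  fixes i j :: nat
  assumes ij: "i < j"
begin

lemma entry_indices:
  "RePart i j \<in> wigner_indices" "ImPart i j \<in> wigner_indices" "RePart i j \<noteq> ImPart i j"
  using ij by (auto simp: wigner_indices_def)

lemma measurable_entry: "(\<lambda>\<omega>. sample_entry (sample \<omega>) i j) \<in> borel_measurable M"
  using measurable_sample[OF entry_indices(1)] measurable_sample[OF entry_indices(2)]
  by (simp add: sample_entry_simps(2)[OF ij] Complex_eq)

lemma integrable_entry_4: "integrable M (\<lambda>\<omega>. (1 + cmod (sample_entry (sample \<omega>) i j)) ^ 4)"
proof (rule Bochner_Integration.integrable_bound)
  let ?R = "\<lambda>\<omega>. sample \<omega> (RePart i j)" and ?I = "\<lambda>\<omega>. sample \<omega> (ImPart i j)"
  show "integrable M (\<lambda>\<omega>. 8 * (1 + 2 * (?R \<omega> ^ 4 + ?I \<omega> ^ 4)))"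
    using integrable_sample_power[OF entry_indices(1), of 4] integrable_sample_power[OF entry_indices(2), of 4]
    by simp
  show "(\<lambda>\<omega>. (1 + cmod (sample_entry (sample \<omega>) i j)) ^ 4) \<in> borel_measurable M"
    using measurable_entry by simp
  have two: "(a + b)\<^sup>2 \<le> 2 * (a\<^sup>2 + b\<^sup>2)" for a b :: real
    using sum_squares_bound[of a b] by (simp add: power2_sum)
  have "(1 + cmod (Complex r t)) ^ 4 \<le> 8 * (1 + 2 * (r ^ 4 + t ^ 4))" for r t
  proof -
    define x where "x = cmod (Complex r t)"
    have x2: "x\<^sup>2 = r\<^sup>2 + t\<^sup>2" by (simp add: x_def cmod_power2)
    have q: "a ^ 4 = (a\<^sup>2)\<^sup>2" for a :: real by simp
    have "(1 + x) ^ 4 \<le> (2 * (1\<^sup>2 + x\<^sup>2))\<^sup>2"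
      unfolding q using two[of 1 x] by (intro power_mono) auto
    also have "\<dots> = 4 * (1 + x\<^sup>2)\<^sup>2" by (simp only: power_mult_distrib) simp
    also have "\<dots> \<le> 4 * (2 * (1\<^sup>2 + (x\<^sup>2)\<^sup>2))" using two[of 1 "x\<^sup>2"] by simp
    also have "\<dots> = 8 * (1 + (r\<^sup>2 + t\<^sup>2)\<^sup>2)" by (simp add: x2)
    also have "\<dots> \<le> 8 * (1 + 2 * ((r\<^sup>2)\<^sup>2 + (t\<^sup>2)\<^sup>2))" using two[of "r\<^sup>2" "t\<^sup>2"] by simp
    finally show ?thesis by (simp add: x_def q[symmetric])
  qed
  then show "AE \<omega> in M. norm ((1 + cmod (sample_entry (sample \<omega>) i j)) ^ 4)
      \<le> norm (8 * (1 + 2 * (?R \<omega> ^ 4 + ?I \<omega> ^ 4)))"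
    by (intro AE_I2) (simp add: sample_entry_simps(2)[OF ij] order.trans[OF _ abs_ge_self])
qed

lemma integrable_entry_monomial:
  assumes "p + q \<le> 4"
  shows "integrable M (\<lambda>\<omega>. cnj (sample_entry (sample \<omega>) i j) ^ p * sample_entry (sample \<omega>) i j ^ q)"
proof (rule Bochner_Integration.integrable_bound[OF integrable_entry_4])
  have "(\<lambda>\<omega>. cnj (sample_entry (sample \<omega>) i j)) \<in> borel_measurable M"
    using borel_measurable_continuous_on[OF continuous_on_cnj[OF continuous_on_id] measurable_entry] by simp
  then show "(\<lambda>\<omega>. cnj (sample_entry (sample \<omega>) i j) ^ p * sample_entry (sample \<omega>) i j ^ q) \<in> borel_measurable M"
    using measurable_entry by simp
  have "cmod (cnj z ^ p * z ^ q) \<le> (1 + cmod z) ^ 4" for z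
  proof -
    have "cmod (cnj z ^ p * z ^ q) = cmod z ^ (p + q)"
      by (simp add: norm_mult norm_power power_add)
    also have "\<dots> \<le> (1 + cmod z) ^ (p + q)" by (intro power_mono) auto
    also have "\<dots> \<le> (1 + cmod z) ^ 4" using assms by (intro power_increasing) auto
    finally show ?thesis .
  qed
  then show "AE \<omega> in M. norm (cnj (sample_entry (sample \<omega>) i j) ^ p * sample_entry (sample \<omega>) i j ^ q)
      \<le> norm ((1 + cmod (sample_entry (sample \<omega>) i j)) ^ 4)"
    by (intro AE_I2) simp
qed

lemma entry_moment_swap: "entry_moment i j q p = cnj (entry_moment i j p q)"
proof -
  have "cnj (entry_moment i j p q)
      = (\<integral>\<omega>. cnj (cnj (sample_entry (sample \<omega>) i j) ^ p * sample_entry (sample \<omega>) i j ^ q) \<partial>M)"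
    unfolding entry_moment_def by (rule Bochner_Integration.integral_cnj[symmetric])
  then show ?thesis
    by (simp only: entry_moment_def complex_cnj_mult complex_cnj_power complex_cnj_cnj mult.commute)
qed

lemma entry_moment_values:
  "entry_moment i j 0 0 = 1" "entry_moment i j 1 1 = 1" "entry_moment i j 2 2 = of_real (2 * fourth_moment + 1 / 2)"
  "entry_moment i j 1 0 = 0" "entry_moment i j 0 1 = 0" "entry_moment i j 2 0 = 0" "entry_moment i j 0 2 = 0"
proof -
  let ?R = "\<lambda>\<omega>. sample \<omega> (RePart i j)" and ?I = "\<lambda>\<omega>. sample \<omega> (ImPart i j)"
  note R = integrable_sample_power[OF entry_indices(1)] and I = integrable_sample_power[OF entry_indices(2)]
  note ER = expectation_sample[OF entry_indices(1)] and EI = expectation_sample[OF entry_indices(2)]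
  have int [simp]: "integrable M ?R" "integrable M ?I" "integrable M (\<lambda>\<omega>. (?R \<omega>)\<^sup>2)" "integrable M (\<lambda>\<omega>. (?I \<omega>)\<^sup>2)"
    "integrable M (\<lambda>\<omega>. ?R \<omega> ^ 4)" "integrable M (\<lambda>\<omega>. ?I \<omega> ^ 4)"
    using R[of 1] I[of 1] R[of 2] I[of 2] R[of 4] I[of 4] by simp_all
  note RI = expectation_sample_prod[OF entry_indices, of "\<lambda>x. x" "\<lambda>x. x"]
  note R2I2 = expectation_sample_prod[OF entry_indices, of "\<lambda>x. x\<^sup>2" "\<lambda>x. x\<^sup>2"]
  have entry: "sample_entry (sample \<omega>) i j = of_real (?R \<omega>) + \<i> * of_real (?I \<omega>)" for \<omega>
    by (simp add: sample_entry_simps(2)[OF ij] Complex_eq)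
  show "entry_moment i j 0 0 = 1" by (simp add: entry_moment_def prob_space)
  show m01: "entry_moment i j 0 1 = 0"
    unfolding entry_moment_def entry by (simp add: ER EI)
  then show "entry_moment i j 1 0 = 0" using entry_moment_swap[of 1 0] by simp
  show m02: "entry_moment i j 0 2 = 0"
  proof -
    have sq: "(sample_entry (sample \<omega>) i j)\<^sup>2 = of_real ((?R \<omega>)\<^sup>2 - (?I \<omega>)\<^sup>2) + 2 * \<i> * of_real (?R \<omega> * ?I \<omega>)" for \<omega>
      unfolding entry by (simp add: power2_sum power_mult_distrib)
    have "entry_moment i j 0 2 = of_real (\<integral>\<omega>. (?R \<omega>)\<^sup>2 - (?I \<omega>)\<^sup>2 \<partial>M) + 2 * \<i> * of_real (\<integral>\<omega>. ?R \<omega> * ?I \<omega> \<partial>M)"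
      unfolding entry_moment_def sq power_0 mult_1
      by (subst Bochner_Integration.integral_add) (use RI in \<open>simp_all del: of_real_mult of_real_diff add: integral_complex_of_real complex_of_real_integrable_eq\<close>)
    then show ?thesis using RI by (simp add: ER EI)
  qed
  then show "entry_moment i j 2 0 = 0" using entry_moment_swap[of 2 0] by simp
  have norm_sq: "cnj (sample_entry (sample \<omega>) i j) * sample_entry (sample \<omega>) i j
      = of_real ((?R \<omega>)\<^sup>2 + (?I \<omega>)\<^sup>2)" for \<omega>
    unfolding sample_entry_simps(2)[OF ij] by (simp add: complex_eq_iff power2_eq_square)
  show "entry_moment i j 1 1 = 1"
    unfolding entry_moment_def power_one_right norm_sq integral_complex_of_real by (simp add: ER EI)
  have "entry_moment i j 2 2 = (\<integral>\<omega>. of_real (((?R \<omega>)\<^sup>2 + (?I \<omega>)\<^sup>2)\<^sup>2) \<partial>M)"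
    unfolding entry_moment_def power_mult_distrib[symmetric] norm_sq by simp
  also have "\<dots> = of_real (\<integral>\<omega>. ((?R \<omega>)\<^sup>2 + (?I \<omega>)\<^sup>2)\<^sup>2 \<partial>M)"
    by (rule integral_complex_of_real)
  also have "(\<lambda>\<omega>. ((?R \<omega>)\<^sup>2 + (?I \<omega>)\<^sup>2)\<^sup>2) = (\<lambda>\<omega>. ?R \<omega> ^ 4 + ?I \<omega> ^ 4 + 2 * ((?R \<omega>)\<^sup>2 * (?I \<omega>)\<^sup>2))"
    by (simp add: power2_sum mult.assoc)
  also have "(\<integral>\<omega>. ?R \<omega> ^ 4 + ?I \<omega> ^ 4 + 2 * ((?R \<omega>)\<^sup>2 * (?I \<omega>)\<^sup>2) \<partial>M) = 2 * fourth_moment + 1 / 2"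
    using R2I2 by (simp add: ER EI fourth_moment_def)
  finally show "entry_moment i j 2 2 = of_real (2 * fourth_moment + 1 / 2)" .
qed

end

text \<open>
  A partition of the coordinates of the matrix of size \<open>n + 1\<close> into independent groups: one for each
  off-diagonal entry of the last column, one for the corner, and one for the block of size \<open>n\<close>.
\<close>

definition border :: "(nat \<Rightarrow> nat) \<Rightarrow> nat \<Rightarrow> nat \<Rightarrow> wigner_index set" where
  "border s n l = (if l < n then {RePart (s l) (s n), ImPart (s l) (s n)}
    else if l = n then {Diag (s n)} else block s n)"

lemma indep_border:
  assumes s: "strict_mono s"
  shows "indep_vars (\<lambda>l. PiM (border s n l) (\<lambda>_. borel)) (\<lambda>l \<omega>. restrict (sample \<omega>) (border s n l)) {..Suc n}"
proof -
  have less: "s i < s j" if "i < j" for i j using s that by (simp add: strict_mono_less)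
  have inj: "s i = s j \<longleftrightarrow> i = j" for i j using s by (simp add: strict_mono_eq)
  have "indep_vars (\<lambda>_. borel) (\<lambda>k \<omega>. sample \<omega> k) wigner_indices"
    using indep by (simp add: sample_def)
  then show ?thesis
  proof (rule indep_vars_restrict)
    show "border s n l \<subseteq> wigner_indices" if "l \<in> {..Suc n}" for l
      using less by (auto simp: border_def wigner_indices_def block_def)
    show "disjoint_family_on (border s n) {..Suc n}"
      unfolding disjoint_family_on_def border_def block_def by (auto simp: inj)
  qed
qed

lemma border_block_expectation:
  fixes g :: "nat \<Rightarrow> complex \<Rightarrow> 'b :: {real_normed_field, banach, second_countable_topology}"
  assumes s: "strict_mono s"
    and meas: "\<And>m. m < n \<Longrightarrow> g m \<in> borel_measurable borel" "h \<in> borel_measurable borel"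
      "u \<in> borel_measurable (PiM (block s n) (\<lambda>_. borel))"
    and u: "\<And>y. u (restrict y (block s n)) = u y"
    and int: "\<And>m. m < n \<Longrightarrow> integrable M (\<lambda>\<omega>. g m (sample_entry (sample \<omega>) (s m) (s n)))"
      "integrable M (\<lambda>\<omega>. h (sample_entry (sample \<omega>) (s n) (s n)))"
      "integrable M (\<lambda>\<omega>. u (sample \<omega>))"
  shows "has_bochner_integral M
    (\<lambda>\<omega>. (\<Prod>m<n. g m (sample_entry (sample \<omega>) (s m) (s n))) * h (sample_entry (sample \<omega>) (s n) (s n)) * u (sample \<omega>))
    ((\<Prod>m<n. \<integral>\<omega>. g m (sample_entry (sample \<omega>) (s m) (s n)) \<partial>M)
      * (\<integral>\<omega>. h (sample_entry (sample \<omega>) (s n) (s n)) \<partial>M) * (\<integral>\<omega>. u (sample \<omega>) \<partial>M))"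
proof -
  \<comment> \<open>One factor for each group of coordinates of the border; the index \<open>n + 1\<close> belongs to the block.\<close>
  define F where "F l y = (if l < n then g l (of_real (y (RePart (s l) (s n))) + \<i> * of_real (y (ImPart (s l) (s n))))
    else if l = n then h (of_real (sqrt 2 * y (Diag (s n)))) else u y)" for l y
  have less: "s i < s j" if "i < j" for i j using s that by (simp add: strict_mono_less)
  have F_restrict: "F l (restrict (sample \<omega>) (border s n l))
      = (if l < n then g l (sample_entry (sample \<omega>) (s l) (s n))
        else if l = n then h (sample_entry (sample \<omega>) (s n) (s n)) else u (sample \<omega>))" for l \<omega>
    using less by (auto simp: F_def border_def sample_entry_simps u Complex_eq)
  have F_meas: "F l \<in> borel_measurable (PiM (border s n l) (\<lambda>_. borel))" if "l \<in> {..Suc n}" for l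
  proof -
    have comp: "(\<lambda>y. y k) \<in> borel_measurable (PiM (border s n l) (\<lambda>_. borel))" if "k \<in> border s n l" for k
      using that by (rule measurable_component_singleton)
    consider "l < n" | "l = n" | "n < l" by linarith
    then show ?thesis
    proof cases
      case 1
      have "(\<lambda>y. complex_of_real (y (RePart (s l) (s n))) + \<i> * of_real (y (ImPart (s l) (s n))))
          \<in> borel_measurable (PiM (border s n l) (\<lambda>_. borel))"
        using comp[of "RePart (s l) (s n)"] comp[of "ImPart (s l) (s n)"] 1 by (simp add: border_def)
      from measurable_compose[OF this meas(1)[OF 1]] show ?thesis
        using 1 by (simp add: F_def[abs_def])
    next
      case 2
      have "(\<lambda>y. complex_of_real (sqrt 2 * y (Diag (s n)))) \<in> borel_measurable (PiM (border s n l) (\<lambda>_. borel))"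
        using comp[of "Diag (s n)"] 2 by (simp add: border_def)
      from measurable_compose[OF this meas(2)] show ?thesis
        using 2 by (simp add: F_def[abs_def])
    next
      case 3
      then show ?thesis using meas(3) by (simp add: F_def[abs_def] border_def)
    qed
  qed
  have ind: "indep_vars (\<lambda>_. borel) (\<lambda>l \<omega>. F l (restrict (sample \<omega>) (border s n l))) {..Suc n}"
    by (rule indep_vars_compose2[OF indep_border[OF s] F_meas])
  have F_int: "integrable M (\<lambda>\<omega>. F l (restrict (sample \<omega>) (border s n l)))" for l
    unfolding F_restrict using int by (cases "l < n"; cases "l = n") simp_all
  have split: "(\<Prod>l\<in>{..Suc n}. G l) = (\<Prod>m<n. G m) * G n * G (Suc n)" for G :: "nat \<Rightarrow> 'b"
    by (simp add: lessThan_Suc_atMost[symmetric])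
  have "integrable M (\<lambda>\<omega>. \<Prod>l\<in>{..Suc n}. F l (restrict (sample \<omega>) (border s n l)))"
    by (rule indep_vars_integrable[OF _ ind F_int]) simp
  moreover have "(\<integral>\<omega>. (\<Prod>l\<in>{..Suc n}. F l (restrict (sample \<omega>) (border s n l))) \<partial>M)
      = (\<Prod>l\<in>{..Suc n}. \<integral>\<omega>. F l (restrict (sample \<omega>) (border s n l)) \<partial>M)"
    by (rule indep_vars_lebesgue_integral[OF _ ind F_int]) simp
  ultimately show ?thesis
    unfolding has_bochner_integral_iff split F_restrict by simp
qed

lemma measurable_sample_block:
  assumes s: "strict_mono s" and u: "u \<in> borel_measurable (PiM (block s n) (\<lambda>_. borel))"
    "\<And>y. u (restrict y (block s n)) = u y"
  shows "(\<lambda>\<omega>. u (sample \<omega>)) \<in> borel_measurable M"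
proof -
  have "(\<lambda>\<omega>. restrict (sample \<omega>) (border s n (Suc n))) \<in> measurable M (PiM (border s n (Suc n)) (\<lambda>_. borel))"
    using indep_border[OF s, of n] unfolding indep_vars_def by auto
  then have "(\<lambda>\<omega>. restrict (sample \<omega>) (block s n)) \<in> measurable M (PiM (block s n) (\<lambda>_. borel))"
    by (simp add: border_def)
  from measurable_compose[OF this u(1)] show ?thesis by (simp add: u(2))
qed

lemma Diag_index: "Diag i \<in> wigner_indices"
  by (simp add: wigner_indices_def)

lemma integrable_diag:
  "integrable M (\<lambda>\<omega>. sample_entry (sample \<omega>) i i)" "integrable M (\<lambda>\<omega>. (sample_entry (sample \<omega>) i i)\<^sup>2)"
  and expectation_diag: "(\<integral>\<omega>. sample_entry (sample \<omega>) i i \<partial>M) = 0" "(\<integral>\<omega>. (sample_entry (sample \<omega>) i i)\<^sup>2 \<partial>M) = 1"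
proof -
  have sq: "(sample_entry (sample \<omega>) i i)\<^sup>2 = of_real (2 * (sample \<omega> (Diag i))\<^sup>2)" for \<omega>
    by (simp add: sample_entry_simps power_mult_distrib flip: of_real_power of_real_mult)
  have "integrable M (\<lambda>\<omega>. sample \<omega> (Diag i))" "integrable M (\<lambda>\<omega>. (sample \<omega> (Diag i))\<^sup>2)"
    using integrable_sample_power[OF Diag_index, of 1] integrable_sample_power[OF Diag_index, of 2] by simp_all
  note int = this
  show "integrable M (\<lambda>\<omega>. sample_entry (sample \<omega>) i i)"
    unfolding sample_entry_simps(1) complex_of_real_integrable_eq using int by simp
  show "integrable M (\<lambda>\<omega>. (sample_entry (sample \<omega>) i i)\<^sup>2)"
    unfolding sq complex_of_real_integrable_eq using int by simp
  show "(\<integral>\<omega>. sample_entry (sample \<omega>) i i \<partial>M) = 0"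
    unfolding sample_entry_simps(1) integral_complex_of_real using expectation_sample(1)[OF Diag_index] by simp
  show "(\<integral>\<omega>. (sample_entry (sample \<omega>) i i)\<^sup>2 \<partial>M) = 1"
    unfolding sq integral_complex_of_real
    by (simp only: integral_mult_right_zero expectation_sample(2)[OF Diag_index]) simp
qed

text \<open>
  Passing from \<open>n\<close> to \<open>n + 1\<close> multiplies the square by a function of the new row and column, which is
  independent of the block and involves moments of order at most four.
\<close>

lemma integrable_dominator_sq:
  assumes s: "strict_mono s"
  shows "integrable M (\<lambda>\<omega>. (dominator s n (sample \<omega>))\<^sup>2)"
proof (induction n)
  case 0
  then show ?case by (simp add: dominator_def)
next
  case (Suc n)
  have "integrable M (\<lambda>\<omega>. (1 + cmod (sample_entry (sample \<omega>) (s n) (s n)))\<^sup>2)"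
  proof (rule Bochner_Integration.integrable_bound)
    show "integrable M (\<lambda>\<omega>. 2 * (1 + cmod ((sample_entry (sample \<omega>) (s n) (s n))\<^sup>2)))"
      using integrable_diag(2)[of "s n"] by simp
    have "(\<lambda>\<omega>. sample_entry (sample \<omega>) (s n) (s n)) \<in> borel_measurable M"
      using integrable_diag(1)[of "s n"] by simp
    then show "(\<lambda>\<omega>. (1 + cmod (sample_entry (sample \<omega>) (s n) (s n)))\<^sup>2) \<in> borel_measurable M" by simp
    have "(1 + x)\<^sup>2 \<le> 2 * (1 + x\<^sup>2)" for x :: real
      using sum_squares_bound[of 1 x] by (simp add: power2_sum)
    then show "AE \<omega> in M. norm ((1 + cmod (sample_entry (sample \<omega>) (s n) (s n)))\<^sup>2)
        \<le> norm (2 * (1 + cmod ((sample_entry (sample \<omega>) (s n) (s n))\<^sup>2)))"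
      by (intro AE_I2) (simp add: norm_power)
  qed
  moreover have "integrable M (\<lambda>\<omega>. (1 + cmod (sample_entry (sample \<omega>) (s m) (s n))) ^ 4)" if "m < n" for m
    using s that by (intro integrable_entry_4) (simp add: strict_mono_less)
  ultimately have "has_bochner_integral M
    (\<lambda>\<omega>. (\<Prod>m<n. (1 + cmod (sample_entry (sample \<omega>) (s m) (s n))) ^ 4)
      * (1 + cmod (sample_entry (sample \<omega>) (s n) (s n)))\<^sup>2 * (dominator s n (sample \<omega>))\<^sup>2)
    ((\<Prod>m<n. \<integral>\<omega>. (1 + cmod (sample_entry (sample \<omega>) (s m) (s n))) ^ 4 \<partial>M)
      * (\<integral>\<omega>. (1 + cmod (sample_entry (sample \<omega>) (s n) (s n)))\<^sup>2 \<partial>M) * (\<integral>\<omega>. (dominator s n (sample \<omega>))\<^sup>2 \<partial>M))"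
    using Suc measurable_dominator[OF s, of n]
    by (intro border_block_expectation[OF s, where g = "\<lambda>m z. (1 + cmod z) ^ 4"
          and h = "\<lambda>z. (1 + cmod z)\<^sup>2" and u = "\<lambda>y. (dominator s n y)\<^sup>2"])
       (simp_all add: dominator_restrict[OF s])
  moreover have "(\<Prod>m<n. (1 + cmod (sample_entry y (s m) (s n))) ^ 4)
      * (1 + cmod (sample_entry y (s n) (s n)))\<^sup>2 * (dominator s n y)\<^sup>2 = (dominator s (Suc n) y)\<^sup>2" for y
    unfolding dominator_Suc[OF s] by (simp add: power_mult_distrib prod_power_distrib)
  ultimately show ?case by (simp add: has_bochner_integral_iff)
qed

lemma integrable_block_prod:
  assumes s: "strict_mono s" and u: "block_fun s n u" and v: "block_fun s n v"
  shows "integrable M (\<lambda>\<omega>. u (sample \<omega>) * v (sample \<omega>))"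
proof -
  obtain C where C: "cmod (u y) \<le> C * dominator s n y" for y using u unfolding block_fun_def by blast
  obtain D where D: "cmod (v y) \<le> D * dominator s n y" for y using v unfolding block_fun_def by blast
  show ?thesis
  proof (rule Bochner_Integration.integrable_bound)
    show "integrable M (\<lambda>\<omega>. C * D * (dominator s n (sample \<omega>))\<^sup>2)"
      using integrable_dominator_sq[OF s] by simp
    have "(\<lambda>\<omega>. u (sample \<omega>)) \<in> borel_measurable M" "(\<lambda>\<omega>. v (sample \<omega>)) \<in> borel_measurable M"
      using u v by (auto intro!: measurable_sample_block[OF s] simp: block_fun_def)
    then show "(\<lambda>\<omega>. u (sample \<omega>) * v (sample \<omega>)) \<in> borel_measurable M" by simp
    have "cmod (u y * v y) \<le> C * D * (dominator s n y)\<^sup>2" for y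
    proof -
      have "cmod (u y * v y) \<le> (C * dominator s n y) * (D * dominator s n y)"
        unfolding norm_mult using C[of y] D[of y] order.trans[OF norm_ge_zero C[of y]]
        by (intro mult_mono) auto
      then show ?thesis by (simp add: power2_eq_square mult_ac)
    qed
    then show "AE \<omega> in M. norm (u (sample \<omega>) * v (sample \<omega>)) \<le> norm (C * D * (dominator s n (sample \<omega>))\<^sup>2)"
      by (intro AE_I2) (simp only: real_norm_def order.trans[OF _ abs_ge_self])
  qed
qed

lemma border_monomial_expectation:
  assumes s: "strict_mono s" and u: "block_fun s n u" and v: "block_fun s n v"
    and pq: "\<And>m. m < n \<Longrightarrow> p m + q m \<le> 4"
    and h: "h \<in> borel_measurable borel" "integrable M (\<lambda>\<omega>. h (sample_entry (sample \<omega>) (s n) (s n)))"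
  shows "has_bochner_integral M
    (\<lambda>\<omega>. (\<Prod>m<n. cnj (sample_entry (sample \<omega>) (s m) (s n)) ^ p m * sample_entry (sample \<omega>) (s m) (s n) ^ q m)
      * h (sample_entry (sample \<omega>) (s n) (s n)) * (u (sample \<omega>) * v (sample \<omega>)))
    ((\<Prod>m<n. entry_moment (s m) (s n) (p m) (q m)) * (\<integral>\<omega>. h (sample_entry (sample \<omega>) (s n) (s n)) \<partial>M)
      * (\<integral>\<omega>. u (sample \<omega>) * v (sample \<omega>) \<partial>M))"
  unfolding entry_moment_def
proof (rule border_block_expectation[OF s, where g = "\<lambda>m z. cnj z ^ p m * z ^ q m" and u = "\<lambda>y. u y * v y"])
  have "cnj \<in> borel_measurable borel"
    by (intro borel_measurable_continuous_onI continuous_on_cnj continuous_on_id)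
  then show "(\<lambda>z. cnj z ^ p m * z ^ q m) \<in> borel_measurable borel" for m
    by simp
  show "(\<lambda>y. u y * v y) \<in> borel_measurable (PiM (block s n) (\<lambda>_. borel))"
    using u v unfolding block_fun_def by (intro borel_measurable_times) auto
  show "u (restrict y (block s n)) * v (restrict y (block s n)) = u y * v y" for y
    using u v by (simp add: block_fun_def)
  show "integrable M (\<lambda>\<omega>. cnj (sample_entry (sample \<omega>) (s m) (s n)) ^ p m * sample_entry (sample \<omega>) (s m) (s n) ^ q m)"
    if "m < n" for m
    using s that pq by (intro integrable_entry_monomial) (simp_all add: strict_mono_less)
qed (use h integrable_block_prod[OF s u v] in simp_all)

text \<open>
  The fourth absolute moment of the off-diagonal entries. Since they have variance 1, a complex Gaussian
  entry has the value 2.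
\<close>

definition kurtosis :: complex where "kurtosis = of_real (2 * fourth_moment + 1 / 2)"

abbreviation pairing :: "((wigner_index \<Rightarrow> real) \<Rightarrow> complex) \<Rightarrow> ((wigner_index \<Rightarrow> real) \<Rightarrow> complex) \<Rightarrow> complex" where
  "pairing u v \<equiv> (\<integral>\<omega>. u (sample \<omega>) * v (sample \<omega>) \<partial>M)"

lemma border_moments:
  assumes s: "strict_mono s" and u: "block_fun s n u" and v: "block_fun s n v"
  shows border_moment_0: "h \<in> borel_measurable borel \<Longrightarrow> integrable M (\<lambda>\<omega>. h (sample_entry (sample \<omega>) (s n) (s n)))
      \<Longrightarrow> has_bochner_integral M
        (\<lambda>\<omega>. h (sample_entry (sample \<omega>) (s n) (s n)) * (u (sample \<omega>) * v (sample \<omega>)))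
        ((\<integral>\<omega>. h (sample_entry (sample \<omega>) (s n) (s n)) \<partial>M) * pairing u v)"
    and border_moment_2: "h \<in> borel_measurable borel \<Longrightarrow> integrable M (\<lambda>\<omega>. h (sample_entry (sample \<omega>) (s n) (s n)))
      \<Longrightarrow> k < n \<Longrightarrow> l < n \<Longrightarrow> has_bochner_integral M
        (\<lambda>\<omega>. (cnj (sample_entry (sample \<omega>) (s k) (s n)) * sample_entry (sample \<omega>) (s l) (s n))
          * h (sample_entry (sample \<omega>) (s n) (s n)) * (u (sample \<omega>) * v (sample \<omega>)))
        (of_bool (k = l) * (\<integral>\<omega>. h (sample_entry (sample \<omega>) (s n) (s n)) \<partial>M) * pairing u v)"
    and border_moment_4: "i < n \<Longrightarrow> j < n \<Longrightarrow> k < n \<Longrightarrow> l < n \<Longrightarrow> has_bochner_integral M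
        (\<lambda>\<omega>. (cnj (sample_entry (sample \<omega>) (s i) (s n)) * sample_entry (sample \<omega>) (s j) (s n)
          * (cnj (sample_entry (sample \<omega>) (s k) (s n)) * sample_entry (sample \<omega>) (s l) (s n)))
          * (u (sample \<omega>) * v (sample \<omega>)))
        ((of_bool (i = j \<and> k = l) + of_bool (i = l \<and> k = j)
          + (kurtosis - 2) * of_bool (i = j \<and> k = j \<and> l = j)) * pairing u v)"
proof -
  have less: "s m < s n" if "m < n" for m using s that by (simp add: strict_mono_less)
  note mom = entry_moment_values[OF less]
  note mono = border_monomial_expectation[OF s u v]
  {
    assume h: "h \<in> borel_measurable borel" "integrable M (\<lambda>\<omega>. h (sample_entry (sample \<omega>) (s n) (s n)))"
    show "has_bochner_integral M
        (\<lambda>\<omega>. h (sample_entry (sample \<omega>) (s n) (s n)) * (u (sample \<omega>) * v (sample \<omega>)))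
        ((\<integral>\<omega>. h (sample_entry (sample \<omega>) (s n) (s n)) \<partial>M) * pairing u v)"
      using mono[of "\<lambda>_. 0" "\<lambda>_. 0" h, OF _ h] by (simp add: mom(1))
    assume kl: "k < n" "l < n"
    have "(\<Prod>m<n. cnj (x m) ^ of_bool (m = k) * x m ^ of_bool (m = l)) = cnj (x k) * x l" for x :: "nat \<Rightarrow> complex"
      using kl by (simp only: prod.distrib prod_power_of_bool)
    moreover have "(\<Prod>m<n. entry_moment (s m) (s n) (of_bool (m = k)) (of_bool (m = l))) = of_bool (k = l)"
      by (rule moment_tensor_2) (use mom kl in auto)
    ultimately show "has_bochner_integral M
        (\<lambda>\<omega>. (cnj (sample_entry (sample \<omega>) (s k) (s n)) * sample_entry (sample \<omega>) (s l) (s n))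
          * h (sample_entry (sample \<omega>) (s n) (s n)) * (u (sample \<omega>) * v (sample \<omega>)))
        (of_bool (k = l) * (\<integral>\<omega>. h (sample_entry (sample \<omega>) (s n) (s n)) \<partial>M) * pairing u v)"
      using mono[of "\<lambda>m. of_bool (m = k)" "\<lambda>m. of_bool (m = l)" h, OF _ h] by (simp only:) simp
  }
  assume ijkl: "i < n" "j < n" "k < n" "l < n"
  have "(\<Prod>m<n. cnj (x m) ^ (of_bool (m = i) + of_bool (m = k)) * x m ^ (of_bool (m = j) + of_bool (m = l)))
      = cnj (x i) * x j * (cnj (x k) * x l)" for x :: "nat \<Rightarrow> complex"
    using ijkl by (simp only: power_add prod.distrib prod_power_of_bool mult_ac)
  moreover have "(\<Prod>m<n. entry_moment (s m) (s n) (of_bool (m = i) + of_bool (m = k)) (of_bool (m = j) + of_bool (m = l)))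
      = of_bool (i = j \<and> k = l) + of_bool (i = l \<and> k = j) + (kurtosis - 2) * of_bool (i = j \<and> k = j \<and> l = j)"
    by (rule moment_tensor_4) (use mom ijkl in \<open>simp_all add: kurtosis_def\<close>)
  moreover have "of_bool (m = i) + of_bool (m = k) + (of_bool (m = j) + of_bool (m = l)) \<le> (4 :: nat)" for m
    by (simp add: of_bool_def)
  ultimately show "has_bochner_integral M
        (\<lambda>\<omega>. (cnj (sample_entry (sample \<omega>) (s i) (s n)) * sample_entry (sample \<omega>) (s j) (s n)
          * (cnj (sample_entry (sample \<omega>) (s k) (s n)) * sample_entry (sample \<omega>) (s l) (s n)))
          * (u (sample \<omega>) * v (sample \<omega>)))
        ((of_bool (i = j \<and> k = l) + of_bool (i = l \<and> k = j)
          + (kurtosis - 2) * of_bool (i = j \<and> k = j \<and> l = j)) * pairing u v)"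
    using mono[of "\<lambda>m. of_bool (m = i) + of_bool (m = k)" "\<lambda>m. of_bool (m = j) + of_bool (m = l)" "\<lambda>_. 1"]
    by (simp only: mult_1_right borel_measurable_const lebesgue_integral_const) (simp add: prob_space)
qed

end

section \<open>The expected product of two characteristic polynomials\<close>

context wigner_moments
begin

abbreviation charpoly :: "(nat \<Rightarrow> nat) \<Rightarrow> nat \<Rightarrow> (wigner_index \<Rightarrow> real) \<Rightarrow> complex poly" where
  "charpoly s n y \<equiv> char_poly (sample_matrix s n y)"

text \<open>
  The shifted determinant, which is the value at \<open>z\<close> of the characteristic polynomial, as a function of
  the coordinates.
\<close>

definition chi :: "(nat \<Rightarrow> nat) \<Rightarrow> nat \<Rightarrow> complex \<Rightarrow> (wigner_index \<Rightarrow> real) \<Rightarrow> complex" where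
  "chi s n z y = Determinant.det (shifted z (sample_matrix s n y))"

definition adjugate :: "(nat \<Rightarrow> nat) \<Rightarrow> nat \<Rightarrow> complex \<Rightarrow> nat \<Rightarrow> nat \<Rightarrow> (wigner_index \<Rightarrow> real) \<Rightarrow> complex" where
  "adjugate s n z i j y = adj_mat (shifted z (sample_matrix s n y)) $$ (i, j)"

lemma chi_eq: "chi s n z y = poly (charpoly s n y) z"
  unfolding chi_def by (rule det_shifted[OF sample_matrix_carrier])

lemma block_fun_chi: "strict_mono s \<Longrightarrow> block_fun s n (chi s n z)"
  unfolding chi_def[abs_def] by (rule block_fun_det)

lemma block_fun_adjugate: "strict_mono s \<Longrightarrow> i < n \<Longrightarrow> j < n \<Longrightarrow> block_fun s n (adjugate s n z i j)"
  unfolding adjugate_def[abs_def] by (rule block_fun_adj)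

text \<open>
  Each of the two determinants is \<open>(z - d) \<chi>\<^sub>n(z)\<close> minus a sesquilinear form in the new column, \<open>d\<close> being the
  corner. Averaging over the corner and the column, which are independent of the block, contracts the
  forms by the moment formulas: the product of both forms yields a product of traces, a trace of a
  product, and the correction from the fourth moment.
\<close>

lemma pairing_chi_Suc:
  assumes s: "strict_mono s"
  shows "pairing (chi s (Suc n) a) (chi s (Suc n) b)
    = (1 + a * b) * pairing (chi s n a) (chi s n b)
      - a * (\<Sum>k<n. pairing (chi s n a) (adjugate s n b k k))
      - b * (\<Sum>k<n. pairing (adjugate s n a k k) (chi s n b))
      + (\<Sum>i<n. \<Sum>k<n. pairing (adjugate s n a i i) (adjugate s n b k k))
      + (\<Sum>i<n. \<Sum>j<n. pairing (adjugate s n a i j) (adjugate s n b j i))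
      + (kurtosis - 2) * (\<Sum>i<n. pairing (adjugate s n a i i) (adjugate s n b i i))"
proof -
  define v where "v m \<omega> = sample_entry (sample \<omega>) (s m) (s n)" for m \<omega>
  define d where "d \<omega> = sample_entry (sample \<omega>) (s n) (s n)" for \<omega>
  let ?D = "\<lambda>z \<omega>. chi s n z (sample \<omega>)" and ?J = "\<lambda>z i j \<omega>. adjugate s n z i j (sample \<omega>)"
  note [simp] = block_fun_chi[OF s] block_fun_adjugate[OF s]
  note int_d = integrable_diag[of "s n", folded d_def] and E_d = expectation_diag[of "s n", folded d_def]
  have linear: "integrable M (\<lambda>\<omega>. z - d \<omega>)" "(\<integral>\<omega>. z - d \<omega> \<partial>M) = z" for z
    using int_d E_d by (simp_all add: prob_space)
  have quad: "(a - d \<omega>) * (b - d \<omega>) = a * b - (a + b) * d \<omega> + (d \<omega>)\<^sup>2" for \<omega>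
    by (simp add: algebra_simps power2_eq_square)
  have quadratic: "integrable M (\<lambda>\<omega>. (a - d \<omega>) * (b - d \<omega>))" "(\<integral>\<omega>. (a - d \<omega>) * (b - d \<omega>) \<partial>M) = 1 + a * b"
    unfolding quad using int_d E_d by (simp_all add: prob_space)
  have expand: "chi s (Suc n) a (sample \<omega>) * chi s (Suc n) b (sample \<omega>)
      = (a - d \<omega>) * (b - d \<omega>) * (?D a \<omega> * ?D b \<omega>)
        - (\<Sum>k<n. \<Sum>l<n. (cnj (v k \<omega>) * v l \<omega>) * (a - d \<omega>) * (?D a \<omega> * ?J b k l \<omega>))
        - (\<Sum>i<n. \<Sum>j<n. (cnj (v i \<omega>) * v j \<omega>) * (b - d \<omega>) * (?J a i j \<omega> * ?D b \<omega>))
        + (\<Sum>i<n. \<Sum>j<n. \<Sum>k<n. \<Sum>l<n. (cnj (v i \<omega>) * v j \<omega> * (cnj (v k \<omega>) * v l \<omega>)) * (?J a i j \<omega> * ?J b k l \<omega>))" for \<omega>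
  proof -
    define A where "A z = (z - d \<omega>) * ?D z \<omega>" for z
    define B where "B z = (\<Sum>i<n. \<Sum>j<n. cnj (v i \<omega>) * v j \<omega> * ?J z i j \<omega>)" for z
    have split: "chi s (Suc n) z (sample \<omega>) = A z - B z" for z
      unfolding chi_def det_shifted_sample_Suc[OF s] A_def B_def v_def d_def adjugate_def ..
    have "chi s (Suc n) a (sample \<omega>) * chi s (Suc n) b (sample \<omega>) = A a * A b - A a * B b - B a * A b + B a * B b"
      unfolding split by (simp add: algebra_simps)
    also have "A a * A b = (a - d \<omega>) * (b - d \<omega>) * (?D a \<omega> * ?D b \<omega>)"
      by (simp only: A_def mult_ac)
    also have "A a * B b = (\<Sum>k<n. \<Sum>l<n. (cnj (v k \<omega>) * v l \<omega>) * (a - d \<omega>) * (?D a \<omega> * ?J b k l \<omega>))"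
      by (simp only: A_def B_def sum_distrib_left mult_ac)
    also have "B a * A b = (\<Sum>i<n. \<Sum>j<n. (cnj (v i \<omega>) * v j \<omega>) * (b - d \<omega>) * (?J a i j \<omega> * ?D b \<omega>))"
      by (simp only: A_def B_def sum_distrib_left sum_distrib_right mult_ac)
    also have "B a * B b = (\<Sum>i<n. \<Sum>j<n. \<Sum>k<n. \<Sum>l<n.
        (cnj (v i \<omega>) * v j \<omega> * (cnj (v k \<omega>) * v l \<omega>)) * (?J a i j \<omega> * ?J b k l \<omega>))"
    proof -
      have "B a * B b = (\<Sum>i<n. \<Sum>j<n. (cnj (v i \<omega>) * v j \<omega> * ?J a i j \<omega>) * B b)"
        unfolding B_def[of a] by (simp only: sum_distrib_right)
      also have "\<dots> = (\<Sum>i<n. \<Sum>j<n. \<Sum>k<n. \<Sum>l<n.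
          (cnj (v i \<omega>) * v j \<omega> * ?J a i j \<omega>) * (cnj (v k \<omega>) * v l \<omega> * ?J b k l \<omega>))"
        unfolding B_def by (simp only: sum_distrib_left)
      finally show ?thesis by (simp only: mult_ac)
    qed
    finally show ?thesis .
  qed
  have meas: "(\<lambda>z :: complex. (a - z) * (b - z)) \<in> borel_measurable borel"
    "(\<lambda>z :: complex. c - z) \<in> borel_measurable borel" for c by simp_all
  have moment_0: "has_bochner_integral M (\<lambda>\<omega>. (a - d \<omega>) * (b - d \<omega>) * (u (sample \<omega>) * w (sample \<omega>)))
      ((1 + a * b) * pairing u w)" if "block_fun s n u" "block_fun s n w" for u w
    using border_moment_0[OF s that meas(1)] quadratic unfolding d_def by simp
  have moment_2: "has_bochner_integral M
      (\<lambda>\<omega>. (cnj (v k \<omega>) * v l \<omega>) * (c - d \<omega>) * (u (sample \<omega>) * w (sample \<omega>)))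
      (of_bool (k = l) * c * pairing u w)"
    if "k < n" "l < n" "block_fun s n u" "block_fun s n w" for k l c u w
    using border_moment_2[OF s that(3,4) meas(2) _ that(1,2), of c] linear[of c] unfolding v_def d_def by simp
  have moment_4: "has_bochner_integral M
      (\<lambda>\<omega>. (cnj (v i \<omega>) * v j \<omega> * (cnj (v k \<omega>) * v l \<omega>)) * (u (sample \<omega>) * w (sample \<omega>)))
      ((of_bool (i = j \<and> k = l) + of_bool (i = l \<and> k = j)
        + (kurtosis - 2) * of_bool (i = j \<and> k = j \<and> l = j)) * pairing u w)"
    if "i < n" "j < n" "k < n" "l < n" "block_fun s n u" "block_fun s n w" for i j k l u w
    using border_moment_4[OF s that(5,6,1,2,3,4)] unfolding v_def .
  have "has_bochner_integral M (\<lambda>\<omega>. chi s (Suc n) a (sample \<omega>) * chi s (Suc n) b (sample \<omega>))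
     ((1 + a * b) * pairing (chi s n a) (chi s n b)
      - (\<Sum>k<n. \<Sum>l<n. of_bool (k = l) * a * pairing (chi s n a) (adjugate s n b k l))
      - (\<Sum>i<n. \<Sum>j<n. of_bool (i = j) * b * pairing (adjugate s n a i j) (chi s n b))
      + (\<Sum>i<n. \<Sum>j<n. \<Sum>k<n. \<Sum>l<n.
          (of_bool (i = j \<and> k = l) + of_bool (i = l \<and> k = j) + (kurtosis - 2) * of_bool (i = j \<and> k = j \<and> l = j))
            * pairing (adjugate s n a i j) (adjugate s n b k l)))"
    unfolding expand
    by (intro has_bochner_integral_add has_bochner_integral_diff has_bochner_integral_sum moment_0 moment_2 moment_4)
       simp_all
  then have "pairing (chi s (Suc n) a) (chi s (Suc n) b)
    = (1 + a * b) * pairing (chi s n a) (chi s n b)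
      - (\<Sum>k<n. \<Sum>l<n. of_bool (k = l) * a * pairing (chi s n a) (adjugate s n b k l))
      - (\<Sum>i<n. \<Sum>j<n. of_bool (i = j) * b * pairing (adjugate s n a i j) (chi s n b))
      + (\<Sum>i<n. \<Sum>j<n. \<Sum>k<n. \<Sum>l<n.
          (of_bool (i = j \<and> k = l) + of_bool (i = l \<and> k = j) + (kurtosis - 2) * of_bool (i = j \<and> k = j \<and> l = j))
            * pairing (adjugate s n a i j) (adjugate s n b k l))"
    by (rule has_bochner_integral_integral_eq)
  moreover have diag: "(\<Sum>k<n. \<Sum>l<n. of_bool (k = l) * c * X k l) = c * (\<Sum>k<n. X k k)" for c and X :: "nat \<Rightarrow> nat \<Rightarrow> complex"
  proof -
    have "(\<Sum>l<n. of_bool (k = l) * c * X k l) = c * X k k" if "k < n" for k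
    proof -
      have "(\<Sum>l<n. of_bool (k = l) * c * X k l) = (\<Sum>l<n. if l = k then c * X k k else 0)"
        by (intro sum.cong) auto
      then show ?thesis using that by simp
    qed
    then show ?thesis by (simp add: sum_distrib_left)
  qed
  ultimately show ?thesis
    unfolding tensor_sum diag by (simp add: algebra_simps)
qed


text \<open>
  Linear functionals of the characteristic polynomial are combinations of finitely many of its values.
  Knowing the expectation of \<open>\<chi>\<^sub>n(x) \<chi>\<^sub>n(z)\<close> for \<open>x \<noteq> z\<close> is enough, because the nodes for the two
  functionals can be chosen disjoint.
\<close>

lemma functional_expectation:
  fixes \<Lambda> \<Lambda>' :: "complex poly \<Rightarrow> complex"
  assumes s: "strict_mono s"
    and base: "\<And>x z. x \<noteq> z \<Longrightarrow> pairing (chi s n x) (chi s n z) = fact n * corrected_kernel \<gamma> n (he x) (he z)"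
    and \<Lambda>: "\<And>p q. \<Lambda> (p + q) = \<Lambda> p + \<Lambda> q" "\<And>c p. \<Lambda> (Polynomial.smult c p) = c * \<Lambda> p"
    and \<Lambda>': "\<And>p q. \<Lambda>' (p + q) = \<Lambda>' p + \<Lambda>' q" "\<And>c p. \<Lambda>' (Polynomial.smult c p) = c * \<Lambda>' p"
  shows "has_bochner_integral M (\<lambda>\<omega>. \<Lambda> (charpoly s n (sample \<omega>)) * \<Lambda>' (charpoly s n (sample \<omega>)))
    (fact n * corrected_kernel \<gamma> n (\<lambda>k. \<Lambda> (hermite k)) (\<lambda>k. \<Lambda>' (hermite k)))"
proof -
  define S where "S = (of_nat ` {..n} :: complex set)"
  \<comment> \<open>\<open>n + 1\<close> nodes determine a polynomial of degree \<open>n\<close>; disjoint node sets avoid equal arguments.\<close>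
  define S' where "S' = (of_nat ` {Suc n..Suc (n + n)} :: complex set)"
  have fin: "finite S" "finite S'" and card: "card S = Suc n" "card S' = Suc n"
    by (simp_all add: S_def S'_def card_image inj_on_def)
  have disjoint: "x \<noteq> z" if "x \<in> S" "z \<in> S'" for x z
    using that by (auto simp: S_def S'_def)
  obtain w where w: "\<And>p. degree p < card S \<Longrightarrow> \<Lambda> p = (\<Sum>x\<in>S. w x * poly p x)"
    using linear_functional_from_values[of S \<Lambda>, OF fin(1) \<Lambda>] by blast
  obtain w' where w': "\<And>p. degree p < card S' \<Longrightarrow> \<Lambda>' p = (\<Sum>z\<in>S'. w' z * poly p z)"
    using linear_functional_from_values[of S' \<Lambda>', OF fin(2) \<Lambda>'] by blast
  have deg: "degree (charpoly s n y) < Suc n" for y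
    using degree_monic_char_poly[OF sample_matrix_carrier, of s n y] by simp
  have deg_hermite: "degree (hermite k :: complex poly) < Suc n" if "k \<le> n" for k
    using degree_hermite[of k, where 'a = complex] that by linarith
  have prod_eq: "\<Lambda> (charpoly s n y) * \<Lambda>' (charpoly s n y)
      = (\<Sum>x\<in>S. \<Sum>z\<in>S'. w x * w' z * (chi s n x y * chi s n z y))" for y
    unfolding w[OF deg[folded card(1)]] w'[OF deg[folded card(2)]] sum_product chi_eq
    by (intro sum.cong refl) (simp add: mult_ac)
  have "has_bochner_integral M (\<lambda>\<omega>. \<Sum>x\<in>S. \<Sum>z\<in>S'. w x * w' z * (chi s n x (sample \<omega>) * chi s n z (sample \<omega>)))
      (\<Sum>x\<in>S. \<Sum>z\<in>S'. w x * w' z * (fact n * corrected_kernel \<gamma> n (he x) (he z)))"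
  proof (intro has_bochner_integral_sum has_bochner_integral_mult_right)
    fix x z assume "x \<in> S" "z \<in> S'"
    then show "has_bochner_integral M (\<lambda>\<omega>. chi s n x (sample \<omega>) * chi s n z (sample \<omega>)) (fact n * corrected_kernel \<gamma> n (he x) (he z))"
      unfolding has_bochner_integral_iff
      using base[OF disjoint] integrable_block_prod[OF s block_fun_chi[OF s] block_fun_chi[OF s]] by blast
  qed
  moreover have "(\<Sum>x\<in>S. \<Sum>z\<in>S'. w x * w' z * (fact n * corrected_kernel \<gamma> n (he x) (he z)))
      = fact n * corrected_kernel \<gamma> n (\<lambda>k. \<Lambda> (hermite k)) (\<lambda>k. \<Lambda>' (hermite k))"
  proof -
    have "corrected_kernel \<gamma> n (\<lambda>k. \<Lambda> (hermite k)) (\<lambda>k. \<Lambda>' (hermite k))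
        = corrected_kernel \<gamma> n (\<lambda>k. \<Sum>x\<in>S. w x * he x k) (\<lambda>k. \<Sum>z\<in>S'. w' z * he z k)"
      by (intro corrected_kernel_cong w w') (simp_all add: card deg_hermite)
    also have "\<dots> = (\<Sum>x\<in>S. w x * corrected_kernel \<gamma> n (he x) (\<lambda>k. \<Sum>z\<in>S'. w' z * he z k))"
      by (rule corrected_kernel_sum_left)
    also have "\<dots> = (\<Sum>x\<in>S. w x * corrected_kernel \<gamma> n (\<lambda>k. \<Sum>z\<in>S'. w' z * he z k) (he x))"
      by (intro sum.cong refl arg_cong2[where f = times] corrected_kernel_commute)
    also have "\<dots> = (\<Sum>x\<in>S. w x * (\<Sum>z\<in>S'. w' z * corrected_kernel \<gamma> n (he z) (he x)))"
      by (intro sum.cong refl arg_cong2[where f = times] corrected_kernel_sum_left)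
    also have "\<dots> = (\<Sum>x\<in>S. w x * (\<Sum>z\<in>S'. w' z * corrected_kernel \<gamma> n (he x) (he z)))"
      by (intro sum.cong refl arg_cong2[where f = times] corrected_kernel_commute)
    finally show ?thesis by (simp only: sum_distrib_left mult_ac)
  qed
  ultimately show ?thesis unfolding prod_eq by simp
qed

text \<open>
  Half the deviation of the fourth absolute moment from 2, in terms of the distribution of the real
  coordinates; see \<open>excess_kurtosis\<close>.
\<close>

definition excess :: real where "excess = fourth_moment - 3 / 4"

lemma excess_kurtosis: "2 * of_real excess = kurtosis - 2"
  by (simp add: excess_def kurtosis_def)

text \<open>
  Both sides satisfy the same recursion in \<open>n\<close>. The induction runs over all index maps \<open>s\<close> at once, since
  the recursion refers to principal submatrices of size \<open>n - 1\<close>. It yields the claim for \<open>a \<noteq> b\<close>, where one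
  may divide by \<open>a - b\<close>, and interpolation extends it to \<open>a = b\<close>.
\<close>

theorem pairing_chi:
  assumes "strict_mono s"
  shows "pairing (chi s n a) (chi s n b) = fact n * corrected_kernel (of_real excess) n (he a) (he b)"
  using assms
proof (induction n arbitrary: s a b rule: less_induct)
  case (less n)
  note s = less.prems
  let ?\<gamma> = "of_real excess :: complex"
  have off_diagonal: "pairing (chi s n x) (chi s n z) = fact n * corrected_kernel ?\<gamma> n (he x) (he z)" if xz: "x \<noteq> z" for x z
  proof (cases n)
    case 0
    have "chi s 0 t y = 1" for t y
      unfolding chi_def by (rule det_dim_zero) simp
    then show ?thesis by (simp add: 0 corrected_kernel_def cd_kernel_def prob_space)
  next
    case (Suc m)
    have IH: "pairing (chi s m x) (chi s m z) = fact m * corrected_kernel ?\<gamma> m (he x) (he z)" for x z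
      using less.IH[of m s] s Suc by simp
    note functional = functional_expectation[OF s IH]
    have val: "poly (p + q) t = poly p t + poly q t" "poly (Polynomial.smult c p) t = c * poly p t"
      and der: "poly (pderiv (p + q)) t = poly (pderiv p) t + poly (pderiv q) t"
        "poly (pderiv (Polynomial.smult c p)) t = c * poly (pderiv p) t" for p q :: "complex poly" and c t
      by (simp_all add: pderiv_add pderiv_smult)
    have VD: "has_bochner_integral M (\<lambda>\<omega>. poly (charpoly s m (sample \<omega>)) x * poly (pderiv (charpoly s m (sample \<omega>))) z)
        (fact m * corrected_kernel ?\<gamma> m (he x) (he' z))"
      by (rule functional) (rule val der)+
    have DV: "has_bochner_integral M (\<lambda>\<omega>. poly (pderiv (charpoly s m (sample \<omega>))) x * poly (charpoly s m (sample \<omega>)) z)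
        (fact m * corrected_kernel ?\<gamma> m (he' x) (he z))"
      by (rule functional) (rule val der)+
    have DD: "has_bochner_integral M (\<lambda>\<omega>. poly (pderiv (charpoly s m (sample \<omega>))) x * poly (pderiv (charpoly s m (sample \<omega>))) z)
        (fact m * corrected_kernel ?\<gamma> m (he' x) (he' z))"
      by (rule functional) (rule val der)+
    note int = integrable_block_prod[OF s]
    note bf = block_fun_chi[OF s, of m] block_fun_adjugate[OF s]
    have trace: "(\<Sum>k<m. adjugate s m t k k y) = poly (pderiv (charpoly s m y)) t" for t y
      unfolding adjugate_def by (rule trace_adj_shifted[OF sample_matrix_carrier])
    have t1: "(\<Sum>k<m. pairing (chi s m x) (adjugate s m z k k)) = fact m * corrected_kernel ?\<gamma> m (he x) (he' z)"
    proof -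
      have "(\<Sum>k<m. pairing (chi s m x) (adjugate s m z k k))
          = (\<integral>\<omega>. (\<Sum>k<m. chi s m x (sample \<omega>) * adjugate s m z k k (sample \<omega>)) \<partial>M)"
        by (rule Bochner_Integration.integral_sum[symmetric]) (auto intro!: int bf)
      also have "\<dots> = fact m * corrected_kernel ?\<gamma> m (he x) (he' z)"
        unfolding sum_distrib_left[symmetric] trace chi_eq using VD by (rule has_bochner_integral_integral_eq)
      finally show ?thesis .
    qed
    have t2: "(\<Sum>k<m. pairing (adjugate s m x k k) (chi s m z)) = fact m * corrected_kernel ?\<gamma> m (he' x) (he z)"
    proof -
      have "(\<Sum>k<m. pairing (adjugate s m x k k) (chi s m z))
          = (\<integral>\<omega>. (\<Sum>k<m. adjugate s m x k k (sample \<omega>) * chi s m z (sample \<omega>)) \<partial>M)"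
        by (rule Bochner_Integration.integral_sum[symmetric]) (auto intro!: int bf)
      also have "\<dots> = fact m * corrected_kernel ?\<gamma> m (he' x) (he z)"
        unfolding sum_distrib_right[symmetric] trace chi_eq using DV by (rule has_bochner_integral_integral_eq)
      finally show ?thesis .
    qed
    have t3: "(\<Sum>i<m. \<Sum>k<m. pairing (adjugate s m x i i) (adjugate s m z k k)) = fact m * corrected_kernel ?\<gamma> m (he' x) (he' z)"
    proof -
      have "(\<Sum>i<m. \<Sum>k<m. pairing (adjugate s m x i i) (adjugate s m z k k))
          = (\<Sum>i<m. \<integral>\<omega>. (\<Sum>k<m. adjugate s m x i i (sample \<omega>) * adjugate s m z k k (sample \<omega>)) \<partial>M)"
        by (intro sum.cong refl Bochner_Integration.integral_sum[symmetric]) (auto intro!: int bf)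
      also have "\<dots> = (\<integral>\<omega>. (\<Sum>i<m. \<Sum>k<m. adjugate s m x i i (sample \<omega>) * adjugate s m z k k (sample \<omega>)) \<partial>M)"
        by (rule Bochner_Integration.integral_sum[symmetric]) (auto intro!: int bf Bochner_Integration.integrable_sum)
      also have "\<dots> = fact m * corrected_kernel ?\<gamma> m (he' x) (he' z)"
        unfolding sum_product[symmetric] trace using DD by (rule has_bochner_integral_integral_eq)
      finally show ?thesis .
    qed
    have t4: "(\<Sum>i<m. \<Sum>j<m. pairing (adjugate s m x i j) (adjugate s m z j i))
        = fact m * (corrected_kernel ?\<gamma> m (he x) (he' z) - corrected_kernel ?\<gamma> m (he' x) (he z)) / (x - z)"
    proof -
      have "(\<Sum>i<m. \<Sum>j<m. pairing (adjugate s m x i j) (adjugate s m z j i))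
          = (\<Sum>i<m. \<integral>\<omega>. (\<Sum>j<m. adjugate s m x i j (sample \<omega>) * adjugate s m z j i (sample \<omega>)) \<partial>M)"
        by (intro sum.cong refl Bochner_Integration.integral_sum[symmetric]) (auto intro!: int bf)
      also have "\<dots> = (\<integral>\<omega>. (\<Sum>i<m. \<Sum>j<m. adjugate s m x i j (sample \<omega>) * adjugate s m z j i (sample \<omega>)) \<partial>M)"
        by (rule Bochner_Integration.integral_sum[symmetric]) (auto intro!: int bf Bochner_Integration.integrable_sum)
      also have "\<dots> = (\<integral>\<omega>. (poly (charpoly s m (sample \<omega>)) x * poly (pderiv (charpoly s m (sample \<omega>))) z
          - poly (pderiv (charpoly s m (sample \<omega>))) x * poly (charpoly s m (sample \<omega>)) z) / (x - z) \<partial>M)"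
      proof (intro Bochner_Integration.integral_cong refl)
        fix \<omega>
        show "(\<Sum>i<m. \<Sum>j<m. adjugate s m x i j (sample \<omega>) * adjugate s m z j i (sample \<omega>))
          = (poly (charpoly s m (sample \<omega>)) x * poly (pderiv (charpoly s m (sample \<omega>))) z
          - poly (pderiv (charpoly s m (sample \<omega>))) x * poly (charpoly s m (sample \<omega>)) z) / (x - z)"
          unfolding resolvent_identity_adj[OF sample_matrix_carrier, symmetric] adjugate_def using xz by simp
      qed
      also have "\<dots> = (fact m * corrected_kernel ?\<gamma> m (he x) (he' z) - fact m * corrected_kernel ?\<gamma> m (he' x) (he z)) / (x - z)"
        by (intro has_bochner_integral_integral_eq has_bochner_integral_divide_zero has_bochner_integral_diff VD DV)
      finally show ?thesis by (simp only: right_diff_distrib)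
    qed
    have t5: "(\<Sum>i<m. pairing (adjugate s m x i i) (adjugate s m z i i))
        = (if m = 0 then 0 else fact m * corrected_kernel ?\<gamma> (m - 1) (he x) (he z))"
    proof -
      have "pairing (adjugate s m x i i) (adjugate s m z i i) = fact (m - 1) * corrected_kernel ?\<gamma> (m - 1) (he x) (he z)"
        if i: "i < m" for i
      proof -
        have "adjugate s m t i i y = chi (s \<circ> insert_index i) (m - 1) t y" for t y
          unfolding adjugate_def adj_shifted_diag[OF sample_matrix_carrier i] mat_delete_sample_matrix[OF i] chi_eq ..
        moreover have "strict_mono (s \<circ> insert_index i)"
          using s strict_mono_insert_index by (rule strict_mono_o)
        moreover have "m - 1 < n"
          using Suc by simp
        ultimately show ?thesis
          by (simp only: less.IH)
      qed
      then have "(\<Sum>i<m. pairing (adjugate s m x i i) (adjugate s m z i i))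
          = (\<Sum>i<m. fact (m - 1) * corrected_kernel ?\<gamma> (m - 1) (he x) (he z))"
        by (intro sum.cong) auto
      then show ?thesis by (cases m) simp_all
    qed
    have "pairing (chi s (Suc m) x) (chi s (Suc m) z)
      = fact m * ((1 + x * z) * corrected_kernel ?\<gamma> m (he x) (he z) - x * corrected_kernel ?\<gamma> m (he x) (he' z)
      - z * corrected_kernel ?\<gamma> m (he' x) (he z) + corrected_kernel ?\<gamma> m (he' x) (he' z)
      + (corrected_kernel ?\<gamma> m (he x) (he' z) - corrected_kernel ?\<gamma> m (he' x) (he z)) / (x - z)
      + (if m = 0 then 0 else 2 * ?\<gamma> * corrected_kernel ?\<gamma> (m - 1) (he x) (he z)))"
      unfolding pairing_chi_Suc[OF s] t1 t2 t3 t4 t5 IH excess_kurtosis[symmetric]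
      by (simp add: algebra_simps)
    then show ?thesis
      unfolding corrected_kernel_recursion[OF xz] Suc by (simp only: fact_Suc mult_ac)
  qed
  show ?case
  proof -
    have "has_bochner_integral M (\<lambda>\<omega>. poly (charpoly s n (sample \<omega>)) a * poly (charpoly s n (sample \<omega>)) b)
        (fact n * corrected_kernel ?\<gamma> n (he a) (he b))"
      by (rule functional_expectation[OF s off_diagonal]) simp_all
    then show ?thesis unfolding chi_eq by (rule has_bochner_integral_integral_eq)
  qed
qed

lemma wigner_det_eq_chi:
  "complex_of_real (wigner_det Xd XRe XIm N \<xi> \<eta> \<omega>)
    = (- 1) ^ N * chi id N (of_real (sqrt (real N) * \<xi> + \<eta> / (sqrt (real N) * semicircle_density \<xi>))) (sample \<omega>)"
proof -
  let ?z = "complex_of_real (sqrt (real N) * \<xi> + \<eta> / (sqrt (real N) * semicircle_density \<xi>))"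
  have W: "wigner_matrix Xd XRe XIm N \<omega> = sample_matrix id N (sample \<omega>)"
    by (simp add: wigner_matrix_def sample_matrix_def wigner_entry_sample)
  have "wigner_matrix Xd XRe XIm N \<omega> - ?z \<cdot>\<^sub>m 1\<^sub>m N = (- 1) \<cdot>\<^sub>m shifted ?z (sample_matrix id N (sample \<omega>))"
    unfolding W by (intro eq_matI) (auto simp: shifted_def)
  then show ?thesis
    unfolding of_real_wigner_det chi_def by (simp add: det_smult)
qed

theorem expectation_wigner_det:
  "(\<integral>\<omega>. wigner_det Xd XRe XIm N \<xi> \<mu> \<omega> * wigner_det Xd XRe XIm N \<xi> \<nu> \<omega> \<partial>M)
    = fact N * corrected_kernel excess N (he (spectral_point \<xi> \<mu> N)) (he (spectral_point \<xi> \<nu> N))"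
proof -
  have sign: "((- 1) ^ N * u) * ((- 1) ^ N * v) = u * v" for u v :: complex
    by (simp add: power_mult_distrib[symmetric] flip: power_add mult.assoc)
  have "complex_of_real (\<integral>\<omega>. wigner_det Xd XRe XIm N \<xi> \<mu> \<omega> * wigner_det Xd XRe XIm N \<xi> \<nu> \<omega> \<partial>M)
      = (\<integral>\<omega>. complex_of_real (wigner_det Xd XRe XIm N \<xi> \<mu> \<omega>) * complex_of_real (wigner_det Xd XRe XIm N \<xi> \<nu> \<omega>) \<partial>M)"
    by (simp only: integral_complex_of_real[symmetric] of_real_mult)
  also have "\<dots> = pairing (chi id N (of_real (spectral_point \<xi> \<mu> N))) (chi id N (of_real (spectral_point \<xi> \<nu> N)))"
    unfolding wigner_det_eq_chi sign spectral_point_def ..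
  also have "\<dots> = fact N * corrected_kernel (of_real excess) N (he (of_real (spectral_point \<xi> \<mu> N))) (he (of_real (spectral_point \<xi> \<nu> N)))"
    by (rule pairing_chi) (simp add: strict_mono_def)
  also have "\<dots> = complex_of_real (fact N * corrected_kernel excess N (he (spectral_point \<xi> \<mu> N)) (he (spectral_point \<xi> \<nu> N)))"
    by (simp add: corrected_kernel_of_real)
  finally show ?thesis by (simp only: of_real_eq_iff)
qed

end

theorem corollary1p2:
  fixes M :: "'a measure" and Q :: "real measure"
    and Xd :: "nat \<Rightarrow> 'a \<Rightarrow> real" and XRe XIm :: "nat \<Rightarrow> nat \<Rightarrow> 'a \<Rightarrow> real"
    and \<xi> \<mu> \<nu> :: real
  assumes "real_distribution Q"
    and "integrable Q (\<lambda>x. x ^ 4)"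
    and "(\<integral>x. x \<partial>Q) = 0"
    and "(\<integral>x. x\<^sup>2 \<partial>Q) = 1 / 2"
    and "hermitian_wigner M Q Xd XRe XIm"
    and "- 2 < \<xi>" and "\<xi> < 2"
  shows "(\<lambda>N.
            (\<integral>\<omega>. wigner_det Xd XRe XIm N \<xi> \<mu> \<omega> * wigner_det Xd XRe XIm N \<xi> \<nu> \<omega> \<partial>M) /
            (sqrt (\<integral>\<omega>. (wigner_det Xd XRe XIm N \<xi> \<mu> \<omega>)\<^sup>2 \<partial>M) *
             sqrt (\<integral>\<omega>. (wigner_det Xd XRe XIm N \<xi> \<nu> \<omega>)\<^sup>2 \<partial>M)))
         \<longlonglongrightarrow> sinc (pi * (\<mu> - \<nu>))"
proof -
  interpret hermitian_wigner M Q Xd XRe XIm by fact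
  interpret wigner_moments M Q Xd XRe XIm
    by unfold_locales (use assms in auto)
  have cancel: "fact N * u / (sqrt (fact N * v) * sqrt (fact N * w)) = u / (sqrt v * sqrt w)" for N u v w
  proof -
    have "sqrt (fact N * v) * sqrt (fact N * w) = (sqrt (fact N) * sqrt (fact N)) * (sqrt v * sqrt w)"
      by (simp only: real_sqrt_mult mult_ac)
    also have "\<dots> = fact N * (sqrt v * sqrt w)" by simp
    finally show ?thesis by simp
  qed
  show ?thesis
    unfolding power2_eq_square expectation_wigner_det cancel
    by (rule corrected_kernel_sinc) fact+
qed

end
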